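(* Let $\mathcal{M}^2$ be one of $\mathbb{R}^2$, $\mathbb{H}^2$, $\mathbb{S}^2$, and let $0<w\le r$, where in the case $\mathcal{M}^2=\mathbb{S}^2$ we also assume $r<\frac{\pi}{2}$. Then there exist constants $c>0$ and $\varepsilon^*>0$, depending only on $w$, $r$ and $\mathcal{M}^2$, such that for every $\varepsilon\in(0,\varepsilon^* )$ there is an $r$-ball convex body $K_\varepsilon\subset\mathcal{M}^2$ of minimal width $w$ with $$\operatorname{area}(K_\varepsilon)=\operatorname{area}(T_{w,r})+\varepsilon$$ and $$\delta(K_\varepsilon,\phi T_{w,r})\ge c\,\varepsilon\quad\text{for every isometry }\phi\colon\mathcal{M}^2\to\mathcal{M}^2 .$$
   Context: $\mathbb{R}^2$, $\mathbb{H}^2$, $\mathbb{S}^2$ are the Euclidean plane, the hyperbolic plane (curvature $-1$) and the unit sphere (curvature $1$), with geodesic metric $d$ and the usual area. A set is convex if it contains the geodesic segment joining any two of its points (in $\mathbb{S}^2$ it is moreover required to be contained in an open hemisphere). A convex body is a compact convex set with non-empty interior. A convex body is $r$-ball convex if it equals the intersection of all closed geodesic disks of radius $r$ containing it (with $r<\pi/2$ in $\mathbb{S}^2$). Width: for a convex body $K$ and a supporting line $H$, in $\mathbb{R}^2$ and $\mathbb{H}^2$ the width $w(K,H)$ is the distance between $H$ and a farthest supporting line of $K$ that is parallel or ultraparallel to $H$. In $\mathbb{S}^2$, a lune is the intersection of two different closed hemispheres with non-antipodal centers; its corner is the intersection of its two bounding great circles and its breadth is the angle between the bounding great circles; a lune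 $L$ supports $K$ if $K\subset L$ and $K$ meets both great circles bounding $L$ outside the corner; $w(K,H)$ is the minimum breadth of all lunes supporting $K$ one of whose bounding great circles is $H$. The minimal width of $K$ is the minimum of $w(K,H)$ over all supporting lines $H$. $T_{w,r}$ denotes the $r$-disk triangle (intersection of three disks of radius $r$ whose centers are the vertices of a regular triangle) of minimal width $w$; it is unique up to isometry for $0<w\le r$. $\delta$ is the Hausdorff distance: $\delta(A,B)=\max\{\sup_{a\in A}d(a,B),\sup_{b\in B}d(b,A)\}$. *)

theory Defs
  imports "HOL-Analysis.Analysis"
begin

text \<open>
  The three planes live in \<open>real^3\<close> so that their lines are exactly the nonempty intersections
  with planes through the origin: the Euclidean plane is the affine plane \<open>x $ 3 = 1\<close>, the
  hyperbolic plane is the upper sheet of the hyperboloid, and the sphere is the unit sphere.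
\<close>

datatype geometry = Euclidean | Hyperbolic | Spherical

primrec points :: "geometry \<Rightarrow> (real^3) set" where
  "points Euclidean = {x. x $ 3 = 1}"
| "points Hyperbolic = {x. x $ 3 > 0 \<and> (x $ 3)\<^sup>2 = 1 + (x $ 1)\<^sup>2 + (x $ 2)\<^sup>2}"
| "points Spherical = sphere 0 1"

primrec gdist :: "geometry \<Rightarrow> real^3 \<Rightarrow> real^3 \<Rightarrow> real" where
  "gdist Euclidean x y = dist x y"
| "gdist Hyperbolic x y = arcosh (x $ 3 * y $ 3 - x $ 1 * y $ 1 - x $ 2 * y $ 2)"
| "gdist Spherical x y = arccos (x \<bullet> y)"

definition lift :: "real^2 \<Rightarrow> real \<Rightarrow> real^3" where
  "lift p t = vector [p $ 1, p $ 2, t]"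

text \<open>
  Riemannian area in the charts given by the first two coordinates. The induced metric at \<open>p\<close> is
  \<open>I - p p\<^sup>T / (1 + |p|\<^sup>2)\<close> on the hyperboloid and \<open>I + p p\<^sup>T / (1 - |p|\<^sup>2)\<close> on each open
  hemisphere, so the area densities are \<open>1 / sqrt (1 + |p|\<^sup>2)\<close> and \<open>1 / sqrt (1 - |p|\<^sup>2)\<close>.
  The equator, missed by the two spherical charts, has area zero.
\<close>

primrec area :: "geometry \<Rightarrow> (real^3) set \<Rightarrow> real" where
  "area Euclidean A = measure lebesgue {p. lift p 1 \<in> A}"
| "area Hyperbolic A =
     (LINT p:{p. lift p (sqrt (1 + (norm p)\<^sup>2)) \<in> A}|lebesgue. 1 / sqrt (1 + (norm p)\<^sup>2))"
| "area Spherical A =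
     (LINT p:{p \<in> ball 0 1. lift p (sqrt (1 - (norm p)\<^sup>2)) \<in> A}|lebesgue. 1 / sqrt (1 - (norm p)\<^sup>2))
   + (LINT p:{p \<in> ball 0 1. lift p (- sqrt (1 - (norm p)\<^sup>2)) \<in> A}|lebesgue. 1 / sqrt (1 - (norm p)\<^sup>2))"

definition isometry_of :: "geometry \<Rightarrow> (real^3 \<Rightarrow> real^3) \<Rightarrow> bool" where
  "isometry_of M \<phi> \<longleftrightarrow> bij_betw \<phi> (points M) (points M) \<and>
     (\<forall>x\<in>points M. \<forall>y\<in>points M. gdist M (\<phi> x) (\<phi> y) = gdist M x y)"

definition hausdorff_distance :: "geometry \<Rightarrow> (real^3) set \<Rightarrow> (real^3) set \<Rightarrow> real" where
  "hausdorff_distance M A B =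
     max (SUP a\<in>A. INF b\<in>B. gdist M a b) (SUP b\<in>B. INF a\<in>A. gdist M b a)"

definition geodesic_segment :: "geometry \<Rightarrow> real^3 \<Rightarrow> real^3 \<Rightarrow> (real^3) set" where
  "geodesic_segment M x y = {z \<in> points M. gdist M x z + gdist M z y = gdist M x y}"

definition convex_in :: "geometry \<Rightarrow> (real^3) set \<Rightarrow> bool" where
  "convex_in M K \<longleftrightarrow> K \<subseteq> points M \<and> (\<forall>x\<in>K. \<forall>y\<in>K. geodesic_segment M x y \<subseteq> K) \<and>
     (M = Spherical \<longrightarrow> (\<exists>a\<in>sphere 0 1. \<forall>x\<in>K. a \<bullet> x > 0))"

definition convex_body :: "geometry \<Rightarrow> (real^3) set \<Rightarrow> bool" where
  "convex_body M K \<longleftrightarrow> compact K \<and> convex_in M K \<and> top_of_set (points M) interior_of K \<noteq> {}"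

definition disk :: "geometry \<Rightarrow> real^3 \<Rightarrow> real \<Rightarrow> (real^3) set" where
  "disk M x r = {y \<in> points M. gdist M x y \<le> r}"

definition ball_convex_body :: "geometry \<Rightarrow> real \<Rightarrow> (real^3) set \<Rightarrow> bool" where
  "ball_convex_body M r K \<longleftrightarrow> convex_body M K \<and>
     K = points M \<inter> \<Inter>{disk M x r | x. x \<in> points M \<and> K \<subseteq> disk M x r}"

definition supporting_line :: "geometry \<Rightarrow> (real^3) set \<Rightarrow> (real^3) set \<Rightarrow> bool" where
  "supporting_line M K H \<longleftrightarrow>
     (\<exists>n. n \<noteq> 0 \<and> H = {x \<in> points M. n \<bullet> x = 0} \<and> (\<forall>x\<in>K. n \<bullet> x \<ge> 0)) \<and> K \<inter> H \<noteq> {}"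

text \<open>
  In the Euclidean and the hyperbolic plane, two distinct lines are parallel or ultraparallel
  iff they are disjoint. The distance between hyperbolic (limiting) parallel lines is zero.
\<close>

definition line_distance :: "geometry \<Rightarrow> (real^3) set \<Rightarrow> (real^3) set \<Rightarrow> real" where
  "line_distance M H H' = (INF (x, y)\<in>H \<times> H'. gdist M x y)"

text \<open>
  On the sphere, \<open>lune a b\<close> is the intersection of the closed hemispheres centered at \<open>a\<close> and \<open>b\<close>.
  The interior angle between its bounding great circles is \<open>pi\<close> minus the distance of the centers.
\<close>

definition lune :: "real^3 \<Rightarrow> real^3 \<Rightarrow> (real^3) set" where
  "lune a b = {x \<in> sphere 0 1. a \<bullet> x \<ge> 0 \<and> b \<bullet> x \<ge> 0}"

definition lune_breadth :: "real^3 \<Rightarrow> real^3 \<Rightarrow> real" where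
  "lune_breadth a b = pi - gdist Spherical a b"

definition great_circle :: "real^3 \<Rightarrow> (real^3) set" where
  "great_circle a = {x \<in> sphere 0 1. a \<bullet> x = 0}"

definition supporting_lune :: "(real^3) set \<Rightarrow> real^3 \<Rightarrow> real^3 \<Rightarrow> bool" where
  "supporting_lune K a b \<longleftrightarrow>
     a \<in> sphere 0 1 \<and> b \<in> sphere 0 1 \<and> a \<noteq> b \<and> a \<noteq> - b \<and> K \<subseteq> lune a b \<and>
     K \<inter> (great_circle a - great_circle b) \<noteq> {} \<and> K \<inter> (great_circle b - great_circle a) \<noteq> {}"

text \<open>
  Maxima and minima are rendered as \<open>Sup\<close> and \<open>Inf\<close>. Since \<open>lune a b = lune b a\<close>, it is no
  restriction that \<open>H\<close> bounds the first hemisphere.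
\<close>

definition width :: "geometry \<Rightarrow> (real^3) set \<Rightarrow> (real^3) set \<Rightarrow> real" where
  "width M K H =
     (if M = Spherical
      then Inf {lune_breadth a b | a b. supporting_lune K a b \<and> great_circle a = H}
      else Sup {line_distance M H H' | H'. supporting_line M K H' \<and> H \<inter> H' = {}})"

definition minimal_width :: "geometry \<Rightarrow> (real^3) set \<Rightarrow> real" where
  "minimal_width M K = Inf {width M K H | H. supporting_line M K H}"

definition regular_triangle :: "geometry \<Rightarrow> real^3 \<Rightarrow> real^3 \<Rightarrow> real^3 \<Rightarrow> bool" where
  "regular_triangle M x y z \<longleftrightarrow>
     {x, y, z} \<subseteq> points M \<and> gdist M x y = gdist M y z \<and> gdist M y z = gdist M z x \<and>
     \<not> (\<exists>n. n \<noteq> 0 \<and> n \<bullet> x = 0 \<and> n \<bullet> y = 0 \<and> n \<bullet> z = 0)"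

definition is_disk_triangle :: "geometry \<Rightarrow> real \<Rightarrow> (real^3) set \<Rightarrow> bool" where
  "is_disk_triangle M r T \<longleftrightarrow>
     (\<exists>x y z. regular_triangle M x y z \<and> T = disk M x r \<inter> disk M y r \<inter> disk M z r)"

text \<open>
  \<open>disk_triangle M w r\<close> is a representative of \<open>T\<^bsub>w,r\<^esub>\<close>, which for \<open>0 < w \<le> r\<close> (and \<open>r < pi / 2\<close> on
  the sphere) exists and is unique up to isometry. Minimal width is only meaningful for convex
  bodies, so degenerate intersections of three disks are excluded.
\<close>

definition disk_triangle :: "geometry \<Rightarrow> real \<Rightarrow> real \<Rightarrow> (real^3) set" where
  "disk_triangle M w r =
     (SOME T. is_disk_triangle M r T \<and> convex_body M T \<and> minimal_width M T = w)"

text \<open>The Euclidean model is the library's plane \<open>real^2\<close> with its distance and Lebesgue measure.\<close>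

lemma lift_nth [simp]: "lift p t $ 1 = p $ 1" "lift p t $ 2 = p $ 2" "lift p t $ 3 = t"
  by (simp_all add: lift_def)

lemma bij_betw_lift_Euclidean: "bij_betw (\<lambda>p. lift p 1) UNIV (points Euclidean)"
  by (rule bij_betw_byWitness[where f' = "\<lambda>x. vector [x $ 1, x $ 2]"])
     (auto simp: vec_eq_iff forall_2 forall_3)

lemma gdist_lift_Euclidean: "gdist Euclidean (lift p 1) (lift q 1) = dist p q"
  by (simp add: dist_vec_def L2_set_def sum_2 sum_3)

lemma area_lift_Euclidean: "area Euclidean ((\<lambda>p. lift p 1) ` A) = measure lebesgue A"
proof -
  have "{p. lift p 1 \<in> (\<lambda>p. lift p 1) ` A} = A"
    using bij_betw_lift_Euclidean by (auto simp: bij_betw_def inj_on_def)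
  then show ?thesis by simp
qed

end

theory Submission
  imports Defs
begin

text \<open>
  The three planes are handled simultaneously. Each of them is a component of a level set \<open>dual M x x = 1\<close> in
  \<open>real^3\<close>, geodesics are the curves \<open>gcos M s *\<^sub>R p + gsin M s *\<^sub>R u\<close>, and distances enter only through
  \<open>haver M x y = gver M (gdist M x y)\<close>, the versine of the distance, which is a quadratic (for curved
  \<open>M\<close> even an affine) expression in each point. A disk of radius \<open>r\<close> becomes an inequality
  \<open>haver M x y \<le> gver M r\<close>, and the trigonometry of the three planes becomes one set of
  formulas with the curvature \<open>kappa M\<close> as a parameter.

  The disk triangle \<open>T\<close> is the intersection of the disks of radius \<open>r\<close> around three points
  \<open>x 0, x 1, x 2\<close> at distance \<open>R\<close> from a center \<open>m\<close>, in directions that make angles of 120 degrees. Its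
  vertex \<open>v i\<close>, common to the circles around the other two centers, lies at distance \<open>\<tau> \<le> R\<close> from \<open>m\<close> in
  the direction of \<open>x i\<close>. The minimal width of \<open>T\<close> is \<open>r - (R - \<tau>)\<close>: it is the length of the axis from the vertex \<open>v 0\<close>
  to the opposite arc.

  The body \<open>Ks s\<close> arises from \<open>T\<close> by replacing the center \<open>x 2\<close> with a center \<open>z s\<close> on the circle of radius
  \<open>r\<close> around \<open>v 0\<close>, moved from \<open>x 2\<close> towards \<open>x 1\<close> as \<open>s\<close> grows. The disk around \<open>z s\<close> contains the
  intersection of the disks around \<open>x 1\<close> and \<open>x 2\<close> (\<open>in_disk_of_positive_combination\<close>), so \<open>Ks s\<close> contains \<open>T\<close>.

  The minimal width does not change. For the lower bound, the disk of radius \<open>r\<close> whose boundary passes through a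
  boundary point of \<open>Ks s\<close> with the same inner normal contains \<open>Ks s\<close> and hence \<open>T\<close>; and the center of a disk of radius \<open>r\<close> containing \<open>T\<close> has distance at most \<open>R - \<tau>\<close> from \<open>T\<close>
  (\<open>ex_near_point_of_T\<close>). So \<open>T\<close> has a point at distance at least
  \<open>r - (R - \<tau>)\<close> from every supporting line of \<open>Ks s\<close>. For the upper bound, the strip orthogonal to the axis through \<open>v 0\<close> still supports \<open>Ks s\<close> as long as
  \<open>s \<le> 1 / 2\<close>, that is, as long as \<open>z s\<close> has not passed that axis.

  The Hausdorff distance grows linearly in \<open>s\<close>. Every isometric copy of \<open>T\<close> lies in a disk of radius \<open>\<tau>\<close>, so a
  copy at Hausdorff distance \<open>h\<close> from \<open>Ks s\<close> forces \<open>Ks s\<close> into a disk of radius \<open>\<tau> + h\<close>. But \<open>Ks s\<close> contains \<open>v 0\<close>,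
  \<open>v 2\<close> and a point \<open>P (rate * s)\<close> of the circle around \<open>x 0\<close> beyond \<open>v 1\<close>, and the sum of the mutual values of
  \<open>haver\<close> for these points exceeds that for the vertices of \<open>T\<close> by a multiple of \<open>s\<close>; this gives
  \<open>c * s \<le> h\<close> (\<open>Hausdorff_bound\<close>).

  The area grows at most linearly in \<open>s\<close>. The area of a set is three times the volume of the cone over it with
  apex \<open>0\<close> (\<open>area_cone_over\<close>), and a contraction of \<open>real^3\<close> towards \<open>m\<close> maps a cone whose defining
  inequality is relaxed by \<open>\<delta>\<close> back into the cone; hence the volume is Lipschitz in \<open>s\<close> (\<open>vol_lipschitz\<close>). Since it is
  larger than the volume for \<open>T\<close> when \<open>s > 0\<close> (\<open>vol_strict\<close>), the intermediate value theorem yields a parameter \<open>s\<close> at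
  which the area is exactly that of \<open>T\<close> plus \<open>\<epsilon>\<close>, and that \<open>s\<close> is at least a multiple of \<open>\<epsilon>\<close>. Combined with
  the linear growth of the Hausdorff distance this proves the theorem.

  Finally, every \<open>r\<close>-disk triangle of minimal width \<open>w \<le> r\<close> has the form assumed for \<open>T\<close>, with \<open>0 < \<tau> \<le> R < r\<close>
  (\<open>disk_triangle_structure\<close>): interior points force \<open>R < r\<close>, and if \<open>\<tau> \<le> R\<close> failed, the centers would be at
  mutual distances less than \<open>r\<close>, which makes the minimal width larger than \<open>r\<close>.
\<close>

section \<open>A common model of the three planes\<close>

text \<open>
  The functions \<open>gcos\<close> and \<open>gsin\<close> are the solutions of \<open>y'' = - kappa M * y\<close> with initial values
  \<open>(1, 0)\<close> and \<open>(0, 1)\<close>. The versine \<open>gver\<close> is \<open>(1 - gcos) / kappa\<close>, continued to curvature \<open>0\<close> by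
  its limit.
\<close>
primrec kappa :: "geometry \<Rightarrow> real" where
  "kappa Euclidean = 0" | "kappa Hyperbolic = -1" | "kappa Spherical = 1"
primrec gcos :: "geometry \<Rightarrow> real \<Rightarrow> real" where
  "gcos Euclidean s = 1" | "gcos Hyperbolic s = cosh s" | "gcos Spherical s = cos s"
primrec gsin :: "geometry \<Rightarrow> real \<Rightarrow> real" where
  "gsin Euclidean s = s" | "gsin Hyperbolic s = sinh s" | "gsin Spherical s = sin s"
primrec gver :: "geometry \<Rightarrow> real \<Rightarrow> real" where
  "gver Euclidean s = s\<^sup>2 / 2" | "gver Hyperbolic s = cosh s - 1" | "gver Spherical s = 1 - cos s"

text \<open>
  On tangent vectors \<open>form\<close> is the Riemannian metric: on the Euclidean plane, whose tangent
  vectors have third coordinate \<open>0\<close>, it ignores that coordinate, and on the hyperboloid it is the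
  Lorentz form. The form \<open>dual\<close> defines the plane by \<open>dual M x x = 1\<close>, its orthogonality \<open>dual M p
  u = 0\<close> defines the tangent vectors at \<open>p\<close>, and on the plane it equals \<open>gcos\<close> of the distance.
  For nonzero curvature the two forms are proportional; keeping both makes the formulas valid for
  curvature \<open>0\<close> as well. The number \<open>haver\<close>, half the squared chord, is \<open>gver\<close> of the distance.
\<close>
definition form :: "geometry \<Rightarrow> real^3 \<Rightarrow> real^3 \<Rightarrow> real" where
  "form M u v = u $ 1 * v $ 1 + u $ 2 * v $ 2 + kappa M * (u $ 3 * v $ 3)"
definition haver :: "geometry \<Rightarrow> real^3 \<Rightarrow> real^3 \<Rightarrow> real" where
  "haver M x y = form M (x - y) (x - y) / 2"
definition dual :: "geometry \<Rightarrow> real^3 \<Rightarrow> real^3 \<Rightarrow> real" where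
  "dual M x y = x $ 3 * y $ 3 + kappa M * (x $ 1 * y $ 1 + x $ 2 * y $ 2)"
definition unit :: "geometry \<Rightarrow> real^3 \<Rightarrow> real^3 \<Rightarrow> bool" where
  "unit M p u \<longleftrightarrow> dual M p u = 0 \<and> form M u u = 1"

lemma gcos_0 [simp]: "gcos M 0 = 1" by (cases M) auto
lemma gsin_0 [simp]: "gsin M 0 = 0" by (cases M) auto
lemma gver_0 [simp]: "gver M 0 = 0" by (cases M) auto
lemma gcos_minus [simp]: "gcos M (- s) = gcos M s" by (cases M) auto
lemma gsin_minus [simp]: "gsin M (- s) = - gsin M s" by (cases M) auto
lemma gver_minus [simp]: "gver M (- s) = gver M s" by (cases M) auto
lemma gcos_gver: "gcos M s = 1 - kappa M * gver M s" by (cases M) auto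
lemma gcos_gsin: "(gcos M s)\<^sup>2 + kappa M * (gsin M s)\<^sup>2 = 1"
  by (cases M) (auto simp: cosh_square_eq)
lemma gsin_squared: "(gsin M s)\<^sup>2 = gver M s * (1 + gcos M s)"
proof -
  have "(1 - c) * (1 + c) = 1 - c\<^sup>2" "(c - 1) * (1 + c) = c\<^sup>2 - 1" for c :: real
    by (simp_all add: power2_eq_square algebra_simps)
  then show ?thesis by (cases M) (simp_all add: sinh_square_eq sin_squared_eq)
qed
lemma gcos_add: "gcos M (s + t) = gcos M s * gcos M t - kappa M * (gsin M s * gsin M t)"
  by (cases M) (auto simp: cosh_add cos_add)
lemma gsin_add: "gsin M (s + t) = gsin M s * gcos M t + gcos M s * gsin M t"
  by (cases M) (auto simp: sinh_add sin_add)
lemma gver_add: "gver M (s + t) = gcos M s * gver M t + gver M s + gsin M s * gsin M t"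
  by (cases M) (auto simp: cosh_add cos_add power2_eq_square algebra_simps)
lemma gver_diff: "gver M (s - t) = gcos M s * gver M t + gver M s - gsin M s * gsin M t"
  using gver_add[of M s "-t"] by simp

text \<open>The values that distances attain; on this set \<open>gver\<close> is injective.\<close>
definition lengths :: "geometry \<Rightarrow> real set" where
  "lengths M = {s. 0 \<le> s \<and> (M = Spherical \<longrightarrow> s \<le> pi)}"

lemma gver_strict_mono: "s \<in> lengths M \<Longrightarrow> t \<in> lengths M \<Longrightarrow> s < t \<Longrightarrow> gver M s < gver M t"
  by (cases M) (auto simp: lengths_def cosh_real_strict_mono cos_monotone_0_pi power_strict_mono)
lemma gver_less_iff: "s \<in> lengths M \<Longrightarrow> t \<in> lengths M \<Longrightarrow> gver M s < gver M t \<longleftrightarrow> s < t"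
  using gver_strict_mono[of s M t] gver_strict_mono[of t M s] by (cases s t rule: linorder_cases) auto
lemma gver_le_iff: "s \<in> lengths M \<Longrightarrow> t \<in> lengths M \<Longrightarrow> gver M s \<le> gver M t \<longleftrightarrow> s \<le> t"
  by (simp add: gver_less_iff linorder_not_less[symmetric])
lemma gver_eq_iff: "s \<in> lengths M \<Longrightarrow> t \<in> lengths M \<Longrightarrow> gver M s = gver M t \<longleftrightarrow> s = t"
  by (simp add: gver_le_iff order.eq_iff)
lemma gver_nonneg: "0 \<le> gver M s"
  by (cases M) (auto simp: cosh_real_ge_1)
lemma gsin_nonneg: "s \<in> lengths M \<Longrightarrow> 0 \<le> gsin M s"
  by (cases M) (auto simp: lengths_def sin_ge_zero)

text \<open>The radii of disks that are convex.\<close>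
definition acute :: "geometry \<Rightarrow> real \<Rightarrow> bool" where
  "acute M s \<longleftrightarrow> 0 \<le> s \<and> (M = Spherical \<longrightarrow> s < pi / 2)"

lemma acute_lengths: "acute M s \<Longrightarrow> s \<in> lengths M"
  unfolding acute_def lengths_def using pi_gt_zero by auto
lemma acute_add: "acute M s \<Longrightarrow> acute M t \<Longrightarrow> s + t \<in> lengths M"
  unfolding acute_def lengths_def by auto
lemma acute_mono: "acute M s \<Longrightarrow> 0 \<le> t \<Longrightarrow> t \<le> s \<Longrightarrow> acute M t"
  unfolding acute_def by auto
lemma gcos_pos: "acute M s \<Longrightarrow> 0 < gcos M s"
  by (cases M) (auto simp: acute_def cosh_real_pos intro!: cos_gt_zero_pi)
lemma gsin_pos: "acute M s \<Longrightarrow> 0 < s \<Longrightarrow> 0 < gsin M s"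
  by (cases M) (auto simp: acute_def intro!: sin_gt_zero)
lemma gsin_mono: "acute M t \<Longrightarrow> 0 \<le> s \<Longrightarrow> s \<le> t \<Longrightarrow> gsin M s \<le> gsin M t"
  by (cases M) (auto simp: acute_def intro!: sin_monotone_2pi_le)
lemma gsin_strict_mono: "acute M t \<Longrightarrow> 0 \<le> s \<Longrightarrow> s < t \<Longrightarrow> gsin M s < gsin M t"
  by (cases M) (auto simp: acute_def intro!: sin_monotone_2pi)
lemma continuous_on_gcos [continuous_intros]:
  fixes f :: "'a::t2_space \<Rightarrow> real"
  shows "continuous_on A f \<Longrightarrow> continuous_on A (\<lambda>x. gcos M (f x))"
  by (cases M) (simp_all add: continuous_on_cos continuous_on_cosh)
lemma continuous_on_gsin [continuous_intros]:
  fixes f :: "'a::t2_space \<Rightarrow> real"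
  shows "continuous_on A f \<Longrightarrow> continuous_on A (\<lambda>x. gsin M (f x))"
  by (cases M) (simp_all add: continuous_on_sin continuous_on_sinh)
lemma continuous_on_gver [continuous_intros]:
  fixes f :: "'a::t2_space \<Rightarrow> real"
  shows "continuous_on A f \<Longrightarrow> continuous_on A (\<lambda>x. gver M (f x))"
  by (cases M) (simp_all add: continuous_on_cos continuous_on_cosh continuous_on_power continuous_on_diff continuous_on_divide)

lemma in_points: "x \<in> points M \<longleftrightarrow>
    (x $ 3)\<^sup>2 + kappa M * ((x $ 1)\<^sup>2 + (x $ 2)\<^sup>2) = 1 \<and> (M \<noteq> Spherical \<longrightarrow> 0 < x $ 3)"
proof (cases M)
  case Euclidean
  have "(x $ 3)\<^sup>2 = 1 \<and> x $ 3 > 0 \<longleftrightarrow> x $ 3 = 1"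
    by (smt (verit) one_power2 power2_eq_1_iff)
  then show ?thesis using Euclidean by simp
next
  case Spherical
  have "norm x = 1 \<longleftrightarrow> (norm x)\<^sup>2 = 1"
    by (smt (verit) one_power2 power2_eq_1_iff norm_ge_zero)
  also have "(norm x)\<^sup>2 = (x $ 1)\<^sup>2 + (x $ 2)\<^sup>2 + (x $ 3)\<^sup>2"
    by (simp only: power2_norm_eq_inner) (simp add: inner_vec_def sum_3 power2_eq_square)
  finally show ?thesis using Spherical by (simp add: algebra_simps)
next
  case Hyperbolic
  then show ?thesis by (simp add: algebra_simps) auto
qed

declare points.simps [simp del]

lemma points_dual: "x \<in> points M \<Longrightarrow> dual M x x = 1"
  by (simp add: in_points dual_def power2_eq_square)

lemma form_commute: "form M u v = form M v u" by (simp add: form_def mult.commute)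
lemma form_add [simp]: "form M (u + v) w = form M u w + form M v w" "form M w (u + v) = form M w u + form M w v"
  by (simp_all add: form_def algebra_simps)
lemma form_diff [simp]: "form M (u - v) w = form M u w - form M v w" "form M w (u - v) = form M w u - form M w v"
  by (simp_all add: form_def algebra_simps)
lemma form_scaleR [simp]: "form M (c *\<^sub>R u) w = c * form M u w" "form M w (c *\<^sub>R u) = c * form M w u"
  by (simp_all add: form_def algebra_simps)
lemma form_minus [simp]: "form M (- u) w = - form M u w" "form M w (- u) = - form M w u"
  by (simp_all add: form_def algebra_simps)
lemma form_zero [simp]: "form M 0 w = 0" "form M w 0 = 0" by (simp_all add: form_def)
lemma dual_commute: "dual M u v = dual M v u" by (simp add: dual_def mult.commute)
lemma dual_add [simp]: "dual M (u + v) w = dual M u w + dual M v w" "dual M w (u + v) = dual M w u + dual M w v"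
  by (simp_all add: dual_def algebra_simps)
lemma dual_diff [simp]: "dual M (u - v) w = dual M u w - dual M v w" "dual M w (u - v) = dual M w u - dual M w v"
  by (simp_all add: dual_def algebra_simps)
lemma dual_scaleR [simp]: "dual M (c *\<^sub>R u) w = c * dual M u w" "dual M w (c *\<^sub>R u) = c * dual M w u"
  by (simp_all add: dual_def algebra_simps)
lemma dual_minus [simp]: "dual M (- u) w = - dual M u w" "dual M w (- u) = - dual M w u"
  by (simp_all add: dual_def algebra_simps)
lemma dual_zero [simp]: "dual M 0 w = 0" "dual M w 0 = 0" by (simp_all add: dual_def)

lemma dual_form: "M \<noteq> Euclidean \<Longrightarrow> dual M u v = kappa M * form M u v"
  by (cases M) (auto simp: dual_def form_def algebra_simps)
lemma kappa_square: "M \<noteq> Euclidean \<Longrightarrow> kappa M * kappa M = 1" by (cases M) auto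

lemma kappa_cases: "M \<noteq> Euclidean \<Longrightarrow> kappa M = 1 \<or> kappa M = -1" by (cases M) auto

lemma haver_commute: "haver M x y = haver M y x"
  by (simp add: haver_def form_def algebra_simps)
lemma haver_self [simp]: "haver M x x = 0" by (simp add: haver_def)

lemma dual_haver: assumes "x \<in> points M" "y \<in> points M" shows "dual M x y = 1 - kappa M * haver M x y"
proof (cases "M = Euclidean")
  case True then show ?thesis using assms by (simp add: dual_def points.simps)
next
  case False
  have "form M x x = kappa M" "form M y y = kappa M"
    using assms[THEN points_dual] dual_form[OF False] kappa_square[OF False]
    by (metis mult.assoc mult.right_neutral mult.commute)+
  then show ?thesis using kappa_cases[OF False]
    by (auto simp: haver_def dual_form[OF False] form_commute[of M y x] field_simps)
qed

lemma haver_dual: assumes "x \<in> points M" "y \<in> points M" "M \<noteq> Euclidean"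
  shows "haver M x y = kappa M * (1 - dual M x y)"
  by (simp add: dual_haver[OF assms(1,2)] kappa_square[OF assms(3)] flip: mult.assoc)

lemma form_point: assumes "dual M p u = 0" shows "M \<noteq> Euclidean \<Longrightarrow> form M p u = 0" "M \<noteq> Euclidean \<Longrightarrow> form M u p = 0"
  using assms dual_form[of M p u] kappa_square[of M] by (auto simp: form_commute)

text \<open>
  One step along a geodesic in the direction of \<open>e\<close>, a tangent vector of length \<open>gsin M r\<close>. The
  vector is not normalized because directions to the centers of touching disks arise in this form.
\<close>
lemma point_step:
  assumes p: "p \<in> points M" and t: "dual M p e = 0" "form M e e = (gsin M r)\<^sup>2"
  shows "gcos M r *\<^sub>R p + e \<in> points M"
proof (cases M)
  case Euclidean
  then show ?thesis using assms by (auto simp: dual_def points.simps)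
next
  case Spherical
  have "dual M (gcos M r *\<^sub>R p + e) (gcos M r *\<^sub>R p + e) = 1"
    using points_dual[OF p] t Spherical dual_form[of M e e] gcos_gsin[of M r] dual_commute[of M e p]
    by (simp add: power2_eq_square)
  then show ?thesis using Spherical by (simp add: in_points dual_def power2_eq_square)
next
  case Hyperbolic
  have "dual M (gcos M r *\<^sub>R p + e) (gcos M r *\<^sub>R p + e) = 1"
    using points_dual[OF p] t Hyperbolic dual_form[of M e e] gcos_gsin[of M r] dual_commute[of M e p]
    by (simp add: power2_eq_square)
  moreover have "0 < gcos M r * p $ 3 + e $ 3"
  proof -
    have p3: "p $ 3 > 0" "(p $ 3)\<^sup>2 = 1 + ((p $ 1)\<^sup>2 + (p $ 2)\<^sup>2)" using p Hyperbolic by (auto simp: in_points)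
    have e3: "p $ 3 * e $ 3 = p $ 1 * e $ 1 + p $ 2 * e $ 2" using t Hyperbolic by (simp add: dual_def)
    have "(p $ 3 * e $ 3)\<^sup>2 \<le> ((p $ 1)\<^sup>2 + (p $ 2)\<^sup>2) * ((e $ 1)\<^sup>2 + (e $ 2)\<^sup>2)"
      unfolding e3 using sum_squares_ge_zero[of "p $ 1 * e $ 2 - p $ 2 * e $ 1" 0]
      by (simp add: power2_eq_square algebra_simps)
    also have "(e $ 1)\<^sup>2 + (e $ 2)\<^sup>2 = (sinh r)\<^sup>2 + (e $ 3)\<^sup>2"
      using t(2) Hyperbolic by (simp add: form_def power2_eq_square)
    finally have "(e $ 3)\<^sup>2 \<le> ((p $ 3)\<^sup>2 - 1) * (sinh r)\<^sup>2"
      using p3(2) by (simp add: power_mult_distrib algebra_simps)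
    also have "\<dots> < (p $ 3)\<^sup>2 * (cosh r)\<^sup>2"
      using p3 by (simp add: cosh_square_eq algebra_simps add_pos_nonneg)
    finally have "\<bar>e $ 3\<bar> < \<bar>p $ 3 * cosh r\<bar>" using abs_le_square_iff[of "p $ 3 * cosh r" "e $ 3"] by (simp add: power_mult_distrib not_le[symmetric])
    then show ?thesis using p3(1) Hyperbolic by (simp add: abs_mult mult.commute)
  qed
  ultimately show ?thesis using Hyperbolic by (simp add: in_points dual_def power2_eq_square)
qed

text \<open>
  The law of cosines. It is affine in the direction \<open>e\<close>, which is what makes all later comparisons
  of distances linear algebra.
\<close>
lemma haver_step:
  assumes p: "p \<in> points M" and t: "dual M p e = 0" "form M e e = (gsin M r)\<^sup>2" and y: "y \<in> points M"
  shows "haver M (gcos M r *\<^sub>R p + e) y = gcos M r * haver M p y + gver M r - form M e (y - p)"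
proof (cases "M = Euclidean")
  case True
  then show ?thesis using t
    by (simp add: haver_def form_commute[of Euclidean y e] form_commute[of Euclidean p e]
        form_commute[of Euclidean y p] field_simps power2_eq_square)
next
  case False
  note k = kappa_square[OF False]
  have "haver M (gcos M r *\<^sub>R p + e) y = kappa M * (1 - gcos M r * dual M p y - dual M e y)"
    using haver_dual[OF point_step[OF p t] y False] by (simp add: algebra_simps)
  moreover have "form M e (y - p) = kappa M * dual M e y"
    using form_point[OF t(1) False] k by (simp add: dual_form[OF False])
  ultimately show ?thesis
    using kappa_cases[OF False] by (auto simp: haver_dual[OF p y False] algebra_simps gcos_gver[of M r])
qed

section \<open>Tangent vectors, distances and geodesics\<close>

text \<open>
  The quarter turn of the tangent plane at \<open>p\<close>, a cross product with \<open>p\<close> adapted to the form;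
  together with a unit tangent vector it gives an orthonormal frame.
\<close>
definition rot :: "geometry \<Rightarrow> real^3 \<Rightarrow> real^3 \<Rightarrow> real^3" where
  "rot M p u = vector [p $ 2 * u $ 3 - p $ 3 * u $ 2, p $ 3 * u $ 1 - p $ 1 * u $ 3,
     kappa M * (p $ 1 * u $ 2 - p $ 2 * u $ 1)]"

lemma rot_nth [simp]: "rot M p u $ 1 = p $ 2 * u $ 3 - p $ 3 * u $ 2"
  "rot M p u $ 2 = p $ 3 * u $ 1 - p $ 1 * u $ 3"
  "rot M p u $ 3 = kappa M * (p $ 1 * u $ 2 - p $ 2 * u $ 1)"
  by (simp_all add: rot_def)

lemma dual_rot: "dual M p (rot M p u) = 0"
  by (simp add: dual_def algebra_simps)

lemma form_rot: assumes "p \<in> points M" "dual M p u = 0" shows "form M u (rot M p u) = 0"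
proof (cases M)
  case Euclidean
  then have "u $ 3 = 0" using assms by (simp add: dual_def points.simps)
  then show ?thesis using Euclidean by (simp add: form_def algebra_simps)
qed (simp_all add: form_def algebra_simps)

lemma form_rot_rot: assumes "p \<in> points M" "dual M p u = 0"
  shows "form M (rot M p u) (rot M p u) = form M u u"
proof -
  show ?thesis
  proof (cases M)
    case Euclidean
    with assms have "u $ 3 = 0" "p $ 3 = 1" by (simp_all add: dual_def points.simps)
    then show ?thesis using Euclidean by (simp add: form_def algebra_simps)
  next
    case Hyperbolic
    have "form M (rot M p u) (rot M p u) = (form M p u)\<^sup>2 - form M p p * form M u u"
      using Hyperbolic by (simp add: form_def power2_eq_square algebra_simps)
    then show ?thesis using form_point[OF assms(2)] dual_form[of M p p] points_dual[OF assms(1)] Hyperbolic by simp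
  next
    case Spherical
    have "form M (rot M p u) (rot M p u) = form M p p * form M u u - (form M p u)\<^sup>2"
      using Spherical by (simp add: form_def power2_eq_square algebra_simps)
    then show ?thesis using form_point[OF assms(2)] dual_form[of M p p] points_dual[OF assms(1)] Spherical by simp
  qed
qed

text \<open>
  Orthonormal frames span: this is polynomial algebra from the equations for \<open>p\<close>, \<open>u\<close> and \<open>w\<close>.
  Everything else about tangent planes (decomposition, positivity, Cauchy--Schwarz) follows from
  it.
\<close>
lemma tangent_eq_0:
  assumes "p \<in> points M" "unit M p u" "dual M p w = 0" "form M w u = 0" "form M w (rot M p u) = 0"
  shows "w = 0"
proof -
  have p: "(p $ 3)\<^sup>2 + kappa M * ((p $ 1)\<^sup>2 + (p $ 2)\<^sup>2) = 1" using assms(1) by (simp add: in_points)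
  have u: "p $ 3 * u $ 3 + kappa M * (p $ 1 * u $ 1 + p $ 2 * u $ 2) = 0"
    "u $ 1 * u $ 1 + u $ 2 * u $ 2 + kappa M * (u $ 3 * u $ 3) = 1"
    using assms(2) by (simp_all add: dual_def unit_def form_def)
  have w: "p $ 3 * w $ 3 + kappa M * (p $ 1 * w $ 1 + p $ 2 * w $ 2) = 0"
    "w $ 1 * u $ 1 + w $ 2 * u $ 2 + kappa M * (w $ 3 * u $ 3) = 0"
    "w $ 1 * (p $ 2 * u $ 3 - p $ 3 * u $ 2) + w $ 2 * (p $ 3 * u $ 1 - p $ 1 * u $ 3)
      + kappa M * (w $ 3 * (kappa M * (p $ 1 * u $ 2 - p $ 2 * u $ 1))) = 0"
    using assms(3,4,5) by (simp_all add: dual_def form_def)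
  have "w $ 1 = 0 \<and> w $ 2 = 0 \<and> w $ 3 = 0"
  proof (cases M)
    case Euclidean
    with assms(1) have 3: "p $ 3 = 1" by (simp add: points.simps)
    then have "u $ 3 = 0" "w $ 3 = 0" using u w Euclidean by simp_all
    with 3 Euclidean u w have *: "u $ 1 * u $ 1 + u $ 2 * u $ 2 = 1" "w $ 1 * u $ 1 + w $ 2 * u $ 2 = 0"
      "w $ 2 * u $ 1 - w $ 1 * u $ 2 = 0" by simp_all
    have "w $ 1 = 0" "w $ 2 = 0" using * by algebra+
    with \<open>w $ 3 = 0\<close> show ?thesis by simp
  next
    case Hyperbolic
    have "w $ 1 = 0" using p u w unfolding Hyperbolic kappa.simps by algebra
    moreover have "w $ 2 = 0" using p u w unfolding Hyperbolic kappa.simps by algebra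
    moreover have "w $ 3 = 0" using p u w unfolding Hyperbolic kappa.simps by algebra
    ultimately show ?thesis by simp
  next
    case Spherical
    have "w $ 1 = 0" using p u w unfolding Spherical kappa.simps by algebra
    moreover have "w $ 2 = 0" using p u w unfolding Spherical kappa.simps by algebra
    moreover have "w $ 3 = 0" using p u w unfolding Spherical kappa.simps by algebra
    ultimately show ?thesis by simp
  qed
  then show ?thesis by (simp add: vec_eq_iff forall_3)
qed

lemma unit_rot: "p \<in> points M \<Longrightarrow> unit M p u \<Longrightarrow> unit M p (rot M p u)"
  by (simp add: unit_def dual_rot form_rot_rot)

lemma ex_unit: assumes "p \<in> points M" shows "\<exists>u. unit M p u"
proof -
  have key: "\<exists>u. unit M p u" if "dual M p w = 0" "0 < form M w w" for w
    using that by (intro exI[of _ "(1 / sqrt (form M w w)) *\<^sub>R w"]) (simp add: unit_def field_simps)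
  let ?v = "vector [p $ 3, 0, - (kappa M * p $ 1)] :: real^3"
  let ?w = "vector [0, p $ 3, - (kappa M * p $ 2)] :: real^3"
  have t: "dual M p ?v = 0" "dual M p ?w = 0" by (simp_all add: dual_def algebra_simps)
  have n: "form M ?v ?v = (p $ 3)\<^sup>2 + kappa M * (p $ 1)\<^sup>2" "form M ?w ?w = (p $ 3)\<^sup>2 + kappa M * (p $ 2)\<^sup>2"
    by (cases M; simp add: form_def power2_eq_square)+
  have "0 < form M ?v ?v \<or> 0 < form M ?w ?w"
  proof (cases M)
    case Spherical
    have "p $ 3 = 0 \<and> p $ 1 = 0 \<and> p $ 2 = 0 \<Longrightarrow> False"
      using assms Spherical by (simp add: in_points)
    then show ?thesis unfolding n using Spherical by (auto simp: sum_power2_gt_zero_iff)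
  next
    case Hyperbolic
    have "(p $ 3)\<^sup>2 - (p $ 1)\<^sup>2 = 1 + (p $ 2)\<^sup>2" using assms Hyperbolic by (simp add: in_points)
    then have "0 < (p $ 3)\<^sup>2 - (p $ 1)\<^sup>2" by (simp add: add_pos_nonneg)
    then show ?thesis unfolding n using Hyperbolic by simp
  next
    case Euclidean
    then show ?thesis unfolding n using assms by (simp add: in_points)
  qed
  then show ?thesis using key t by blast
qed

lemma tangent_decomp:
  assumes "p \<in> points M" "unit M p u" "dual M p v = 0"
  shows "v = form M v u *\<^sub>R u + form M v (rot M p u) *\<^sub>R rot M p u"
proof -
  have "v - (form M v u *\<^sub>R u + form M v (rot M p u) *\<^sub>R rot M p u) = 0"
    using assms form_rot[of p M u] form_rot_rot[of p M u] dual_rot[of M p u]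
    by (intro tangent_eq_0[OF assms(1,2)]) (auto simp: unit_def form_commute[of M "rot M p u" u])
  then show ?thesis by simp
qed

lemma tangent_form:
  assumes "p \<in> points M" "unit M p u" "dual M p v = 0"
  shows "form M v w = form M v u * form M u w + form M v (rot M p u) * form M (rot M p u) w"
  by (subst tangent_decomp[OF assms]) simp

lemma tangent_form_nonneg:
  assumes "p \<in> points M" "dual M p v = 0"
  shows "0 \<le> form M v v"
proof -
  obtain u where u: "unit M p u" using ex_unit assms by blast
  show ?thesis unfolding tangent_form[OF assms(1) u assms(2), of v]
    by (simp add: form_commute[of M u v] form_commute[of M "rot M p u" v])
qed

lemma tangent_Cauchy_Schwarz:
  assumes "p \<in> points M" "dual M p v = 0" "dual M p w = 0"
  shows "(form M v w)\<^sup>2 \<le> form M v v * form M w w"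
proof -
  obtain u where u: "unit M p u" using ex_unit assms by blast
  define a b c d where "a = form M v u" "b = form M v (rot M p u)" "c = form M w u" "d = form M w (rot M p u)"
  have "form M v w = a * c + b * d" "form M v v = a * a + b * b" "form M w w = c * c + d * d"
    using tangent_form[OF assms(1) u assms(2), of v] tangent_form[OF assms(1) u assms(2), of w]
      tangent_form[OF assms(1) u assms(3), of w]
    by (simp_all add: a_b_c_d_def form_commute[of M u] form_commute[of M "rot M p u"])
  moreover have "(a * c + b * d)\<^sup>2 \<le> (a * a + b * b) * (c * c + d * d)"
    using zero_le_square[of "a * d - b * c"] by (simp add: power2_eq_square algebra_simps)
  ultimately show ?thesis by simp
qed

lemma tangent_form_eq_0:
  assumes "p \<in> points M" "dual M p v = 0" "form M v v = 0" shows "v = 0"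
proof -
  obtain u where u: "unit M p u" using ex_unit assms by blast
  have "form M v u = 0" "form M v (rot M p u) = 0"
    using tangent_Cauchy_Schwarz[OF assms(1,2), of u] tangent_Cauchy_Schwarz[OF assms(1,2), of "rot M p u"]
      assms u dual_rot[of M p u] by (simp_all add: unit_def)
  then show ?thesis using tangent_decomp[OF assms(1) u assms(2)] by simp
qed

lemma form_le_norms:
  assumes "p \<in> points M" "dual M p v = 0" "dual M p w = 0" "form M v v \<le> a\<^sup>2" "form M w w \<le> b\<^sup>2" "0 \<le> a" "0 \<le> b"
  shows "\<bar>form M v w\<bar> \<le> a * b"
proof -
  have "(form M v w)\<^sup>2 \<le> form M v v * form M w w" using tangent_Cauchy_Schwarz assms by blast
  also have "\<dots> \<le> a\<^sup>2 * b\<^sup>2" using assms tangent_form_nonneg by (intro mult_mono) auto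
  finally show ?thesis using assms by (simp add: power_mult_distrib[symmetric] abs_le_square_iff[symmetric])
qed

text \<open>
  For a point \<open>t\<close> of the plane, \<open>tpart M p t\<close> points from \<open>p\<close> to \<open>t\<close> and has length \<open>gsin\<close> of
  their distance.
\<close>
definition tpart :: "geometry \<Rightarrow> real^3 \<Rightarrow> real^3 \<Rightarrow> real^3" where
  "tpart M p t = t - dual M p t *\<^sub>R p"

lemma dual_tpart: "p \<in> points M \<Longrightarrow> dual M p (tpart M p t) = 0"
  by (simp add: tpart_def points_dual)

lemma form_tpart:
  assumes "p \<in> points M" "t \<in> points M" "dual M p e = 0"
  shows "form M e (tpart M p t) = form M e (t - p)"
proof (cases "M = Euclidean")
  case True
  then have "dual M p t = 1" using assms by (simp add: dual_def points.simps)
  then show ?thesis by (simp add: tpart_def)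
next
  case False
  then show ?thesis using form_point(2)[OF assms(3) False] by (simp add: tpart_def)
qed

lemma form_tpart_tpart:
  assumes "p \<in> points M" "t \<in> points M"
  shows "form M (tpart M p t) (tpart M p t) = haver M p t * (2 - kappa M * haver M p t)"
proof (cases "M = Euclidean")
  case True
  then have "dual M p t = 1" using assms by (simp add: dual_def points.simps)
  then show ?thesis using True haver_commute[of M p t] by (simp add: tpart_def haver_def)
next
  case False
  note k = kappa_cases[OF False]
  have f: "form M x y = kappa M * dual M x y" for x y using dual_form[OF False, of x y] k by auto
  show ?thesis using k dual_commute[of M t p] unfolding f tpart_def
    by (auto simp: points_dual[OF assms(1)] points_dual[OF assms(2)] haver_dual[OF assms False] algebra_simps)
qed

text \<open>
  The squared length of the tangential part is \<open>haver * (2 - kappa * haver)\<close> and nonnegative. On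
  the hyperboloid this leaves the possibility \<open>haver \<le> -2\<close>, which is excluded because both points
  lie on the upper sheet.
\<close>
lemma haver_bounds: assumes "p \<in> points M" "t \<in> points M"
  shows "0 \<le> haver M p t" "M = Spherical \<Longrightarrow> haver M p t \<le> 2"
proof -
  have *: "0 \<le> haver M p t * (2 - kappa M * haver M p t)"
    using tangent_form_nonneg[OF assms(1) dual_tpart[OF assms(1)], of t] form_tpart_tpart[OF assms] by simp
  have "0 \<le> haver M p t \<and> (M = Spherical \<longrightarrow> haver M p t \<le> 2)"
  proof (cases M)
    case Hyperbolic
    have "dual M p t > 0"
    proof -
      have "p $ 3 > 0" "t $ 3 > 0" and q: "(p $ 1)\<^sup>2 + (p $ 2)\<^sup>2 < (p $ 3)\<^sup>2" "(t $ 1)\<^sup>2 + (t $ 2)\<^sup>2 < (t $ 3)\<^sup>2"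
        using assms Hyperbolic by (auto simp: in_points)
      have "(p $ 1 * t $ 1 + p $ 2 * t $ 2)\<^sup>2 \<le> ((p $ 1)\<^sup>2 + (p $ 2)\<^sup>2) * ((t $ 1)\<^sup>2 + (t $ 2)\<^sup>2)"
        using zero_le_square[of "p $ 1 * t $ 2 - p $ 2 * t $ 1"] by (simp add: power2_eq_square algebra_simps)
      also have "\<dots> < (p $ 3)\<^sup>2 * (t $ 3)\<^sup>2" using q \<open>p $ 3 > 0\<close> by (intro mult_strict_mono) auto
      finally have "\<bar>p $ 1 * t $ 1 + p $ 2 * t $ 2\<bar> < p $ 3 * t $ 3"
        using \<open>p $ 3 > 0\<close> \<open>t $ 3 > 0\<close> by (simp add: power_mult_distrib[symmetric] power2_less_imp_less)
      then show ?thesis using Hyperbolic by (simp add: dual_def)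
    qed
    then have "-1 < haver M p t" using dual_haver[OF assms] Hyperbolic by simp
    moreover have "0 \<le> haver M p t * (2 + haver M p t)" using * Hyperbolic by simp
    ultimately show ?thesis using Hyperbolic by (auto simp: zero_le_mult_iff)
  next
    case Spherical
    have "0 \<le> haver M p t" using Spherical by (simp add: haver_def form_def)
    then show ?thesis using * Spherical by (auto simp: zero_le_mult_iff)
  qed (use * in \<open>auto simp: zero_le_mult_iff\<close>)
  then show "0 \<le> haver M p t" "M = Spherical \<Longrightarrow> haver M p t \<le> 2" by auto
qed

text \<open>
  The bridge from the three formulas for the distance to the common calculus. From here on
  distances are compared through \<open>haver\<close>.
\<close>
lemma gdist_gver: assumes "p \<in> points M" "t \<in> points M"
  shows "gver M (gdist M p t) = haver M p t" and "gdist M p t \<in> lengths M"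
proof -
  have "gver M (gdist M p t) = haver M p t \<and> gdist M p t \<in> lengths M"
  proof (cases M)
    case Euclidean
    have "(dist p t)\<^sup>2 = form M (p - t) (p - t)"
      using assms Euclidean by (simp add: dist_vec_def L2_set_def sum_3 form_def points.simps power2_eq_square dist_real_def)
    then show ?thesis using Euclidean by (simp add: haver_def lengths_def)
  next
    case Hyperbolic
    have "gdist M p t = arcosh (dual M p t)" using Hyperbolic by (simp add: dual_def algebra_simps)
    moreover have "dual M p t = 1 + haver M p t" using dual_haver[OF assms] Hyperbolic by simp
    ultimately show ?thesis using haver_bounds[OF assms] Hyperbolic
      by (auto simp: cosh_arcosh_real lengths_def arcosh_nonneg_real)
  next
    case Spherical
    have "gdist M p t = arccos (dual M p t)" using Spherical by (simp add: dual_def inner_vec_def sum_3 algebra_simps)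
    moreover have "dual M p t = 1 - haver M p t" using dual_haver[OF assms] Spherical by simp
    ultimately show ?thesis using haver_bounds[OF assms] Spherical
      by (auto simp: cos_arccos lengths_def arccos_lbound arccos_ubound)
  qed
  then show "gver M (gdist M p t) = haver M p t" and "gdist M p t \<in> lengths M" by auto
qed

lemma gdist_le_iff: assumes "p \<in> points M" "t \<in> points M" "s \<in> lengths M"
  shows "gdist M p t \<le> s \<longleftrightarrow> haver M p t \<le> gver M s"
  using gver_le_iff[OF gdist_gver(2)[OF assms(1,2)] assms(3)] gdist_gver(1)[OF assms(1,2)] by simp
lemma gdist_eq_iff: assumes "p \<in> points M" "t \<in> points M" "s \<in> lengths M"
  shows "gdist M p t = s \<longleftrightarrow> haver M p t = gver M s"
  using gver_eq_iff[OF gdist_gver(2)[OF assms(1,2)] assms(3)] gdist_gver(1)[OF assms(1,2)] by simp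
lemma gdist_nonneg: "p \<in> points M \<Longrightarrow> t \<in> points M \<Longrightarrow> 0 \<le> gdist M p t"
  using gdist_gver(2) by (auto simp: lengths_def)
lemma gdist_commute: "p \<in> points M \<Longrightarrow> t \<in> points M \<Longrightarrow> gdist M p t = gdist M t p"
  using gdist_eq_iff[of p M t "gdist M t p"] gdist_gver[of t M p] by (simp add: haver_commute)

definition gexp :: "geometry \<Rightarrow> real^3 \<Rightarrow> real^3 \<Rightarrow> real \<Rightarrow> real^3" where
  "gexp M p u s = gcos M s *\<^sub>R p + gsin M s *\<^sub>R u"

lemma gexp_0 [simp]: "gexp M p u 0 = p" by (simp add: gexp_def)
lemma gexp_points: "p \<in> points M \<Longrightarrow> unit M p u \<Longrightarrow> gexp M p u s \<in> points M"
  unfolding gexp_def by (rule point_step) (auto simp: unit_def power2_eq_square)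
lemma haver_gexp: "p \<in> points M \<Longrightarrow> unit M p u \<Longrightarrow> t \<in> points M \<Longrightarrow>
    haver M (gexp M p u s) t = gcos M s * haver M p t + gver M s - gsin M s * form M u (t - p)"
  unfolding gexp_def by (subst haver_step) (auto simp: unit_def power2_eq_square algebra_simps)
lemma haver_gexp_self: "p \<in> points M \<Longrightarrow> unit M p u \<Longrightarrow> haver M p (gexp M p u s) = gver M s"
  using haver_gexp[of p M u p s] haver_commute[of M p] by simp
lemma gdist_gexp: "p \<in> points M \<Longrightarrow> unit M p u \<Longrightarrow> s \<in> lengths M \<Longrightarrow> gdist M p (gexp M p u s) = s"
  using gdist_eq_iff[of p M "gexp M p u s" s] by (simp add: haver_gexp_self gexp_points)

text \<open>Polar coordinates around \<open>p\<close>.\<close>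
lemma ex_gexp: assumes "p \<in> points M" "t \<in> points M"
  shows "\<exists>u. unit M p u \<and> t = gexp M p u (gdist M p t)"
proof -
  let ?s = "gdist M p t" and ?e = "tpart M p t"
  have s: "gver M ?s = haver M p t" "?s \<in> lengths M" using gdist_gver[OF assms] by auto
  have c: "gcos M ?s = dual M p t" using s dual_haver[OF assms] gcos_gver[of M ?s] by simp
  have n: "form M ?e ?e = (gsin M ?s)\<^sup>2"
    unfolding form_tpart_tpart[OF assms] gsin_squared s(1) gcos_gver[of M ?s] by (simp add: s)
  have t: "t = gcos M ?s *\<^sub>R p + ?e" by (simp add: c tpart_def)
  show ?thesis
  proof (cases "gsin M ?s = 0")
    case True
    then have "?e = 0" using n tangent_form_eq_0[OF assms(1) dual_tpart[OF assms(1)]] by simp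
    then show ?thesis using ex_unit[OF assms(1)] t True by (auto simp: gexp_def)
  next
    case False
    then show ?thesis using t n dual_tpart[OF assms(1), of t]
      by (intro exI[of _ "(1 / gsin M ?s) *\<^sub>R ?e"]) (auto simp: gexp_def unit_def power2_eq_square)
  qed
qed

lemma haver_gexp_gexp:
  assumes "p \<in> points M" "unit M p u" "unit M p v"
  shows "haver M (gexp M p u s) (gexp M p v t) = gcos M s * gver M t + gver M s - gsin M s * gsin M t * form M u v"
proof -
  have "form M u (gexp M p v t - p) = gsin M t * form M u v"
  proof (cases "M = Euclidean")
    case False
    then show ?thesis using assms form_point[of M p u] by (simp add: gexp_def unit_def)
  qed (simp add: gexp_def)
  then show ?thesis using haver_gexp[OF assms(1,2) gexp_points[OF assms(1,3)], of s t] haver_gexp_self[OF assms(1,3), of t]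
    by simp
qed

lemma form_unit_le: "p \<in> points M \<Longrightarrow> unit M p u \<Longrightarrow> unit M p v \<Longrightarrow> \<bar>form M u v\<bar> \<le> 1"
  using form_le_norms[of p M u v 1 1] by (simp add: unit_def)

lemma unit_minus: "unit M p u \<Longrightarrow> unit M p (- u)" by (simp add: unit_def)

text \<open>
  By the law of cosines at \<open>y\<close>, with the angle replaced by a straight one. If the sum of the two
  sides exceeds the range of distances, which can happen on the sphere only, there is nothing to
  compare.
\<close>
lemma gdist_triangle:
  assumes "x \<in> points M" "y \<in> points M" "z \<in> points M"
  shows "gdist M x z \<le> gdist M x y + gdist M y z"
proof (cases "gdist M x y + gdist M y z \<in> lengths M")
  case False
  then show ?thesis using gdist_gver(2)[OF assms(1,2)] gdist_gver(2)[OF assms(2,3)] gdist_gver(2)[OF assms(1,3)]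
    by (auto simp: lengths_def)
next
  case True
  let ?s = "gdist M y x" and ?t = "gdist M y z"
  obtain u v where u: "unit M y u" "x = gexp M y u ?s" and v: "unit M y v" "z = gexp M y v ?t"
    using ex_gexp assms by metis
  have "haver M x z = gcos M ?s * gver M ?t + gver M ?s - gsin M ?s * gsin M ?t * form M u v"
    using haver_gexp_gexp[OF assms(2) u(1) v(1), of ?s ?t] u(2) v(2) by simp
  moreover have "gsin M ?s * gsin M ?t * (- form M u v) \<le> gsin M ?s * gsin M ?t * 1"
    using form_unit_le[OF assms(2) u(1) v(1)] gsin_nonneg gdist_gver(2) assms
    by (intro mult_left_mono) auto
  ultimately have "haver M x z \<le> gver M (?s + ?t)" by (simp add: gver_add)
  then show ?thesis using gdist_le_iff[OF assms(1,3) True] gdist_commute[OF assms(1,2)] by simp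
qed

section \<open>Disks and their normal cones\<close>

text \<open>
  The velocity at parameter \<open>s\<close> of the geodesic that leaves \<open>p\<close> in direction \<open>u\<close>.
\<close>
definition gdir :: "geometry \<Rightarrow> real^3 \<Rightarrow> real^3 \<Rightarrow> real \<Rightarrow> real^3" where
  "gdir M p u s = gcos M s *\<^sub>R u - (kappa M * gsin M s) *\<^sub>R p"

lemma gdir_0 [simp]: "gdir M p u 0 = u" by (simp add: gdir_def)

lemma unit_gdir: assumes "p \<in> points M" "unit M p u" shows "unit M (gexp M p u s) (gdir M p u s)"
proof (cases "M = Euclidean")
  case True
  then show ?thesis using assms by (auto simp: gexp_def gdir_def unit_def dual_def points.simps)
next
  case False
  have [simp]: "form M p u = 0" "form M u p = 0" "dual M p u = 0" "dual M u p = 0" "form M u u = 1"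
    using assms form_point[OF _ False, of p u] by (auto simp: unit_def dual_commute)
  have d: "dual M p p = 1" "form M p p = kappa M" "dual M u u = kappa M"
    using points_dual[OF assms(1)] dual_form[OF False, of p p] dual_form[OF False, of u u] kappa_cases[OF False] by auto
  have "(gcos M s)\<^sup>2 + kappa M * (gsin M s)\<^sup>2 = 1" by (rule gcos_gsin)
  then show ?thesis using kappa_cases[OF False]
    by (auto simp: gexp_def gdir_def unit_def d power2_eq_square algebra_simps)
qed

lemma gexp_gexp: "gexp M (gexp M p u s) (gdir M p u s) t = gexp M p u (s + t)"
  by (simp add: gexp_def gdir_def gcos_add gsin_add algebra_simps)
lemma gdir_gdir: "gdir M (gexp M p u s) (gdir M p u s) t = gdir M p u (s + t)"
  by (simp add: gexp_def gdir_def gcos_add gsin_add algebra_simps)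
lemma gexp_minus: "gexp M p (- u) s = gexp M p u (- s)" by (simp add: gexp_def)
lemma gexp_back: "gexp M (gexp M p u s) (- gdir M p u s) t = gexp M p u (s - t)"
  using gexp_gexp[of M p u s "-t"] by (simp add: gexp_minus)

text \<open>
  Convexity of disks along a geodesic through \<open>z\<close>. The law of cosines expresses \<open>haver\<close> at the two
  endpoints by the same two unknowns, the value at \<open>z\<close> and a directional term; weighting the
  endpoints with the \<open>gsin\<close> of the opposite lengths eliminates the directional term.
\<close>
lemma haver_between:
  assumes z: "z \<in> points M" and u: "unit M z u" and c: "c \<in> points M" and r: "acute M r"
    and s: "s1 \<in> lengths M" "s2 \<in> lengths M" "0 < gsin M (s1 + s2)"
    and 1: "haver M (gexp M z u s1) c \<le> gver M r" and 2: "haver M (gexp M z (- u) s2) c \<le> gver M r"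
  shows "haver M z c \<le> gver M r" and "0 < gsin M s1 \<Longrightarrow> 0 < gsin M s2 \<Longrightarrow> 0 < gver M s1 \<Longrightarrow> haver M z c < gver M r"
proof -
  define D G V where "D = haver M z c" "G = form M u (c - z)" "V = gver M r"
  define C1 C2 S1 S2 V1 V2 where "C1 = gcos M s1" "C2 = gcos M s2" "S1 = gsin M s1" "S2 = gsin M s2" "V1 = gver M s1" "V2 = gver M s2"
  note defs = D_G_V_def C1_C2_S1_S2_V1_V2_def
  have A: "C1 * D + V1 - S1 * G \<le> V" using 1 haver_gexp[OF z u c] by (simp add: defs)
  have B: "C2 * D + V2 + S2 * G \<le> V" using 2 haver_gexp[OF z unit_minus[OF u] c, of s2] by (simp add: defs algebra_simps)
  have n: "0 \<le> S1" "0 \<le> S2" "0 \<le> V1" "0 \<le> V2" using s gsin_nonneg gver_nonneg by (auto simp: defs)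
  have "S2 * (C1 * D + V1 - S1 * G) + S1 * (C2 * D + V2 + S2 * G) \<le> S2 * V + S1 * V"
    using A B n by (intro add_mono mult_left_mono) auto
  moreover have k: "C1 = 1 - kappa M * V1" "C2 = 1 - kappa M * V2" "gcos M r = 1 - kappa M * V"
    by (simp_all add: defs gcos_gver)
  have "(D - V) * gsin M (s1 + s2) + gcos M r * (V1 * S2 + V2 * S1)
      = S2 * (C1 * D + V1 - S1 * G) + S1 * (C2 * D + V2 + S2 * G) - (S2 * V + S1 * V)"
    unfolding gsin_add C1_C2_S1_S2_V1_V2_def[symmetric] k by (simp add: algebra_simps)
  ultimately have *: "(D - V) * gsin M (s1 + s2) \<le> - gcos M r * (V1 * S2 + V2 * S1)" by simp
  have "0 \<le> V1 * S2 + V2 * S1" using n by simp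
  then have "(D - V) * gsin M (s1 + s2) \<le> 0" using * gcos_pos[OF r] by (smt (verit) mult_nonneg_nonneg mult_minus_left)
  then show "haver M z c \<le> gver M r" using s(3) by (auto simp: mult_le_0_iff defs)
  assume "0 < gsin M s1" "0 < gsin M s2" "0 < gver M s1"
  then have "0 < V1 * S2 + V2 * S1" using n by (simp add: defs add_pos_nonneg)
  then have "(D - V) * gsin M (s1 + s2) < 0" using * gcos_pos[OF r] by (smt (verit) mult_pos_pos mult_minus_left)
  then show "haver M z c < gver M r" using s(3) by (auto simp: mult_less_0_iff defs)
qed

lemma disk_eq: "x \<in> points M \<Longrightarrow> acute M r \<Longrightarrow> disk M x r = {y \<in> points M. haver M x y \<le> gver M r}"
  unfolding disk_def using gdist_le_iff acute_lengths by blast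

lemma gsin_pos_lengths: "s \<in> lengths M \<Longrightarrow> 0 < s \<Longrightarrow> (M = Spherical \<longrightarrow> s < pi) \<Longrightarrow> 0 < gsin M s"
  by (cases M) (auto simp: lengths_def sin_gt_zero)

text \<open>
  Equality in the triangle inequality means that the directions from \<open>z\<close> to \<open>x\<close> and \<open>y\<close> are
  opposite, so \<open>haver_between\<close> applies.
\<close>
lemma segment_in_disk:
  assumes c: "c \<in> points M" "acute M r" and x: "x \<in> disk M c r" and y: "y \<in> disk M c r"
  shows "geodesic_segment M x y \<subseteq> disk M c r"
proof
  fix z assume "z \<in> geodesic_segment M x y"
  then have z: "z \<in> points M" "gdist M x z + gdist M z y = gdist M x y" by (auto simp: geodesic_segment_def)
  have P: "x \<in> points M" "y \<in> points M" "gdist M c x \<le> r" "gdist M c y \<le> r" using x y by (auto simp: disk_def)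
  let ?s = "gdist M z x" and ?t = "gdist M z y"
  have st: "?s + ?t = gdist M x y" using z P gdist_commute[of x M z] by simp
  have le: "?s + ?t \<le> 2 * r" using gdist_triangle[OF P(1) c(1) P(2)] gdist_commute[OF P(1) c(1)] P st by simp
  have nn: "0 \<le> ?s" "0 \<le> ?t" using z P gdist_nonneg by auto
  have sl: "?s \<in> lengths M" "?t \<in> lengths M" "?s + ?t \<in> lengths M" using gdist_gver(2) z P st by auto
  have sp: "M = Spherical \<longrightarrow> ?s + ?t < pi" using le c(2) by (auto simp: acute_def)
  show "z \<in> disk M c r"
  proof (cases "?s = 0 \<or> ?t = 0")
    case True
    have "haver M z x = 0 \<or> haver M z y = 0" using True gdist_gver(1)[OF z(1) P(1)] gdist_gver(1)[OF z(1) P(2)] by auto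
    then have "z = x \<or> z = y" using ex_gexp[OF z(1) P(1)] ex_gexp[OF z(1) P(2)] True by fastforce
    then show ?thesis using x y by auto
  next
    case False
    then have pos: "0 < gsin M ?s" "0 < gsin M ?t" "0 < gsin M (?s + ?t)"
      using nn sl sp by (auto intro!: gsin_pos_lengths)
    obtain u v where u: "unit M z u" "x = gexp M z u ?s" and v: "unit M z v" "y = gexp M z v ?t"
      using ex_gexp z P by metis
    have "gcos M ?s * gver M ?t + gver M ?s - gsin M ?s * gsin M ?t * form M u v = gver M (?s + ?t)"
      using haver_gexp_gexp[OF z(1) u(1) v(1), of ?s ?t] u(2) v(2) gdist_gver(1)[OF P(1,2)] st by simp
    then have "gsin M ?s * gsin M ?t * (1 + form M u v) = 0" by (simp add: gver_add algebra_simps)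
    then have "form M u v = -1" using pos by simp
    then have "form M (u + v) (u + v) = 0" using u v form_commute[of M v u] by (simp add: unit_def)
    then have "u + v = 0" using u v z by (intro tangent_form_eq_0[OF z(1)]) (auto simp: unit_def)
    then have "v = - u" by (simp add: add_eq_0_iff)
    then have "haver M z c \<le> gver M r"
      using haver_between(1)[OF z(1) u(1) c sl(1,2) pos(3)] u(2) v(2) x y c haver_commute[of M c] by (simp add: disk_eq)
    then show ?thesis using z c haver_commute[of M c] by (simp add: disk_eq)
  qed
qed

lemma continuous_on_form [continuous_intros]:
  fixes f g :: "'a::t2_space \<Rightarrow> real^3"
  shows "continuous_on A f \<Longrightarrow> continuous_on A g \<Longrightarrow> continuous_on A (\<lambda>x. form M (f x) (g x))"
  unfolding form_def by (intro continuous_intros)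
lemma continuous_on_dual [continuous_intros]:
  fixes f g :: "'a::t2_space \<Rightarrow> real^3"
  shows "continuous_on A f \<Longrightarrow> continuous_on A g \<Longrightarrow> continuous_on A (\<lambda>x. dual M (f x) (g x))"
  unfolding dual_def by (intro continuous_intros)
lemma continuous_on_haver [continuous_intros]:
  fixes f g :: "'a::t2_space \<Rightarrow> real^3"
  shows "continuous_on A f \<Longrightarrow> continuous_on A g \<Longrightarrow> continuous_on A (\<lambda>x. haver M (f x) (g x))"
  unfolding haver_def by (intro continuous_intros) auto

lemma closed_points: "closed (points M)"
proof -
  have "x $ 3 > 0 \<longleftrightarrow> x $ 3 \<ge> 1" if "(x $ 3)\<^sup>2 + kappa M * ((x $ 1)\<^sup>2 + (x $ 2)\<^sup>2) = 1" "M \<noteq> Spherical" for x :: "real^3"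
  proof -
    have "1 \<le> (x $ 3)\<^sup>2" using that zero_le_power2[of "x $ 1"] zero_le_power2[of "x $ 2"]
      by (cases M; simp; linarith)
    then have "1 \<le> \<bar>x $ 3\<bar>" by (simp add: abs_square_le_1 one_le_power abs_le_square_iff[of 1, simplified])
    then show ?thesis by auto
  qed
  \<comment> \<open>the strict inequality for the sheet may be replaced by a closed condition\<close>
  then have *: "points M = {x. dual M x x = 1} \<inter> (if M = Spherical then UNIV else {x. x $ 3 \<ge> 1})"
    by (auto simp: in_points dual_def power2_eq_square)
  show ?thesis unfolding *
    by (intro closed_Int) (auto intro!: closed_Collect_eq closed_Collect_le continuous_intros)
qed

lemma compact_disk: assumes "x \<in> points M" "acute M r" shows "compact (disk M x r)"
proof -
  have eq: "disk M x r = points M \<inter> {y. haver M x y \<le> gver M r}" using disk_eq[OF assms] by auto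
  have "closed (disk M x r)" unfolding eq
    by (intro closed_Int closed_points closed_Collect_le continuous_intros)
  moreover have "bounded (disk M x r)"
  proof -
    obtain u where u: "unit M x u" using ex_unit assms by blast
    define V where "V = gver M r"
    have V: "0 \<le> V" by (simp add: V_def gver_nonneg)
    have "norm y \<le> (1 + V) * norm x + (1 + V * (2 + V)) * norm u + (1 + V * (2 + V)) * norm (rot M x u)"
      if "y \<in> disk M x r" for y
    proof -
      have y: "y \<in> points M" "haver M x y \<le> V" using that disk_eq[OF assms] by (auto simp: V_def)
      have h: "0 \<le> haver M x y" using haver_bounds[OF assms(1) y(1)] by simp
      have kh: "\<bar>kappa M * haver M x y\<bar> \<le> V" using y h V by (cases M) auto
      let ?e = "tpart M x y"
      have "form M ?e ?e \<le> V * (2 + V)" unfolding form_tpart_tpart[OF assms(1) y(1)]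
        using y h kh V haver_bounds(2)[OF assms(1) y(1)] by (intro mult_mono) (cases M; auto)+
      moreover have "form M ?e ?e = (form M ?e u)\<^sup>2 + (form M ?e (rot M x u))\<^sup>2"
        using tangent_form[OF assms(1) u dual_tpart[OF assms(1)], of y ?e]
        by (simp add: form_commute[of M u ?e] form_commute[of M "rot M x u" ?e] power2_eq_square)
      moreover have "\<bar>a\<bar> \<le> 1 + B" if "a\<^sup>2 \<le> B" for a B :: real
      proof -
        have "2 * \<bar>a\<bar> \<le> 1 + a\<^sup>2" using zero_le_power2[of "\<bar>a\<bar> - 1"] by (simp add: power2_eq_square algebra_simps)
        then show ?thesis using that zero_le_power2[of a] by linarith
      qed
      ultimately have ab: "\<bar>form M ?e u\<bar> \<le> 1 + V * (2 + V)" "\<bar>form M ?e (rot M x u)\<bar> \<le> 1 + V * (2 + V)"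
        by (smt (verit) zero_le_power2)+
      have "y = dual M x y *\<^sub>R x + ?e" by (simp add: tpart_def)
      also have "\<dots> = dual M x y *\<^sub>R x + (form M ?e u *\<^sub>R u + form M ?e (rot M x u) *\<^sub>R rot M x u)"
        by (rule arg_cong[OF tangent_decomp[OF assms(1) u dual_tpart[OF assms(1)]]])
      finally have "norm y = norm (dual M x y *\<^sub>R x + (form M ?e u *\<^sub>R u + form M ?e (rot M x u) *\<^sub>R rot M x u))" by simp
      then have "norm y \<le> \<bar>dual M x y\<bar> * norm x + (\<bar>form M ?e u\<bar> * norm u + \<bar>form M ?e (rot M x u)\<bar> * norm (rot M x u))"
        by (simp only: norm_scaleR[symmetric]) (meson add_left_mono norm_triangle_ineq order_trans)
      moreover have "\<bar>dual M x y\<bar> \<le> 1 + V" using dual_haver[OF assms(1) y(1)] kh by linarith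
      ultimately show ?thesis using ab
        by (smt (verit) mult_right_mono norm_ge_zero)
    qed
    then show ?thesis by (auto simp: bounded_iff)
  qed
  ultimately show ?thesis by (simp add: compact_eq_bounded_closed)
qed

lemma haver_le_iff:
  assumes "p \<in> points M" "t \<in> points M" "dual M p e = 0" "form M e e = (gsin M r)\<^sup>2"
  shows "haver M (gcos M r *\<^sub>R p + e) t \<le> gver M r \<longleftrightarrow> gcos M r * haver M p t \<le> form M e (t - p)"
  using haver_step[OF assms(1,3,4,2)] by auto

text \<open>
  If \<open>t\<close> lies in several disks of radius \<open>r\<close> whose boundaries pass through \<open>p\<close>, it lies in every
  disk of radius \<open>r\<close> whose boundary passes through \<open>p\<close> and whose center lies, seen from \<open>p\<close>,
  between the given centers. The condition for \<open>t\<close> to lie in the disk with direction \<open>e\<close> is a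
  lower bound on the linear functional \<open>form M e (t - p)\<close> by a nonnegative number
  (\<open>haver_le_iff\<close>), and by Cauchy--Schwarz a combination of vectors of length \<open>gsin M r\<close> can have
  that length only if the coefficients sum to at least \<open>1\<close>.
\<close>
lemma in_disk_of_positive_combination:
  assumes r: "acute M r" "0 < r" and p: "p \<in> points M" and t: "t \<in> points M"
    and e: "finite I" "\<And>i. i \<in> I \<Longrightarrow> dual M p (e i) = 0" "\<And>i. i \<in> I \<Longrightarrow> form M (e i) (e i) = (gsin M r)\<^sup>2"
      "\<And>i. i \<in> I \<Longrightarrow> haver M (gcos M r *\<^sub>R p + e i) t \<le> gver M r"
    and l: "\<And>i. i \<in> I \<Longrightarrow> 0 \<le> l i" and f: "form M (\<Sum>i\<in>I. l i *\<^sub>R e i) (\<Sum>i\<in>I. l i *\<^sub>R e i) = (gsin M r)\<^sup>2"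
  shows "haver M (gcos M r *\<^sub>R p + (\<Sum>i\<in>I. l i *\<^sub>R e i)) t \<le> gver M r"
proof -
  have fs: "form M (\<Sum>i\<in>J. l i *\<^sub>R e i) w = (\<Sum>i\<in>J. l i * form M (e i) w)"
    "form M w (\<Sum>i\<in>J. l i *\<^sub>R e i) = (\<Sum>i\<in>J. l i * form M w (e i))"
    "dual M w (\<Sum>i\<in>J. l i *\<^sub>R e i) = (\<Sum>i\<in>J. l i * dual M w (e i))" if "finite J" for J w
    using that by (induction J rule: finite_induct) auto
  have S: "0 < gsin M r" using r by (rule gsin_pos)
  have "(gsin M r)\<^sup>2 = (\<Sum>i\<in>I. l i * (\<Sum>j\<in>I. l j * form M (e j) (e i)))"
    unfolding f[symmetric] fs(1)[OF e(1)] fs(2)[OF e(1)] ..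
  also have "\<dots> \<le> (\<Sum>i\<in>I. l i * (\<Sum>j\<in>I. l j * (gsin M r)\<^sup>2))"
  proof (intro sum_mono mult_left_mono l)
    fix i j assume "i \<in> I" "j \<in> I"
    then have "\<bar>form M (e j) (e i)\<bar> \<le> gsin M r * gsin M r"
      using S e by (intro form_le_norms[OF p]) auto
    then show "form M (e j) (e i) \<le> (gsin M r)\<^sup>2" by (simp add: power2_eq_square)
  qed auto
  also have "\<dots> = (sum l I)\<^sup>2 * (gsin M r)\<^sup>2"
    by (simp add: power2_eq_square sum_distrib_right[symmetric] sum_distrib_left mult.assoc)
  finally have "1 \<le> (sum l I)\<^sup>2" using S by simp
  then have L: "1 \<le> sum l I" using l by (intro power2_le_imp_le[of 1 "sum l I"]) (auto intro: sum_nonneg)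
  have d: "dual M p (\<Sum>i\<in>I. l i *\<^sub>R e i) = 0" by (simp add: fs(3)[OF e(1)] e(2))
  have h: "0 \<le> gcos M r * haver M p t" using haver_bounds(1)[OF p t] gcos_pos[OF r(1)] by simp
  have "gcos M r * haver M p t \<le> sum l I * (gcos M r * haver M p t)" using L h mult_right_mono[OF L h] by simp
  also have "\<dots> \<le> (\<Sum>i\<in>I. l i * form M (e i) (t - p))"
    unfolding sum_distrib_right
  proof (intro sum_mono mult_left_mono l)
    fix i assume "i \<in> I"
    then show "gcos M r * haver M p t \<le> form M (e i) (t - p)" using haver_le_iff[OF p t e(2,3)] e(4) by blast
  qed
  also have "\<dots> = form M (\<Sum>i\<in>I. l i *\<^sub>R e i) (t - p)" by (simp only: fs(1)[OF e(1)])
  finally show ?thesis using haver_le_iff[OF p t d f] by simp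
qed

text \<open>The case of two centers, indexed by \<open>bool\<close>.\<close>
lemma in_disk_of_positive_combination2:
  assumes r: "acute M r" "0 < r" and p: "p \<in> points M" and t: "t \<in> points M"
    and "dual M p e1 = 0" "form M e1 e1 = (gsin M r)\<^sup>2" "haver M (gcos M r *\<^sub>R p + e1) t \<le> gver M r"
    and "dual M p e2 = 0" "form M e2 e2 = (gsin M r)\<^sup>2" "haver M (gcos M r *\<^sub>R p + e2) t \<le> gver M r"
    and "0 \<le> a" "0 \<le> b" "e = a *\<^sub>R e1 + b *\<^sub>R e2" "form M e e = (gsin M r)\<^sup>2"
  shows "haver M (gcos M r *\<^sub>R p + e) t \<le> gver M r"
proof -
  let ?e = "\<lambda>i. if i then e1 else e2" and ?l = "\<lambda>i. if i then a else b"
  have s: "(\<Sum>i\<in>UNIV. ?l i *\<^sub>R ?e i) = e" unfolding assms(13) by (simp add: UNIV_bool add.commute)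
  show ?thesis
  proof (rule in_disk_of_positive_combination[of M r p t UNIV ?e ?l, unfolded s])
    fix i :: bool
    show "dual M p (?e i) = 0" by (cases i) (simp_all only: if_True if_False assms(5) assms(8))
    show "form M (?e i) (?e i) = (gsin M r)\<^sup>2" by (cases i) (simp_all only: if_True if_False assms(6) assms(9))
    show "haver M (gcos M r *\<^sub>R p + ?e i) t \<le> gver M r"
      by (cases i) (simp_all only: if_True if_False assms(7) assms(10))
    show "0 \<le> ?l i" by (cases i) (simp_all only: if_True if_False assms(11) assms(12))
  qed (use r p t assms(14) in simp_all)
qed

lemma tpart_active:
  assumes "p \<in> points M" "q \<in> points M" "haver M q p = gver M r"
  shows "q = gcos M r *\<^sub>R p + tpart M p q" "dual M p (tpart M p q) = 0" "form M (tpart M p q) (tpart M p q) = (gsin M r)\<^sup>2"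
proof -
  have "haver M p q = gver M r" using assms(3) haver_commute by metis
  then show "q = gcos M r *\<^sub>R p + tpart M p q" "form M (tpart M p q) (tpart M p q) = (gsin M r)\<^sup>2"
    unfolding form_tpart_tpart[OF assms(1,2)] gsin_squared gcos_gver
    by (simp_all add: tpart_def dual_haver[OF assms(1,2)])
qed (rule dual_tpart[OF assms(1)])

lemma convex_cone_hull_finite_subset:
  assumes "finite A"
  shows "convex_cone hull (f ` A) \<subseteq> {\<Sum>a\<in>A. l a *\<^sub>R f a | l. \<forall>a. 0 \<le> (l a :: real)}" (is "_ \<subseteq> ?C")
proof (rule hull_minimal)
  show "f ` A \<subseteq> ?C"
  proof
    fix x assume "x \<in> f ` A"
    then obtain b where b: "b \<in> A" "x = f b" by auto
    have "(\<Sum>a\<in>A. (if a = b then 1 else 0) *\<^sub>R f a) = (\<Sum>a\<in>A. if a = b then f a else 0)"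
      by (intro sum.cong) auto
    then have "x = (\<Sum>a\<in>A. (if a = b then 1 else 0) *\<^sub>R f a)" using b assms by simp
    then show "x \<in> ?C" by (intro CollectI exI[of _ "\<lambda>a. if a = b then 1 else 0"]) auto
  qed
  have add: "x + y \<in> ?C" if xy: "x \<in> ?C" "y \<in> ?C" for x y
  proof -
    obtain l m where "x = (\<Sum>a\<in>A. l a *\<^sub>R f a)" "y = (\<Sum>a\<in>A. m a *\<^sub>R f a)" "\<forall>a. 0 \<le> (l a :: real)" "\<forall>a. 0 \<le> (m a :: real)"
      using xy by blast
    then show ?thesis
      by (intro CollectI exI[of _ "\<lambda>a. l a + m a"]) (auto simp: scaleR_left_distrib sum.distrib)
  qed
  have scale: "c *\<^sub>R x \<in> ?C" if xc: "x \<in> ?C" "0 \<le> c" for x c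
  proof -
    obtain l where "x = (\<Sum>a\<in>A. l a *\<^sub>R f a)" "\<forall>a. 0 \<le> (l a :: real)" using xc by blast
    then show ?thesis using xc(2)
      by (intro CollectI exI[of _ "\<lambda>a. c * l a"]) (auto simp: scaleR_sum_right)
  qed
  have "0 \<in> ?C" by (intro CollectI exI[of _ "\<lambda>_. 0"]) auto
  then show "convex_cone ?C"
    unfolding convex_cone_iff by (intro conjI ballI allI impI add scale)
qed

text \<open>
  The Karush--Kuhn--Tucker conditions: an inner normal of an intersection of disks at a boundary
  point \<open>p\<close> is a nonnegative combination of the directions from \<open>p\<close> to the active centers.
  Otherwise a hyperplane separates it from the cone of these directions, and the separating
  functional is represented by a tangent vector \<open>e\<close>. Tilting \<open>e\<close> slightly towards the interior
  point \<open>t0\<close> gives a direction in which the distance to every active center decreases to first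
  order while \<open>form M u\<close> decreases too, which contradicts that \<open>u\<close> is an inner normal.
\<close>
lemma normal_cone:
  assumes Q: "finite Q" "Q \<subseteq> points M" and p: "p \<in> points M" "\<And>q. q \<in> Q \<Longrightarrow> haver M q p \<le> gver M r"
    and r: "acute M r" and t0: "t0 \<in> points M" "\<And>q. q \<in> Q \<Longrightarrow> haver M q t0 < gver M r"
    and u: "unit M p u"
    and nonneg: "\<And>t. t \<in> points M \<Longrightarrow> (\<And>q. q \<in> Q \<Longrightarrow> haver M q t \<le> gver M r) \<Longrightarrow> 0 \<le> form M u (t - p)"
  shows "\<exists>l. (\<forall>q. 0 \<le> l q) \<and> u = (\<Sum>q\<in>{q\<in>Q. haver M q p = gver M r}. l q *\<^sub>R tpart M p q)"
proof (rule ccontr)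
  define A where "A = {q\<in>Q. haver M q p = gver M r}"
  define S where "S = convex_cone hull (tpart M p ` A)"
  assume "\<not> ?thesis"
  then have "u \<notin> {\<Sum>a\<in>A. l a *\<^sub>R tpart M p a | l. \<forall>a. 0 \<le> (l a :: real)}" unfolding A_def by blast
  moreover have "finite A" using Q by (simp add: A_def)
  ultimately have "u \<notin> S" unfolding S_def using convex_cone_hull_finite_subset by blast
  then obtain a b where ab: "a \<bullet> u < b" "\<And>x. x \<in> S \<Longrightarrow> b < a \<bullet> x"
    using separating_hyperplane_closed_point[of S u] \<open>finite A\<close>
    by (auto simp: S_def convex_convex_cone_hull closed_convex_cone_hull)
  have b: "b < 0" using ab(2)[of 0] by (simp add: S_def convex_cone_hull_contains_0)
  have S: "0 \<le> a \<bullet> x" if "x \<in> S" for x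
  proof (rule ccontr)
    assume neg: "\<not> 0 \<le> a \<bullet> x"
    then have "(b / (a \<bullet> x)) *\<^sub>R x \<in> S" unfolding S_def using that b
      by (intro convex_cone_hull_mul) (auto simp: S_def divide_nonpos_nonpos)
    from ab(2)[OF this] neg show False by simp
  qed
  \<comment> \<open>the tangent vector that represents the separating functional\<close>
  define e where "e = (a \<bullet> u) *\<^sub>R u + (a \<bullet> rot M p u) *\<^sub>R rot M p u"
  have et: "dual M p e = 0" using u dual_rot[of M p u] by (simp add: e_def unit_def)
  have e: "form M e w = a \<bullet> w" if "dual M p w = 0" for w
  proof -
    have "a \<bullet> w = a \<bullet> (form M w u *\<^sub>R u + form M w (rot M p u) *\<^sub>R rot M p u)"
      using tangent_decomp[OF p(1) u that] by simp
    then show ?thesis by (simp add: e_def inner_add_right form_commute[of M w] mult.commute)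
  qed
  define f where "f = tpart M p t0"
  have ft: "dual M p f = 0" using dual_tpart[OF p(1)] by (simp add: f_def)
  have fA: "0 < form M (tpart M p q) f" if "q \<in> A" for q
  proof -
    have q: "q \<in> points M" "haver M q p = gver M r" using that Q by (auto simp: A_def)
    note ta = tpart_active[OF p(1) q]
    have "haver M q t0 < gver M r" using t0(2) that by (auto simp: A_def)
    then have "gcos M r * haver M p t0 < form M (tpart M p q) (t0 - p)"
      using haver_step[OF p(1) ta(2,3) t0(1)] ta(1) by simp
    moreover have "0 \<le> gcos M r * haver M p t0" using gcos_pos[OF r] haver_bounds(1)[OF p(1) t0(1)] by simp
    ultimately show ?thesis using form_tpart[OF p(1) t0(1) ta(2)] by (simp add: f_def)
  qed
  \<comment> \<open>the tilt must not spoil the sign of \<open>form M e u\<close>\<close>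
  define N where "N = 1 + \<bar>form M f u\<bar>"
  define d where "d = - (a \<bullet> u) / 2 / N"
  have N: "0 < N" by (simp add: N_def)
  have ue: "a \<bullet> u < 0" using ab b by simp
  then have d: "0 < d" unfolding d_def using N by (intro divide_pos_pos) auto
  define g where "g = e + d *\<^sub>R f"
  have gt: "dual M p g = 0" by (simp add: g_def et ft)
  have gu: "form M g u < 0"
  proof -
    have "d * form M f u \<le> d * N" using d by (intro mult_left_mono) (auto simp: N_def)
    also have "\<dots> = - (a \<bullet> u) / 2" using N by (simp add: d_def)
    finally have "a \<bullet> u + d * form M f u < 0" using ue by linarith
    moreover have "form M e u = a \<bullet> u" using u by (intro e) (simp add: unit_def)
    ultimately show ?thesis by (simp add: g_def)
  qed
  have gA: "0 < form M g (tpart M p q)" if "q \<in> A" for q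
  proof -
    have "0 \<le> a \<bullet> tpart M p q" by (rule S) (auto simp: S_def that intro: hull_inc)
    moreover have "0 < d * form M f (tpart M p q)" using fA[OF that] d by (simp add: form_commute)
    ultimately show ?thesis using e dual_tpart[OF p(1)] by (simp add: g_def)
  qed
  define n where "n = sqrt (form M g g)"
  have "form M g g \<noteq> 0" using tangent_form_eq_0[OF p(1) gt] gu by auto
  then have n: "0 < n" using tangent_form_nonneg[OF p(1) gt] by (simp add: n_def)
  define h where "h = (1 / n) *\<^sub>R g"
  have h: "unit M p h" using n gt by (simp add: h_def unit_def) (simp add: n_def)
  have ev: "\<forall>\<^sub>F s in at_right 0. haver M q (gexp M p h s) \<le> gver M r" if "q \<in> Q" for q
  proof -
    have q: "q \<in> points M" using that Q by auto
    define D where "D = haver M q p"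
    have eq: "haver M q (gexp M p h s) = gcos M s * D + gver M s - gsin M s * form M h (q - p)" for s
      using haver_gexp[OF p(1) h q] by (simp add: D_def haver_commute)
    show ?thesis
    proof (cases "q \<in> A")
      case True
      then have D: "D = gver M r" by (simp add: A_def D_def)
      define G where "G = form M h (q - p)"
      have "0 < G" using gA[OF True] n form_tpart[OF p(1) q gt] divide_strict_right_mono[of "form M g p" "form M g q" n]
        by (simp add: h_def G_def)
      have le: "gcos M s * D + gver M s - gsin M s * G \<le> D" if "gcos M r * gver M s \<le> gsin M s * G" for s
        using that unfolding gcos_gver[of M s] gcos_gver[of M r] D by (simp add: algebra_simps)
      have "\<forall>\<^sub>F s in at_right 0. gcos M r * gver M s \<le> gsin M s * G"
      proof -
        have "((\<lambda>s. gcos M r * gver M s / gsin M s) \<longlongrightarrow> 0) (at_right 0)"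
        proof -
          have "\<forall>\<^sub>F s in at_right 0. gsin M s / (1 + gcos M s) = gver M s / gsin M s"
          proof -
            have "\<forall>\<^sub>F s in at_right (0::real). s \<in> {0<..<1}" by (rule eventually_at_right_real) simp
            then show ?thesis
            proof eventually_elim
              case (elim s)
              have "acute M s" using elim pi_gt3 by (auto simp: acute_def)
              then have "0 < gsin M s" "0 < gcos M s" using elim gsin_pos gcos_pos by auto
              then show ?case using gsin_squared[of M s] by (simp add: field_simps power2_eq_square)
            qed
          qed
          moreover have "((\<lambda>s. gsin M s / (1 + gcos M s)) \<longlongrightarrow> gsin M 0 / (1 + gcos M 0)) (at_right 0)"
          proof (rule tendsto_intros)
            have c: "isCont (gsin M) 0" "isCont (gcos M) 0"
              using continuous_on_gsin[OF continuous_on_id, of UNIV M] continuous_on_gcos[OF continuous_on_id, of UNIV M]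
              by (auto simp: continuous_on_eq_continuous_at)
            show "(gsin M \<longlongrightarrow> gsin M 0) (at_right 0)"
              using c(1) unfolding isCont_def by (rule tendsto_within_subset) simp
            have "(gcos M \<longlongrightarrow> gcos M 0) (at_right 0)"
              using c(2) unfolding isCont_def by (rule tendsto_within_subset) simp
            then show "((\<lambda>s. 1 + gcos M s) \<longlongrightarrow> 1 + gcos M 0) (at_right 0)"
              by (intro tendsto_add tendsto_const)
          qed simp
          ultimately have "((\<lambda>s. gver M s / gsin M s) \<longlongrightarrow> 0) (at_right 0)"
            using Lim_transform_eventually by (auto)
          from tendsto_mult_left[OF this, of "gcos M r"] show ?thesis by simp
        qed
        then have "\<forall>\<^sub>F s in at_right 0. gcos M r * gver M s / gsin M s < G" using \<open>0 < G\<close> by (rule order_tendstoD)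
        moreover have "\<forall>\<^sub>F s in at_right (0::real). s \<in> {0<..<1}" by (rule eventually_at_right_real) simp
        ultimately show ?thesis
        proof eventually_elim
          case (elim s)
          have "acute M s" using elim pi_gt3 by (auto simp: acute_def)
          then have "0 < gsin M s" using elim gsin_pos by auto
          then show ?case using elim by (simp add: field_simps)
        qed
      qed
      then show ?thesis unfolding eq G_def[symmetric] using le D by (auto elim!: eventually_mono)
    next
      case False
      then have "D < gver M r" using p(2)[OF that] that by (auto simp: A_def D_def)
      moreover have "((\<lambda>s. haver M q (gexp M p h s)) \<longlongrightarrow> D) (at_right 0)"
      proof -
        have "continuous_on UNIV (\<lambda>s. haver M q (gexp M p h s))" unfolding gexp_def by (intro continuous_intros)
        then have "isCont (\<lambda>s. haver M q (gexp M p h s)) 0" by (simp add: continuous_on_eq_continuous_at)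
        then show ?thesis unfolding isCont_def by (auto simp: D_def intro: tendsto_within_subset)
      qed
      ultimately show ?thesis by (auto elim!: eventually_mono dest!: order_tendstoD(2))
    qed
  qed
  have "\<forall>\<^sub>F s in at_right 0. \<forall>q\<in>Q. haver M q (gexp M p h s) \<le> gver M r"
    using ev Q by (simp add: eventually_ball_finite)
  moreover have "\<forall>\<^sub>F s in at_right (0::real). s \<in> {0<..<1}" by (rule eventually_at_right_real) simp
  ultimately have "\<forall>\<^sub>F s in at_right 0. (\<forall>q\<in>Q. haver M q (gexp M p h s) \<le> gver M r) \<and> s \<in> {0<..<1}"
    by (rule eventually_conj)
  from eventually_happens'[OF trivial_limit_at_right_real this]
  obtain s where s: "\<forall>q\<in>Q. haver M q (gexp M p h s) \<le> gver M r" "0 < s" "s < 1" by auto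
  have "acute M s" using s pi_gt3 by (auto simp: acute_def)
  then have "0 < gsin M s" using s gsin_pos by auto
  have "0 \<le> form M u (gexp M p h s - p)" using nonneg[OF gexp_points[OF p(1) h]] s(1) by blast
  also have "\<dots> = form M u (tpart M p (gexp M p h s))"
    using form_tpart[OF p(1) gexp_points[OF p(1) h]] u by (simp add: unit_def)
  also have "tpart M p (gexp M p h s) = gsin M s *\<^sub>R h"
    using h points_dual[OF p(1)] by (simp add: tpart_def gexp_def unit_def)
  also have "form M u \<dots> < 0" using \<open>0 < gsin M s\<close> gu n by (simp add: h_def form_commute[of M u] mult_less_0_iff divide_less_0_iff)
  finally show False by simp
qed

section \<open>Supporting lines and the minimal width\<close>

lemma form_eq_inner: assumes "dual M p u = 0" "p \<in> points M"
  shows "\<exists>n. \<forall>t\<in>points M. n \<bullet> t = form M u (t - p)"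
proof (cases "M = Euclidean")
  case True
  then show ?thesis
    by (intro exI[of _ "vector [u $ 1, u $ 2, - form M u p] :: real^3"])
      (auto simp: inner_vec_def sum_3 form_def points.simps algebra_simps)
next
  case False
  then show ?thesis using form_point(2)[OF assms(1) False]
    by (intro exI[of _ "vector [u $ 1, u $ 2, kappa M * u $ 3] :: real^3"])
      (auto simp: inner_vec_def sum_3 form_def algebra_simps)
qed

lemma dual_eq_inner: "\<exists>n. \<forall>t. n \<bullet> t = dual M p t"
  by (intro exI[of _ "vector [kappa M * p $ 1, kappa M * p $ 2, p $ 3] :: real^3"])
    (auto simp: inner_vec_def sum_3 dual_def algebra_simps)

text \<open>
  Lines are given by linear functionals on \<open>real^3\<close>; restricted to the plane, a functional that
  vanishes at \<open>p\<close> is a multiple of \<open>form M u (x - p)\<close> for a unit tangent vector \<open>u\<close> at \<open>p\<close>.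
\<close>
lemma supporting_normal:
  assumes "K \<subseteq> points M" "supporting_line M K H"
  obtains p u where "p \<in> K" "unit M p u" "\<And>t. t \<in> K \<Longrightarrow> 0 \<le> form M u (t - p)" "H = {x \<in> points M. form M u (x - p) = 0}"
proof -
  obtain n p where n: "n \<noteq> 0" "H = {x \<in> points M. n \<bullet> x = 0}" "\<And>x. x \<in> K \<Longrightarrow> n \<bullet> x \<ge> 0" and p: "p \<in> K" "p \<in> H"
    using assms(2) unfolding supporting_line_def by blast
  have pp: "p \<in> points M" "n \<bullet> p = 0" using p n(2) by auto
  define u0 :: "real^3" where "u0 = vector [n $ 1, n $ 2, kappa M * n $ 3]"
  have t: "dual M p u0 = 0" using pp(2)
    by (cases M) (auto simp: u0_def dual_def inner_vec_def sum_3 algebra_simps points.simps)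
  have f: "form M u0 (t - p) = n \<bullet> t" if "t \<in> points M" for t
  proof -
    have "form M u0 (t - p) = n \<bullet> (t - p)"
      using that pp(1) by (cases M) (auto simp: u0_def form_def inner_vec_def sum_3 points.simps)
    then show ?thesis using pp(2) by (simp add: inner_diff_right)
  qed
  have "u0 \<noteq> 0"
  proof
    assume "u0 = 0"
    then have 0: "n $ 1 = 0" "n $ 2 = 0" "kappa M * n $ 3 = 0"
      unfolding u0_def by (metis vector_3 zero_index)+
    have "n $ 3 = 0"
    proof (cases "M = Euclidean")
      case True
      then show ?thesis using pp 0 by (simp add: inner_vec_def sum_3 points.simps)
    next
      case False then show ?thesis using 0(3) kappa_cases[OF False] by auto
    qed
    with 0 n(1) show False by (simp add: vec_eq_iff forall_3)
  qed
  then have pos: "0 < form M u0 u0" using tangent_form_nonneg[OF pp(1) t] tangent_form_eq_0[OF pp(1) t] by fastforce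
  define c where "c = 1 / sqrt (form M u0 u0)"
  have c: "0 < c" "c * (c * form M u0 u0) = 1" using pos
    by (simp_all add: c_def field_simps)
  have f': "form M (c *\<^sub>R u0) (t - p) = c * (n \<bullet> t)" if "t \<in> points M" for t
    using f[OF that] by (metis form_scaleR(1))
  show thesis
  proof (rule that[of p "c *\<^sub>R u0"])
    show "unit M p (c *\<^sub>R u0)" using t c by (simp add: unit_def)
    have "form M (c *\<^sub>R u0) (x - p) = 0 \<longleftrightarrow> n \<bullet> x = 0" if "x \<in> points M" for x
      unfolding f'[OF that] using c(1) by simp
    then show "H = {x \<in> points M. form M (c *\<^sub>R u0) (x - p) = 0}" unfolding n(2) by blast
    show "0 \<le> form M (c *\<^sub>R u0) (t - p)" if "t \<in> K" for t
    proof -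
      have "t \<in> points M" using that assms(1) by auto
      then show ?thesis unfolding f'[OF \<open>t \<in> points M\<close>] using n(3)[OF that] c(1) by simp
    qed
  qed (rule p)
qed

text \<open>
  The functional of the line orthogonal to the geodesic from \<open>p\<close> at parameter \<open>s\<close>, expressed at
  \<open>p\<close>.
\<close>
lemma form_gdir:
  assumes "p \<in> points M" "unit M p u" "t \<in> points M"
  shows "form M (gdir M p u s) (t - gexp M p u s) = gcos M s * form M u (t - p) - gsin M s * dual M p t"
    and "dual M (gexp M p u s) t = gcos M s * dual M p t + kappa M * gsin M s * form M u (t - p)"
proof -
  have "form M (gdir M p u s) (t - gexp M p u s) = gcos M s * form M u (t - p) - gsin M s * dual M p t \<and>
    dual M (gexp M p u s) t = gcos M s * dual M p t + kappa M * gsin M s * form M u (t - p)"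
  proof (cases "M = Euclidean")
    case True
    have "u $ 3 = 0" "p $ 3 = 1" "t $ 3 = 1" using assms True by (auto simp: unit_def dual_def points.simps)
    then show ?thesis using assms True
      by (simp add: gdir_def gexp_def unit_def dual_def algebra_simps)
  next
    case False
    have z: "form M u p = 0" "form M p u = 0" "form M u u = 1" "form M p p = kappa M"
      using assms form_point[of M p u] False points_dual[OF assms(1)] dual_form[OF False, of p p] kappa_cases[OF False]
      by (auto simp: unit_def)
    show ?thesis using kappa_cases[OF False]
      by (auto simp: gdir_def gexp_def dual_form[OF False] z algebra_simps)
  qed
  then show "form M (gdir M p u s) (t - gexp M p u s) = gcos M s * form M u (t - p) - gsin M s * dual M p t"
    and "dual M (gexp M p u s) t = gcos M s * dual M p t + kappa M * gsin M s * form M u (t - p)" by auto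
qed

lemma form_gexp:
  assumes "p \<in> points M" "unit M p u" "dual M p v = 0"
  shows "form M v (gexp M p u s - p) = gsin M s * form M v u"
proof (cases "M = Euclidean")
  case False
  then show ?thesis using assms form_point[of M p v] by (simp add: gexp_def unit_def)
qed (simp add: gexp_def)

lemma supporting_line_intro:
  assumes K: "K \<subseteq> points M" and a: "a \<in> K" "unit M a n" and pos: "\<And>t. t \<in> K \<Longrightarrow> 0 \<le> form M n (t - a)"
  shows "supporting_line M K {x \<in> points M. form M n (x - a) = 0}"
proof -
  have aP: "a \<in> points M" using a K by auto
  obtain l where l: "\<forall>t\<in>points M. l \<bullet> t = form M n (t - a)" using form_eq_inner[OF _ aP, of n] a(2) by (auto simp: unit_def)
  have "l \<bullet> gexp M a n 1 = gsin M 1"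
    using l gexp_points[OF aP a(2)] form_gexp[OF aP a(2), of n 1] a(2) by (simp add: unit_def)
  moreover have "0 < gsin M 1" using pi_gt3 by (intro gsin_pos) (auto simp: acute_def)
  ultimately have "l \<noteq> 0" by auto
  moreover have "a \<in> K \<inter> {x \<in> points M. form M n (x - a) = 0}" using a aP by simp
  ultimately show ?thesis unfolding supporting_line_def using l pos K by (auto simp: subset_iff)
qed

lemma unit_transfer:
  assumes "p \<in> points M" "unit M p u" "x \<in> points M" "form M u (x - p) = 0"
  shows "unit M x u" "form M u (y - p) = form M u (y - x)"
proof -
  have "dual M x u = 0"
  proof (cases "M = Euclidean")
    case True
    then show ?thesis using assms by (simp add: unit_def dual_def points.simps)
  next
    case False
    then show ?thesis using assms form_point[of M p u] dual_form[OF False, of x u] form_commute[of M x u]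
      by (simp add: unit_def)
  qed
  then show "unit M x u" using assms(2) by (simp add: unit_def)
  show "form M u (y - p) = form M u (y - x)" using assms(4) by simp
qed

text \<open>
  The value \<open>form M u (y - p)\<close> is \<open>gsin\<close> of the signed distance of \<open>y\<close> from the line, so it bounds
  the distance from \<open>y\<close> to any point of the line from below.
\<close>
lemma form_le_gsin_gdist:
  assumes "p \<in> points M" "unit M p u" "x \<in> points M" "form M u (x - p) = 0" "y \<in> points M"
  shows "form M u (y - p) \<le> gsin M (gdist M x y)"
proof -
  note x = unit_transfer[OF assms(1-4)]
  obtain e where e: "unit M x e" "y = gexp M x e (gdist M x y)" using ex_gexp assms by metis
  have "form M u (y - p) = gsin M (gdist M x y) * form M u e"
    using form_gexp[OF assms(3) e(1), of u "gdist M x y"] x e by (simp add: unit_def)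
  also have "\<dots> \<le> gsin M (gdist M x y) * 1"
    using form_unit_le[OF assms(3) x(1) e(1)] gsin_nonneg[OF gdist_gver(2)[OF assms(3,5)]] by (intro mult_left_mono) auto
  finally show ?thesis by simp
qed

lemma form_in_disk:
  assumes "p \<in> points M" "unit M p u" "t \<in> points M" "acute M r" "haver M (gexp M p u r) t \<le> gver M r"
  shows "gcos M r * haver M p t \<le> gsin M r * form M u (t - p)" "0 \<le> form M u (t - p)"
proof -
  show *: "gcos M r * haver M p t \<le> gsin M r * form M u (t - p)"
    using haver_gexp[OF assms(1,2,3), of r] assms(5) by simp
  show "0 \<le> form M u (t - p)"
  proof (cases "r = 0")
    case True
    then have "haver M p t = 0" using assms(5) haver_bounds(1)[OF assms(1,3)] by simp
    then have "gdist M p t = 0" using gdist_eq_iff[OF assms(1,3), of 0] by (auto simp: lengths_def)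
    then have "t = p" using ex_gexp[OF assms(1,3)] by auto
    then show ?thesis by simp
  next
    case False
    then have "0 < gsin M r" using assms(4) by (intro gsin_pos) (auto simp: acute_def)
    moreover have "0 \<le> gcos M r * haver M p t" using gcos_pos[OF assms(4)] haver_bounds(1)[OF assms(1,3)] by simp
    ultimately show ?thesis using * by (smt (verit) zero_le_mult_iff)
  qed
qed

text \<open>
  A point within \<open>r - w\<close> of the center of the disk that touches a line from inside at \<open>p\<close> lies in
  a disk that touches, at depth \<open>w\<close> on the normal geodesic, the line orthogonal to that geodesic;
  so it lies beyond that orthogonal line. On the sphere the lines orthogonal to a geodesic
  converge, hence lying beyond does not bound the distance from the original line, and the second
  claim is proved separately from the disk condition.
\<close>
lemma beyond_of_near:
  assumes p: "p \<in> points M" "unit M p u" and t: "t \<in> points M" and r: "acute M r" "0 \<le> w" "w \<le> r"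
    and d: "gdist M (gexp M p u r) t \<le> r - w"
  shows "0 \<le> gcos M w * form M u (t - p) - gsin M w * dual M p t"
    and "M \<noteq> Hyperbolic \<Longrightarrow> gsin M w \<le> form M u (t - p)"
proof -
  let ?p = "gexp M p u w" and ?u = "gdir M p u w"
  note pu = gexp_points[OF p, of w] unit_gdir[OF p, of w]
  have a: "acute M (r - w)" using r by (intro acute_mono[OF r(1)]) auto
  have q: "gexp M p u r = gexp M ?p ?u (r - w)" by (simp add: gexp_gexp)
  have h: "haver M (gexp M ?p ?u (r - w)) t \<le> gver M (r - w)"
    using d gdist_le_iff[OF gexp_points[OF p, of r] t acute_lengths[OF a]] unfolding q by simp
  note f = form_in_disk[OF pu t a h]
  show "0 \<le> gcos M w * form M u (t - p) - gsin M w * dual M p t"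
    using f(2) form_gdir(1)[OF p t, of w] by simp
  assume "M \<noteq> Hyperbolic"
  have bk: "gexp M ?p ?u (- w) = p" "gdir M ?p ?u (- w) = u"
    using gexp_gexp[of M p u w "-w"] gdir_gdir[of M p u w "-w"] by simp_all
  have eq: "form M u (t - p) = gcos M w * form M ?u (t - ?p) + gsin M w * dual M ?p t"
    using form_gdir(1)[OF pu t, of "- w"] unfolding bk by simp
  have dd: "dual M ?p t = 1 - kappa M * haver M ?p t" by (rule dual_haver[OF pu(1) t])
  show "gsin M w \<le> form M u (t - p)"
  proof (cases M)
    case Euclidean
    then show ?thesis using eq f(2) dd by simp
  next
    case Spherical
    define h f' where "h = haver M ?p t" "f' = form M ?u (t - ?p)"
    have "gcos M (w + (r - w)) \<ge> 0" using gcos_pos[OF r(1)] by simp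
    then have c: "gsin M w * gsin M (r - w) \<le> gcos M w * gcos M (r - w)"
      unfolding gcos_add using Spherical by simp
    have h0: "0 \<le> h" using haver_bounds(1)[OF pu(1) t] by (simp add: h_f'_def)
    have aw: "acute M w" using r by (intro acute_mono[OF r(1)]) auto
    have key: "gsin M w * h \<le> gcos M w * f'"
    proof (cases "gsin M (r - w) = 0")
      case True
      then have "h \<le> 0" using f(1) gcos_pos[OF a] by (auto simp: h_f'_def mult_le_0_iff)
      then show ?thesis using h0 f(2) gcos_pos[OF aw] by (simp add: h_f'_def)
    next
      case False
      then have S: "0 < gsin M (r - w)" using gsin_nonneg[OF acute_lengths[OF a]] by simp
      have "gsin M (r - w) * (gsin M w * h) \<le> gcos M w * (gcos M (r - w) * h)"
        using mult_right_mono[OF c h0] by (simp add: mult_ac)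
      also have "\<dots> \<le> gcos M w * (gsin M (r - w) * f')"
        using f(1) gcos_pos[OF aw] by (intro mult_left_mono) (auto simp: h_f'_def)
      finally have "gsin M (r - w) * (gsin M w * h) \<le> gsin M (r - w) * (gcos M w * f')" by (simp add: mult_ac)
      then show ?thesis using S by simp
    qed
    have "form M u (t - p) = gcos M w * f' + gsin M w * (1 - h)"
      unfolding eq h_f'_def(2) dd using Spherical by (simp add: h_f'_def(1))
    then show ?thesis using key by (simp add: algebra_simps del: form_diff)
  qed (use \<open>M \<noteq> Hyperbolic\<close> in simp)
qed

text \<open>
  In the Euclidean and the hyperbolic plane the line orthogonal to the normal geodesic at depth
  \<open>w\<close> stays at distance at least \<open>w\<close> from the supporting line.
\<close>
lemma gsin_le_of_beyond:
  assumes p: "p \<in> points M" "unit M p u" and y: "y \<in> points M" and M: "M \<noteq> Spherical" and w: "0 \<le> w"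
    and l: "0 \<le> gcos M w * form M u (y - p) - gsin M w * dual M p y"
  shows "gsin M w \<le> form M u (y - p)"
proof (cases M)
  case Euclidean
  then show ?thesis using l dual_haver[OF p(1) y] by simp
next
  case Hyperbolic
  define f Y where "f = form M u (y - p)" "Y = dual M p y"
  have l': "sinh w * Y \<le> cosh w * f" using l Hyperbolic by (simp add: f_Y_def)
  have D: "Y = 1 + haver M p y" using dual_haver[OF p(1) y] Hyperbolic by (simp add: f_Y_def)
  have Y1: "1 \<le> Y" using D haver_bounds(1)[OF p(1) y] by simp
  have "f\<^sup>2 \<le> form M (tpart M p y) (tpart M p y)"
  proof -
    have "f = form M (tpart M p y) u"
      using form_tpart[OF p(1) y, of u] p by (simp add: f_Y_def unit_def form_commute)
    then show ?thesis using tangent_Cauchy_Schwarz[OF p(1) dual_tpart[OF p(1)], of u y] p by (simp add: unit_def)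
  qed
  also have "\<dots> = Y\<^sup>2 - 1" unfolding form_tpart_tpart[OF p(1) y] D using Hyperbolic by (simp add: power2_eq_square algebra_simps)
  finally have Yf: "1 + f\<^sup>2 \<le> Y\<^sup>2" by simp
  have f0: "0 \<le> f"
  proof -
    have "0 \<le> sinh w * Y" using w Y1 by simp
    then have "0 \<le> cosh w * f" using l' by simp
    then show ?thesis using cosh_real_pos[of w] by (auto simp: zero_le_mult_iff)
  qed
  have "(sinh w)\<^sup>2 * (1 + f\<^sup>2) \<le> (sinh w)\<^sup>2 * Y\<^sup>2" using Yf by (intro mult_left_mono) auto
  also have "\<dots> = (sinh w * Y)\<^sup>2" by (simp add: power_mult_distrib)
  also have "\<dots> \<le> (cosh w * f)\<^sup>2" using l' w Y1 by (intro power_mono) auto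
  also have "\<dots> = (1 + (sinh w)\<^sup>2) * f\<^sup>2" by (simp add: power_mult_distrib cosh_square_eq)
  finally have "(sinh w)\<^sup>2 \<le> f\<^sup>2" by (simp add: algebra_simps)
  then have "sinh w \<le> f" using f0 by (rule power2_le_imp_le)
  then show ?thesis using Hyperbolic by (simp add: f_Y_def)
qed (use M in simp)

lemma gsin_le_imp_le: "M \<noteq> Spherical \<Longrightarrow> gsin M s \<le> gsin M t \<Longrightarrow> s \<le> t"
  by (cases M) auto

lemma line_distance_ge:
  assumes "H \<noteq> {}" "H' \<noteq> {}" "\<And>x y. x \<in> H \<Longrightarrow> y \<in> H' \<Longrightarrow> c \<le> gdist M x y"
  shows "c \<le> line_distance M H H'"
  unfolding line_distance_def using assms by (intro cINF_greatest) auto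

lemma line_distance_le:
  assumes "H \<subseteq> points M" "H' \<subseteq> points M" "x \<in> H" "y \<in> H'"
  shows "line_distance M H H' \<le> gdist M x y"
  unfolding line_distance_def
  using cINF_lower[of "\<lambda>(x, y). gdist M x y" "H \<times> H'" "(x, y)"] assms gdist_nonneg
  by (force intro!: bdd_belowI2[of _ 0])

text \<open>
  Conditions under which a set has minimal width at least \<open>w\<close>. At every point \<open>p\<close> of \<open>K\<close> with an
  inner normal \<open>u\<close>, the disk of radius \<open>r\<close> that touches the supporting line at \<open>p\<close> contains \<open>K\<close>,
  and some point of \<open>K\<close> lies beyond the line orthogonal to the normal geodesic at depth \<open>w\<close> and
  has distance at least \<open>w\<close> from the supporting line. The last condition says \<open>0 < gcos M (w -
  r)\<close>, which makes slopes of lines seen from the center of the touching disk comparable; it covers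
  \<open>w \<le> r\<close> as well as \<open>r < w\<close>.
\<close>
locale wide_set =
  fixes M K r w
  assumes K: "K \<subseteq> points M" "compact K" and r: "acute M r" "0 < r" and w: "acute M w" "0 < w"
    and tangent_disk: "\<And>p u t. p \<in> K \<Longrightarrow> unit M p u \<Longrightarrow> (\<And>t. t \<in> K \<Longrightarrow> 0 \<le> form M u (t - p)) \<Longrightarrow> t \<in> K \<Longrightarrow>
        haver M (gexp M p u r) t \<le> gver M r"
    and beyond: "\<And>p u. p \<in> K \<Longrightarrow> unit M p u \<Longrightarrow> (\<And>t. t \<in> K \<Longrightarrow> 0 \<le> form M u (t - p)) \<Longrightarrow>
        \<exists>t\<in>K. 0 \<le> gcos M w * form M u (t - p) - gsin M w * dual M p t \<and> gsin M w \<le> form M u (t - p)"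
    and small: "r - w \<in> {- pi / 2<..<pi / 2} \<or> M \<noteq> Spherical"
begin

text \<open>
  A supporting line on the opposite side, orthogonal to the normal geodesic at \<open>p\<close>. In the central
  projection from the origin to the tangent plane at the center of the touching disk, lines become
  lines, and the function \<open>h\<close> below is the coordinate in the direction of the normal geodesic; its
  maximum \<open>k\<close> over \<open>K\<close> gives the line. The last two inequalities say that \<open>p\<close> lies strictly on the
  inner side of that line and that the line crosses the geodesic at depth at least \<open>w\<close>.
\<close>
lemma opposite_line:
  assumes p: "p \<in> K" "unit M p u" "\<And>t. t \<in> K \<Longrightarrow> 0 \<le> form M u (t - p)"
  shows "\<exists>k. (\<forall>t\<in>K. 0 \<le> k * dual M (gexp M p u r) t - form M (gdir M p u r) (t - gexp M p u r)) \<and>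
    (\<exists>t\<in>K. k * dual M (gexp M p u r) t - form M (gdir M p u r) (t - gexp M p u r) = 0) \<and>
    (\<forall>t\<in>K. 0 < dual M (gexp M p u r) t) \<and> 0 < k * gcos M r + gsin M r \<and> 0 \<le> gcos M (w - r) * k - gsin M (w - r)"
proof -
  have pP: "p \<in> points M" using p K by auto
  let ?q = "gexp M p u r" and ?v = "gdir M p u r"
  have q: "?q \<in> points M" "unit M ?q ?v" using gexp_points[OF pP p(2)] unit_gdir[OF pP p(2)] by auto
  have pos: "0 < dual M ?q t" if "t \<in> K" for t
  proof -
    have t: "t \<in> points M" "haver M ?q t \<le> gver M r" using tangent_disk[OF p that] that K by auto
    then have "dual M ?q t \<ge> min 1 (gcos M r)"
      unfolding dual_haver[OF q(1) t(1)] gcos_gver using haver_bounds(1)[OF q(1) t(1)] by (cases M) auto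
    then show ?thesis using gcos_pos[OF r(1)] by auto
  qed
  define h where "h t = form M ?v (t - ?q) / dual M ?q t" for t
  have "continuous_on K h" unfolding h_def using pos by (intro continuous_intros) force+
  then obtain t' where t': "t' \<in> K" "\<And>t. t \<in> K \<Longrightarrow> h t \<le> h t'"
    using continuous_attains_sup[OF K(2)] p(1) by blast
  define k where "k = h t'"
  obtain t where t: "t \<in> K" "0 \<le> gcos M w * form M u (t - p) - gsin M w * dual M p t" using beyond[OF p] by blast
  have tP: "t \<in> points M" using t K by auto
  have C: "0 < gcos M (w - r)" using small by (cases M) (auto simp: cosh_real_pos intro!: cos_gt_zero_pi)
  have eq: "gexp M ?q ?v (w - r) = gexp M p u w" by (simp add: gexp_gexp)
  have eq': "gdir M ?q ?v (w - r) = gdir M p u w" by (simp add: gdir_gdir)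
  have "0 \<le> gcos M (w - r) * form M ?v (t - ?q) - gsin M (w - r) * dual M ?q t"
    using t(2) form_gdir(1)[OF q tP, of "w - r"] form_gdir(1)[OF pP p(2) tP, of w] unfolding eq eq' by simp
  then have "gsin M (w - r) \<le> gcos M (w - r) * h t" using pos[OF t(1)] by (simp add: h_def field_simps)
  also have "\<dots> \<le> gcos M (w - r) * k" using t'(2)[OF t(1)] C by (simp add: k_def)
  finally have k: "gsin M (w - r) \<le> gcos M (w - r) * k" .
  show ?thesis
  proof (intro exI[of _ k] conjI ballI)
    show "0 \<le> k * dual M ?q t - form M ?v (t - ?q)" if "t \<in> K" for t
      using t'(2)[OF that] pos[OF that] by (simp add: k_def h_def[of t] field_simps)
    show "\<exists>t\<in>K. k * dual M ?q t - form M ?v (t - ?q) = 0"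
      using t'(1) pos[OF t'(1)] by (intro bexI[of _ t']) (auto simp: k_def h_def)
    show "0 < k * gcos M r + gsin M r"
    proof -
      have "0 < gsin M ((w - r) + r)" using gsin_pos[OF w] by simp
      also have "\<dots> = gsin M (w - r) * gcos M r + gcos M (w - r) * gsin M r" by (rule gsin_add)
      also have "\<dots> \<le> gcos M (w - r) * k * gcos M r + gcos M (w - r) * gsin M r"
        using k gcos_pos[OF r(1)] by (intro add_right_mono mult_right_mono) auto
      also have "\<dots> = gcos M (w - r) * (k * gcos M r + gsin M r)" by (simp add: algebra_simps)
      finally show ?thesis using C by (simp add: zero_less_mult_iff)
    qed
    show "0 \<le> gcos M (w - r) * k - gsin M (w - r)" using k by simp
  qed (rule pos)
qed

lemma ex_far_line:
  assumes M: "M \<noteq> Spherical" and H: "supporting_line M K H"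
  shows "\<exists>H'. supporting_line M K H' \<and> H \<inter> H' = {} \<and> w \<le> line_distance M H H'"
proof -
  obtain p u where p: "p \<in> K" "unit M p u" "\<And>t. t \<in> K \<Longrightarrow> 0 \<le> form M u (t - p)"
    and H': "H = {x \<in> points M. form M u (x - p) = 0}" by (rule supporting_normal[OF K(1) H], rule that, assumption+)
  have pP: "p \<in> points M" using p K by auto
  let ?q = "gexp M p u r" and ?v = "gdir M p u r"
  have q: "?q \<in> points M" "unit M ?q ?v" using gexp_points[OF pP p(2)] unit_gdir[OF pP p(2)] by auto
  obtain k where k: "\<And>t. t \<in> K \<Longrightarrow> 0 \<le> k * dual M ?q t - form M ?v (t - ?q)"
    "\<exists>t\<in>K. k * dual M ?q t - form M ?v (t - ?q) = 0" "\<And>t. t \<in> K \<Longrightarrow> 0 < dual M ?q t"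
    "0 < k * gcos M r + gsin M r" "0 \<le> gcos M (w - r) * k - gsin M (w - r)"
    using opposite_line[OF p] by blast
  obtain n1 n2 where n: "\<forall>t\<in>points M. n1 \<bullet> t = form M ?v (t - ?q)" "\<forall>t. n2 \<bullet> t = dual M ?q t"
    using form_eq_inner[OF _ q(1), of ?v] q(2) dual_eq_inner[of M ?q] by (auto simp: unit_def)
  define n where "n = k *\<^sub>R n2 - n1"
  have nt: "n \<bullet> t = k * dual M ?q t - form M ?v (t - ?q)" if "t \<in> points M" for t
    using n that unfolding n_def inner_diff_left inner_scaleR_left by simp
  define H2 where "H2 = {x \<in> points M. n \<bullet> x = 0}"
  have "n \<bullet> p = k * gcos M r + gsin M r"
    using nt[OF pP] form_gdir[OF pP p(2) pP, of r] points_dual[OF pP] by simp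
  then have "n \<noteq> 0" using k(4) by auto
  then have s: "supporting_line M K H2"
    unfolding supporting_line_def using k(1,2) nt K(1) by (auto simp: H2_def subset_iff)
  have far: "gsin M w \<le> form M u (y - p)" if "y \<in> H2" for y
  proof (rule gsin_le_of_beyond[OF pP p(2) _ M])
    show y: "y \<in> points M" using that by (simp add: H2_def)
    have "0 < dual M ?q y" unfolding dual_haver[OF q(1) y] using haver_bounds(1)[OF q(1) y] M
      by (cases M) auto
    then have "0 \<le> (gcos M (w - r) * k - gsin M (w - r)) * dual M ?q y" using k(5) by simp
    also have "\<dots> = gcos M (w - r) * form M ?v (y - ?q) - gsin M (w - r) * dual M ?q y"
      using nt[OF y] that by (simp add: H2_def algebra_simps)
    also have "\<dots> = gcos M w * form M u (y - p) - gsin M w * dual M p y"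
      using form_gdir(1)[OF q y, of "w - r"] form_gdir(1)[OF pP p(2) y, of w]
      unfolding gexp_gexp gdir_gdir by simp
    finally show "0 \<le> gcos M w * form M u (y - p) - gsin M w * dual M p y" .
  qed (use w in simp)
  have "0 < gsin M w" using gsin_pos[OF w] .
  then have "H \<inter> H2 = {}" using far H' by force
  moreover have "w \<le> line_distance M H H2"
  proof (rule line_distance_ge)
    show "H \<noteq> {}" "H2 \<noteq> {}" using H s by (auto simp: supporting_line_def)
    fix x y assume xy: "x \<in> H" "y \<in> H2"
    then have "gsin M w \<le> gsin M (gdist M x y)"
      using far[OF xy(2)] form_le_gsin_gdist[OF pP p(2), of x y] H' by (auto simp: H2_def)
    then show "w \<le> gdist M x y" using gsin_le_imp_le[OF M] by blast
  qed
  ultimately show ?thesis using s by blast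
qed

lemma line_distance_bound:
  assumes "supporting_line M K H" "supporting_line M K H'"
  shows "line_distance M H H' \<le> 2 * r"
proof -
  obtain p u where p: "p \<in> K" "unit M p u" "\<And>t. t \<in> K \<Longrightarrow> 0 \<le> form M u (t - p)"
    and H': "H = {x \<in> points M. form M u (x - p) = 0}" by (rule supporting_normal[OF K(1) assms(1)], rule that, assumption+)
  obtain p' where p': "p' \<in> K" "p' \<in> H'" using assms(2) by (auto simp: supporting_line_def)
  have P: "p \<in> points M" "p' \<in> points M" using p p' K by auto
  have q: "gexp M p u r \<in> points M" using gexp_points[OF P(1) p(2)] .
  have "gdist M (gexp M p u r) p \<le> r" "gdist M (gexp M p u r) p' \<le> r"
    using tangent_disk[OF p] p(1) p'(1) gdist_le_iff[OF q _ acute_lengths[OF r(1)]] P by auto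
  then have "gdist M p p' \<le> 2 * r" using gdist_triangle[OF P(1) q P(2)] gdist_commute[OF P(1) q] by linarith
  moreover have "line_distance M H H' \<le> gdist M p p'"
    using assms(2) p' H' P by (intro line_distance_le) (auto simp: supporting_line_def)
  ultimately show ?thesis by linarith
qed

lemma opposite_lune:
  assumes M: "M = Spherical" and H: "supporting_line M K H"
  shows "\<exists>a b. supporting_lune K a b \<and> great_circle a = H"
proof -
  obtain p u where p: "p \<in> K" "unit M p u" "\<And>t. t \<in> K \<Longrightarrow> 0 \<le> form M u (t - p)"
    and H': "H = {x \<in> points M. form M u (x - p) = 0}" by (rule supporting_normal[OF K(1) H], rule that, assumption+)
  have pP: "p \<in> points M" using p K by auto
  let ?q = "gexp M p u r" and ?v = "gdir M p u r"
  have q: "?q \<in> points M" "unit M ?q ?v" using gexp_points[OF pP p(2)] unit_gdir[OF pP p(2)] by auto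
  obtain k where k: "\<And>t. t \<in> K \<Longrightarrow> 0 \<le> k * dual M ?q t - form M ?v (t - ?q)"
    "\<exists>t\<in>K. k * dual M ?q t - form M ?v (t - ?q) = 0" "\<And>t. t \<in> K \<Longrightarrow> 0 < dual M ?q t"
    "0 < k * gcos M r + gsin M r" "0 \<le> gcos M (w - r) * k - gsin M (w - r)"
    using opposite_line[OF p] by blast
  have ip: "x \<bullet> y = dual M x y" "form M x y = dual M x y" for x y :: "real^3"
    using M by (auto simp: inner_vec_def sum_3 dual_def form_def)
  have pu: "dual M u p = 0" "dual M p u = 0" "dual M u u = 1" using p(2) ip(2)[of u u] by (auto simp: unit_def dual_commute)
  have vq: "dual M ?v ?q = 0" "dual M ?q ?v = 0" "dual M ?v ?v = 1" using q(2) ip(2)[of ?v ?v] by (auto simp: unit_def dual_commute)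
  define b0 where "b0 = k *\<^sub>R ?q - ?v"
  have b0: "dual M b0 t = k * dual M ?q t - form M ?v (t - ?q)" for t
    using vq by (simp add: b0_def ip)
  have nb: "dual M b0 b0 = k\<^sup>2 + 1" using vq points_dual[OF q(1)] by (simp add: b0_def power2_eq_square)
  define c where "c = 1 / sqrt (k\<^sup>2 + 1)"
  have c: "0 < c" "c * (c * (k\<^sup>2 + 1)) = 1"
  proof -
    have "0 < k\<^sup>2 + 1" by (simp add: add_nonneg_pos)
    then show "0 < c" "c * (c * (k\<^sup>2 + 1)) = 1" by (simp_all add: c_def field_simps)
  qed
  define b where "b = c *\<^sub>R b0"
  have bP: "b \<in> sphere 0 1"
    using c nb by (simp only: mem_sphere_0 norm_eq_1 ip b_def dual_scaleR)
  have uP: "u \<in> sphere 0 1" using pu by (simp add: norm_eq_1 ip)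
  have KP: "t \<in> sphere 0 1" if "t \<in> K" for t using that K M by (auto simp: points.simps)
  have ut: "dual M u t = form M u (t - p)" for t using pu by (simp add: ip)
  have bp: "0 < b \<bullet> p"
    using c(1) k(4) form_gdir[OF pP p(2) pP, of r] points_dual[OF pP] by (simp add: ip(1) b_def b0)
  obtain t' where t': "t' \<in> K" "dual M b0 t' = 0" using k(2) b0 by auto
  have t'P: "t' \<in> points M" using t' K by auto
  have ut': "0 < u \<bullet> t'"
  proof -
    have "u = gsin M r *\<^sub>R ?q + gcos M r *\<^sub>R ?v"
    proof -
      have "gsin M r *\<^sub>R ?q + gcos M r *\<^sub>R ?v = (gcos M r * gcos M r + gsin M r * gsin M r) *\<^sub>R u"
        using M by (simp only: gdir_def gexp_def kappa.simps) (simp add: algebra_simps del: gcos.simps gsin.simps)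
      also have "gcos M r * gcos M r + gsin M r * gsin M r = 1" using gcos_gsin[of M r] M by (simp add: power2_eq_square)
      finally show ?thesis by simp
    qed
    then have "dual M u t' = gsin M r * dual M ?q t' + gcos M r * dual M ?v t'" by (metis dual_add(1) dual_scaleR(1))
    also have "dual M ?v t' = k * dual M ?q t'" using t'(2) by (simp add: b0_def)
    finally have "dual M u t' = (k * gcos M r + gsin M r) * dual M ?q t'" by (simp add: algebra_simps)
    then show ?thesis using k(3)[OF t'(1)] k(4) by (simp add: ip)
  qed
  have "supporting_lune K u b"
    unfolding supporting_lune_def
  proof (intro conjI)
    show "u \<noteq> b" "u \<noteq> - b" using bp pu by (auto simp: ip)
    show "K \<subseteq> lune u b"
      using KP p(3) k(1) c(1) by (auto simp: lune_def ip(1) ut b_def b0)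
    have "p \<in> K \<inter> (great_circle u - great_circle b)"
      using p(1) KP bp pu by (auto simp: great_circle_def ip(1))
    then show "K \<inter> (great_circle u - great_circle b) \<noteq> {}" by blast
    have "t' \<in> K \<inter> (great_circle b - great_circle u)"
      using t' KP ut' by (auto simp: great_circle_def ip(1) b_def)
    then show "K \<inter> (great_circle b - great_circle u) \<noteq> {}" by blast
  qed (rule uP bP)+
  moreover have "great_circle u = H"
    using M ut by (auto simp: H' great_circle_def ip(1) points.simps)
  ultimately show ?thesis by blast
qed

text \<open>
  A point of a lune of breadth less than \<open>w < pi / 2\<close> has distance less than \<open>w\<close> from each of the
  two bounding great circles, which is false for the point provided by \<open>beyond\<close>. The estimate is
  the Cauchy--Schwarz inequality for the components orthogonal to \<open>u\<close>.
\<close>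
lemma lune_breadth_ge:
  assumes M: "M = Spherical" and H: "supporting_line M K H" and ab: "supporting_lune K a b" "great_circle a = H"
  shows "w \<le> lune_breadth a b"
proof -
  obtain p u where p: "p \<in> K" "unit M p u" "\<And>t. t \<in> K \<Longrightarrow> 0 \<le> form M u (t - p)"
    and H': "H = {x \<in> points M. form M u (x - p) = 0}" by (rule supporting_normal[OF K(1) H], rule that, assumption+)
  have pP: "p \<in> points M" using p K by auto
  have ip: "x \<bullet> y = dual M x y" "form M x y = dual M x y" for x y :: "real^3"
    using M by (auto simp: inner_vec_def sum_3 dual_def form_def)
  have pu: "dual M u p = 0" "dual M p u = 0" "dual M u u = 1" using p(2) ip(2)[of u u] by (auto simp: unit_def dual_commute)
  have ut: "dual M u t = form M u (t - p)" for t using pu by (simp add: ip)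
  have a: "a \<in> sphere 0 1" "b \<in> sphere 0 1" using ab by (auto simp: supporting_lune_def)
  then have aa: "dual M a a = 1" "dual M b b = 1" by (simp_all add: norm_eq_1 ip)
  obtain t where t: "t \<in> K" "gsin M w \<le> dual M u t" using beyond[OF p] ut by auto
  have tP: "t \<in> points M" "dual M t t = 1" using t K points_dual by auto
  have sw: "0 < gsin M w" using gsin_pos[OF w] .
  \<comment> \<open>the great circle determines its center up to sign, and the side on which \<open>K\<close> lies determines the sign\<close>
  have au: "a = u"
  proof -
    have rP: "rot M p u \<in> points M"
      using points_dual unit_rot[OF pP p(2)] M ip(2)[of "rot M p u" "rot M p u"]
      by (simp add: unit_def in_points dual_def power2_eq_square)
    have "p \<in> H" "rot M p u \<in> H" using pP rP pu form_rot[OF pP pu(2)] by (auto simp: H' ut[symmetric] ip(2)[symmetric])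
    then have "a \<bullet> p = 0" "a \<bullet> rot M p u = 0" unfolding ab(2)[symmetric] great_circle_def by auto
    then have "dual M a p = 0" "dual M a (rot M p u) = 0" by (simp_all add: ip)
    then have eq: "a = dual M a u *\<^sub>R u" using tangent_decomp[OF pP p(2), of a] by (simp add: ip dual_commute)
    then have "dual M a a = dual M a u * dual M a u" by (metis dual_scaleR(2))
    then have "dual M a u = 1 \<or> dual M a u = -1" using aa by (metis power2_eq_1_iff power2_eq_square)
    moreover have "0 \<le> dual M a t" using ab(1) t(1) by (auto simp: supporting_lune_def lune_def ip(1))
    ultimately show ?thesis using eq t(2) sw by auto
  qed
  have bt: "0 \<le> dual M b t" using ab(1) t(1) by (auto simp: supporting_lune_def lune_def ip(1))
  show ?thesis
  proof (rule ccontr)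
    assume "\<not> ?thesis"
    then have "pi - w < arccos (dual M u b)" by (simp add: lune_breadth_def au ip)
    define \<beta> \<tau> where "\<beta> = dual M u b" "\<tau> = dual M u t"
    have bnd: "\<bar>x \<bullet> y\<bar> \<le> 1" if "dual M x x = 1" "dual M y y = 1" for x y :: "real^3"
      using that Cauchy_Schwarz_ineq2[of x y] by (simp add: norm_eq_sqrt_inner ip)
    have b1: "\<bar>\<beta>\<bar> \<le> 1" "\<bar>\<tau>\<bar> \<le> 1" using bnd[OF pu(3) aa(2)] bnd[OF pu(3) tP(2)] by (auto simp: \<beta>_\<tau>_def ip)
    have wp: "0 < w" "w < pi / 2" using w M by (auto simp: acute_def)
    have "cos (arccos \<beta>) < cos (pi - w)"
      using \<open>pi - w < arccos (dual M u b)\<close> b1 wp arccos_ubound[of \<beta>] by (intro cos_monotone_0_pi) (auto simp: \<beta>_\<tau>_def)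
    then have bw: "\<beta> < - cos w" using b1 by (simp add: cos_arccos_abs)
    have cw: "0 < cos w" using wp by (intro cos_gt_zero) auto
    have tw: "sin w \<le> \<tau>" using t(2) M by (simp add: \<beta>_\<tau>_def)
    have sw': "0 < sin w" using sw M by simp
    have "(b - \<beta> *\<^sub>R u) \<bullet> (t - \<tau> *\<^sub>R u) = b \<bullet> t - \<beta> * \<tau>"
      using pu by (simp add: ip \<beta>_\<tau>_def dual_commute[of M b u] dual_commute[of M t u])
    moreover have "(norm (b - \<beta> *\<^sub>R u))\<^sup>2 = 1 - \<beta>\<^sup>2" "(norm (t - \<tau> *\<^sub>R u))\<^sup>2 = 1 - \<tau>\<^sup>2"
      unfolding power2_norm_eq_inner using pu aa tP
      by (simp_all add: ip \<beta>_\<tau>_def dual_commute[of M b u] dual_commute[of M t u] power2_eq_square)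
    moreover have "\<bar>(b - \<beta> *\<^sub>R u) \<bullet> (t - \<tau> *\<^sub>R u)\<bar> \<le> norm (b - \<beta> *\<^sub>R u) * norm (t - \<tau> *\<^sub>R u)"
      by (rule Cauchy_Schwarz_ineq2)
    moreover have "norm (b - \<beta> *\<^sub>R u) \<le> sin w"
    proof (rule power2_le_imp_le)
      have "(cos w)\<^sup>2 \<le> \<beta>\<^sup>2" using bw cw by (simp add: abs_le_square_iff[symmetric])
      then show "(norm (b - \<beta> *\<^sub>R u))\<^sup>2 \<le> (sin w)\<^sup>2" using calculation(2) sin_squared_eq[of w] by simp
    qed (use sw' in simp)
    moreover have "norm (t - \<tau> *\<^sub>R u) \<le> cos w"
    proof (rule power2_le_imp_le)
      have "(sin w)\<^sup>2 \<le> \<tau>\<^sup>2" using tw sw' by (intro power_mono) auto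
      then show "(norm (t - \<tau> *\<^sub>R u))\<^sup>2 \<le> (cos w)\<^sup>2" using calculation(3) cos_squared_eq[of w] by simp
    qed (use cw in simp)
    ultimately have "b \<bullet> t - \<beta> * \<tau> \<le> sin w * cos w"
      by (smt (verit) mult_mono norm_ge_zero)
    moreover have "\<beta> * \<tau> < - cos w * sin w"
    proof -
      have "\<beta> * \<tau> \<le> \<beta> * sin w" using tw bw cw by (intro mult_left_mono_neg) auto
      also have "\<dots> < - cos w * sin w" using bw sw' by (intro mult_strict_right_mono)
      finally show ?thesis .
    qed
    ultimately show False using bt by (simp add: ip mult.commute)
  qed
qed

lemma width_ge: assumes "supporting_line M K H" shows "w \<le> width M K H"
proof (cases "M = Spherical")
  case True
  let ?S = "{lune_breadth a b | a b. supporting_lune K a b \<and> great_circle a = H}"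
  have "w \<le> Inf ?S"
  proof (rule cInf_greatest)
    show "?S \<noteq> {}" using opposite_lune[OF True assms] by blast
    show "w \<le> x" if "x \<in> ?S" for x using that lune_breadth_ge[OF True assms] by blast
  qed
  then show ?thesis using True by (simp add: width_def)
next
  case False
  let ?S = "{line_distance M H H' | H'. supporting_line M K H' \<and> H \<inter> H' = {}}"
  obtain H' where H': "supporting_line M K H'" "H \<inter> H' = {}" "w \<le> line_distance M H H'"
    using ex_far_line[OF False assms] by blast
  have "bdd_above ?S" using line_distance_bound[OF assms] by (intro bdd_aboveI[of _ "2 * r"]) blast
  then have "line_distance M H H' \<le> Sup ?S" using H' by (intro cSup_upper) auto
  then show ?thesis using False H' by (simp add: width_def)
qed

lemma minimal_width_ge: assumes "supporting_line M K H" shows "w \<le> minimal_width M K"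
  unfolding minimal_width_def using width_ge assms by (intro cInf_greatest) auto

text \<open>
  The bound is attained if \<open>K\<close> contains the ends of an axis of length \<open>w\<close> and lies in the two
  disks of radius \<open>r\<close> that are centered on the line of the axis and touch, from inside, the lines
  orthogonal to it at its ends. Another supporting line meets \<open>K\<close> in some \<open>y\<close>. In the Euclidean
  and the hyperbolic plane the segment of length at most \<open>r\<close> from the center of the second disk to
  \<open>y\<close> crosses the first line after length at least \<open>r - w\<close>, so what remains has length at most
  \<open>w\<close>. On the sphere the two lines at the ends of the axis bound a lune of breadth \<open>w\<close>.
\<close>
lemma minimal_width_eq:
  assumes a: "a \<in> K" "unit M a n" and v: "gexp M a n w \<in> K" and wr: "w \<le> r"
    and d1: "\<And>t. t \<in> K \<Longrightarrow> haver M (gexp M a n r) t \<le> gver M r"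
    and d2: "\<And>t. t \<in> K \<Longrightarrow> haver M (gexp M a n (w - r)) t \<le> gver M r"
  shows "minimal_width M K = w"
proof -
  have aP: "a \<in> points M" using a K by auto
  define H where "H = {x \<in> points M. form M n (x - a) = 0}"
  have pos: "0 \<le> form M n (t - a)" if "t \<in> K" for t
    using form_in_disk(2)[OF aP a(2) _ r(1) d1[OF that]] that K by auto
  have H: "supporting_line M K H" unfolding H_def by (rule supporting_line_intro[OF K(1) a pos])
  have le: "width M K H \<le> w"
  proof (cases "M = Spherical")
    case False
    let ?S = "{line_distance M H H' | H'. supporting_line M K H' \<and> H \<inter> H' = {}}"
    have "Sup ?S \<le> w"
    proof (rule cSup_least)
      show "?S \<noteq> {}" using ex_far_line[OF False H] by blast
      fix x assume "x \<in> ?S"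
      then obtain H' where x: "x = line_distance M H H'" and H': "supporting_line M K H'" by blast
      then obtain y where y: "y \<in> K" "y \<in> H'" by (auto simp: supporting_line_def)
      have yP: "y \<in> points M" using y K by auto
      let ?c = "gexp M a n (w - r)"
      have cP: "?c \<in> points M" using gexp_points[OF aP a(2)] .
      let ?d = "gdist M ?c y"
      have d: "?d \<le> r" using d2[OF y(1)] gdist_le_iff[OF cP yP acute_lengths[OF r(1)]] by simp
      obtain e where e: "unit M ?c e" "y = gexp M ?c e ?d" using ex_gexp cP yP by metis
      define g where "g s = form M n (gexp M ?c e s - a)" for s
      have "continuous_on {0..?d} g" unfolding g_def gexp_def[of M "gexp M a n (w - r)"] by (intro continuous_intros)
      moreover have "g 0 = - gsin M (r - w)"
        using form_gexp[OF aP a(2), of n "w - r"] a(2) gsin_minus[of M "r - w"] by (simp add: g_def unit_def del: form_diff)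
      moreover have "0 \<le> gsin M (r - w)" using wr acute_mono[OF r(1), of "r - w"] w by (intro gsin_nonneg acute_lengths) auto
      moreover have "0 \<le> g ?d" using pos[OF y(1)] e(2) by (simp add: g_def)
      ultimately obtain s where s: "0 \<le> s" "s \<le> ?d" "g s = 0"
        using IVT'[of g 0 0 ?d] gdist_nonneg[OF cP yP] by auto
      let ?z = "gexp M ?c e s"
      have z_points: "?z \<in> points M" using gexp_points[OF cP e(1)] .
      have zH: "?z \<in> H" using s(3) z_points by (simp add: H_def g_def)
      have sl: "s \<in> lengths M" "?d - s \<in> lengths M" using s False by (auto simp: lengths_def)
      have "gsin M (r - w) \<le> gsin M (gdist M ?z ?c)"
      proof -
        have "form M (- n) (?c - a) = gsin M (r - w)"
          using form_gexp[OF aP a(2), of n "w - r"] a(2) gsin_minus[of M "r - w"] by (simp add: unit_def del: form_diff)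
        moreover have "form M (- n) (?z - a) = 0" using zH by (simp add: H_def del: form_diff)
        ultimately show ?thesis using form_le_gsin_gdist[OF aP unit_minus[OF a(2)] z_points _ cP] by simp
      qed
      then have "r - w \<le> gdist M ?z ?c" by (rule gsin_le_imp_le[OF False])
      also have "\<dots> = s" using gdist_gexp[OF cP e(1) sl(1)] gdist_commute[OF z_points cP] by simp
      finally have "?d - s \<le> w" using d by linarith
      moreover have "gdist M ?z y = ?d - s"
      proof -
        have "y = gexp M ?z (gdir M ?c e s) (?d - s)" using e(2) by (simp add: gexp_gexp)
        then show ?thesis using gdist_gexp[OF z_points unit_gdir[OF cP e(1), of s] sl(2)] by simp
      qed
      moreover have "line_distance M H H' \<le> gdist M ?z y"
        using H' zH y by (intro line_distance_le) (auto simp: supporting_line_def H_def)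
      ultimately show "x \<le> w" using x by linarith
    qed
    then show ?thesis using False by (simp add: width_def)
  next
    case True
    have ip: "x \<bullet> y = dual M x y" "form M x y = dual M x y" for x y :: "real^3"
      using True by (auto simp: inner_vec_def sum_3 dual_def form_def)
    let ?v = "gexp M a n w" and ?b = "- gdir M a n w"
    have v_points: "?v \<in> points M" "unit M ?v ?b" using gexp_points[OF aP a(2)] unit_minus[OF unit_gdir[OF aP a(2)]] by auto
    have an: "dual M a n = 0" "dual M n a = 0" "dual M n n = 1" "dual M a a = 1"
      using a(2) ip(2)[of n n] points_dual[OF aP] by (auto simp: unit_def dual_commute)
    have b: "dual M ?b ?b = 1" "dual M ?b ?v = 0"
      using v_points(2) ip(2)[of ?b ?b] by (auto simp: unit_def dual_commute)
    have sw: "0 < gsin M w" using gsin_pos[OF w] .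
    have nb: "dual M n ?b = - gcos M w" and ab: "dual M ?b a = gsin M w"
      using True an by (simp_all add: gdir_def)
    have nv: "dual M n ?v = gsin M w" using an by (simp add: gexp_def)
    have lune: "K \<subseteq> lune n ?b"
    proof
      fix t assume t: "t \<in> K"
      have tP: "t \<in> points M" using t K by auto
      have "haver M (gexp M ?v ?b r) t \<le> gver M r" using d2[OF t] by (simp add: gexp_back)
      then have "0 \<le> form M ?b (t - ?v)" using form_in_disk(2)[OF v_points tP r(1)] by blast
      moreover have "0 \<le> form M n (t - a)" by (rule pos[OF t])
      ultimately have "0 \<le> dual M n t" "0 \<le> dual M ?b t" using an b by (simp_all add: ip)
      then show "t \<in> lune n ?b" using tP True by (simp add: lune_def ip(1) points.simps)
    qed
    have nc: "n \<noteq> ?b" "n \<noteq> - ?b"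
    proof -
      have "dual M (- ?b) a = - gsin M w" using ab by (simp only: dual_minus(1))
      then show "n \<noteq> ?b" "n \<noteq> - ?b" using ab an(2) sw by (metis less_irrefl, metis less_irrefl neg_0_equal_iff_equal)
    qed
    have S: "n \<in> sphere 0 1" "?b \<in> sphere 0 1"
      using an b by (simp_all only: mem_sphere_0 norm_eq_1 ip)
    have P: "a \<in> sphere 0 1" "?v \<in> sphere 0 1" using aP v_points True by (auto simp: points.simps)
    have "a \<in> K \<inter> (great_circle n - great_circle ?b)" "?v \<in> K \<inter> (great_circle ?b - great_circle n)"
      using a v an b ab nv sw P unfolding great_circle_def ip(1) by auto
    then have "supporting_lune K n ?b"
      unfolding supporting_lune_def using lune nc S by blast
    moreover have "great_circle n = H"
    proof -
      have "great_circle n = {x \<in> points M. dual M n x = 0}" unfolding great_circle_def ip(1) using True by (simp add: points.simps)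
      moreover have "form M n (x - a) = dual M n x" for x using an by (simp add: ip)
      ultimately show ?thesis by (simp add: H_def del: form_diff)
    qed
    moreover have "lune_breadth n ?b = w"
    proof -
      have "dual M n ?b = cos (pi - w)" using nb True by simp
      moreover have "arccos (cos (pi - w)) = pi - w" using w True by (intro arccos_cos) (auto simp: acute_def)
      ultimately show ?thesis by (simp add: lune_breadth_def ip(1))
    qed
    moreover have "bdd_below {lune_breadth a b | a b. supporting_lune K a b \<and> great_circle a = H}"
      using lune_breadth_ge[OF True H] by (intro bdd_belowI[of _ w]) blast
    ultimately have "Inf {lune_breadth a b | a b. supporting_lune K a b \<and> great_circle a = H} \<le> w"
      by (intro cInf_lower CollectI exI[of _ n] exI[of _ ?b]) simp_all
    then show ?thesis using True by (simp add: width_def)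
  qed
  have "minimal_width M K \<le> width M K H"
    unfolding minimal_width_def using H width_ge by (intro cInf_lower bdd_belowI[of _ w]) auto
  then show ?thesis using le minimal_width_ge[OF H] by linarith
qed

end

section \<open>Intersections of finitely many disks\<close>

definition common :: "geometry \<Rightarrow> real \<Rightarrow> (real^3) set \<Rightarrow> (real^3) set" where
  "common M r Q = {t \<in> points M. \<forall>q\<in>Q. haver M q t \<le> gver M r}"

lemma common_eq_disks: "Q \<subseteq> points M \<Longrightarrow> acute M r \<Longrightarrow> common M r Q = points M \<inter> (\<Inter>q\<in>Q. disk M q r)"
  by (auto simp: common_def disk_eq subset_iff)

lemma compact_common:
  assumes "Q \<subseteq> points M" "Q \<noteq> {}" "acute M r" shows "compact (common M r Q)"
proof -
  obtain q where q: "q \<in> Q" "q \<in> points M" using assms by auto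
  have "common M r Q = disk M q r \<inter> {t. \<forall>q\<in>Q. haver M q t \<le> gver M r}"
    using q disk_eq[OF q(2) assms(3)] by (auto simp: common_def)
  moreover have "{t. \<forall>q\<in>Q. haver M q t \<le> gver M r} = (\<Inter>q\<in>Q. {t. haver M q t \<le> gver M r})" by auto
  moreover have "closed (\<Inter>q\<in>Q. {t. haver M q t \<le> gver M r})"
    by (intro closed_INT ballI closed_Collect_le continuous_intros)
  ultimately show ?thesis using compact_disk[OF q(2) assms(3)] by (simp add: compact_Int_closed)
qed

lemma ball_convex_common:
  assumes Q: "finite Q" "Q \<subseteq> points M" "Q \<noteq> {}" and r: "acute M r"
    and c: "c \<in> points M" "\<And>q. q \<in> Q \<Longrightarrow> haver M q c < gver M r"
  shows "ball_convex_body M r (common M r Q)"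
proof -
  let ?K = "common M r Q"
  obtain q where q: "q \<in> Q" "q \<in> points M" using Q by auto
  have sub: "?K \<subseteq> points M" by (auto simp: common_def)
  have "convex_in M ?K"
    unfolding convex_in_def
  proof (intro conjI ballI impI sub)
    fix x y assume xy: "x \<in> ?K" "y \<in> ?K"
    have "geodesic_segment M x y \<subseteq> disk M q r" if "q \<in> Q" for q
      using that Q r xy by (intro segment_in_disk) (auto simp: disk_eq common_def)
    then show "geodesic_segment M x y \<subseteq> ?K"
      unfolding common_eq_disks[OF Q(2) r] by (auto simp: geodesic_segment_def)
  next
    assume M: "M = Spherical"
    have "q \<bullet> x > 0" if "x \<in> ?K" for x
    proof -
      have x: "x \<in> points M" "haver M q x \<le> gver M r" using that q by (auto simp: common_def)
      have "q \<bullet> x = dual M q x" using M by (simp add: inner_vec_def sum_3 dual_def)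
      also have "\<dots> \<ge> gcos M r" unfolding dual_haver[OF q(2) x(1)] gcos_gver using x M by simp
      finally show ?thesis using gcos_pos[OF r] by linarith
    qed
    then show "\<exists>a\<in>sphere 0 1. \<forall>x\<in>?K. a \<bullet> x > 0" using q M by (intro bexI[of _ q]) (auto simp: points.simps)
  qed
  moreover have "top_of_set (points M) interior_of ?K \<noteq> {}"
  proof -
    let ?U = "{t. \<forall>q\<in>Q. haver M q t < gver M r}"
    have "?U = (\<Inter>q\<in>Q. {t. haver M q t < gver M r})" by auto
    moreover have "open (\<Inter>q\<in>Q. {t. haver M q t < gver M r})"
      using Q by (intro open_INT ballI open_Collect_less continuous_intros)
    ultimately have "openin (top_of_set (points M)) (points M \<inter> ?U)" by (simp add: openin_open_Int)
    moreover have "points M \<inter> ?U \<subseteq> ?K" by (auto simp: common_def intro: less_imp_le)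
    ultimately have "points M \<inter> ?U \<subseteq> top_of_set (points M) interior_of ?K" by (rule interior_of_maximal[rotated])
    then show ?thesis using c by auto
  qed
  moreover have "compact ?K" using compact_common Q r by blast
  moreover have "?K = points M \<inter> \<Inter>{disk M x r | x. x \<in> points M \<and> ?K \<subseteq> disk M x r}" (is "_ = ?R")
  proof
    show "?K \<subseteq> ?R" using sub by auto
    show "?R \<subseteq> ?K"
    proof
      fix t assume t: "t \<in> ?R"
      have "t \<in> disk M q r" if "q \<in> Q" for q
      proof -
        have "?K \<subseteq> disk M q r" unfolding common_eq_disks[OF Q(2) r] using that by auto
        then show ?thesis using t that Q by blast
      qed
      then show "t \<in> ?K" using t unfolding common_eq_disks[OF Q(2) r] by auto
    qed
  qed
  ultimately show ?thesis unfolding ball_convex_body_def convex_body_def by blast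
qed

text \<open>
  The disk that touches at a boundary point with a given inner normal contains the whole
  intersection: by \<open>normal_cone\<close> its center is a positive combination of the active centers.
\<close>
lemma common_tangent_disk:
  assumes Q: "finite Q" "Q \<subseteq> points M" and r: "acute M r" "0 < r"
    and c: "c \<in> points M" "\<And>q. q \<in> Q \<Longrightarrow> haver M q c < gver M r"
    and p: "p \<in> common M r Q" "unit M p u" "\<And>t. t \<in> common M r Q \<Longrightarrow> 0 \<le> form M u (t - p)"
  shows "\<exists>l. (\<forall>q. 0 \<le> l q) \<and> u = (\<Sum>q\<in>{q\<in>Q. haver M q p = gver M r}. l q *\<^sub>R tpart M p q)"
    and "t \<in> common M r Q \<Longrightarrow> haver M (gexp M p u r) t \<le> gver M r"
proof -
  have pP: "p \<in> points M" using p by (auto simp: common_def)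
  let ?A = "{q\<in>Q. haver M q p = gver M r}"
  show ex: "\<exists>l. (\<forall>q. 0 \<le> l q) \<and> u = (\<Sum>q\<in>?A. l q *\<^sub>R tpart M p q)"
    by (rule normal_cone[OF Q pP _ r(1) c p(2)]) (use p in \<open>auto simp: common_def\<close>)
  assume t: "t \<in> common M r Q"
  obtain l where l: "\<forall>q. 0 \<le> l q" "u = (\<Sum>q\<in>?A. l q *\<^sub>R tpart M p q)" using ex by blast
  have eq: "gsin M r *\<^sub>R u = (\<Sum>q\<in>?A. (gsin M r * l q) *\<^sub>R tpart M p q)"
    by (subst l(2)) (simp add: scaleR_sum_right)
  have "haver M (gcos M r *\<^sub>R p + (\<Sum>q\<in>?A. (gsin M r * l q) *\<^sub>R tpart M p q)) t \<le> gver M r"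
  proof (rule in_disk_of_positive_combination[OF r pP])
    show "t \<in> points M" "finite ?A" using t Q by (auto simp: common_def)
    show "form M (\<Sum>q\<in>?A. (gsin M r * l q) *\<^sub>R tpart M p q) (\<Sum>q\<in>?A. (gsin M r * l q) *\<^sub>R tpart M p q) = (gsin M r)\<^sup>2"
      unfolding eq[symmetric] using p(2) by (simp add: unit_def power2_eq_square)
    show "0 \<le> gsin M r * l q" for q using l(1) gsin_pos[OF r] by simp
    fix q assume q: "q \<in> ?A"
    then have qP: "q \<in> points M" "haver M q p = gver M r" using Q by auto
    note ta = tpart_active[OF pP qP]
    show "dual M p (tpart M p q) = 0" "form M (tpart M p q) (tpart M p q) = (gsin M r)\<^sup>2" using ta by auto
    show "haver M (gcos M r *\<^sub>R p + tpart M p q) t \<le> gver M r"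
      using ta(1) t q by (auto simp: common_def)
  qed
  then show "haver M (gexp M p u r) t \<le> gver M r" unfolding gexp_def eq .
qed

text \<open>
  First variation of the distance: moving from the nearest point \<open>t\<close> towards another point \<open>y\<close> of
  the convex set cannot decrease the distance to \<open>q\<close>. Dividing by the step length and letting it
  tend to \<open>0\<close> gives the claim.
\<close>
lemma nearest_point_normal:
  assumes T: "T = common M r Q" "Q \<subseteq> points M" "acute M r"
    and q: "q \<in> points M" and t: "t \<in> T" "\<And>t'. t' \<in> T \<Longrightarrow> gdist M q t \<le> gdist M q t'"
    and e: "unit M t e" "q = gexp M t e s" "s \<in> lengths M" "0 < s" "M = Spherical \<Longrightarrow> s < pi"
    and y: "y \<in> T"
  shows "form M e (y - t) \<le> 0"
proof (rule ccontr)
  assume neg: "\<not> form M e (y - t) \<le> 0"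
  have P: "t \<in> points M" "y \<in> points M" using t y T by (auto simp: common_def)
  let ?d = "gdist M t y"
  obtain f where f: "unit M t f" "y = gexp M t f ?d" using ex_gexp P by metis
  have ft: "form M e (y - t) = gsin M ?d * form M e f"
    using form_gexp[OF P(1) f(1), of e ?d] f(2) e(1) by (simp add: unit_def)
  have d: "?d \<in> lengths M" using gdist_gver(2)[OF P] .
  have "0 < form M e f" "0 < gsin M ?d" using neg gsin_nonneg[OF d] unfolding ft by (auto simp: not_le zero_less_mult_iff)
  then have dpos: "0 < ?d" "M = Spherical \<longrightarrow> ?d < pi" using d by (auto simp: lengths_def order.strict_iff_order)
  define g where "g h = haver M q (gexp M t f h)" for h
  have gq: "g h = gcos M h * gver M s + gver M h - gsin M h * (gsin M s * form M f e)" for h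
    using haver_gexp_gexp[OF P(1) f(1) e(1), of h s] e(2) by (simp add: g_def haver_commute mult.assoc)
  have Ss: "0 < gsin M s" using e gsin_pos_lengths by blast
  have inT: "gexp M t f h \<in> T" if h: "0 < h" "h < ?d" for h
  proof -
    let ?z = "gexp M t f h"
    have z_points: "?z \<in> points M" using gexp_points[OF P(1) f(1)] .
    have "haver M c ?z \<le> gver M r" if c: "c \<in> Q" for c
    proof -
      have cP: "c \<in> points M" using c T by auto
      have "haver M ?z c \<le> gver M r"
      proof (rule haver_between(1)[OF z_points unit_gdir[OF P(1) f(1)] cP T(3), of "?d - h" h])
        show "?d - h \<in> lengths M" "h \<in> lengths M" using h d by (auto simp: lengths_def)
        show "0 < gsin M (?d - h + h)" using \<open>0 < gsin M ?d\<close> by simp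
        show "haver M (gexp M ?z (gdir M t f h) (?d - h)) c \<le> gver M r"
          using y c T f(2) by (simp add: gexp_gexp common_def haver_commute)
        show "haver M (gexp M ?z (- gdir M t f h) h) c \<le> gver M r"
          using t(1) c T by (simp add: gexp_back common_def haver_commute)
      qed
      then show ?thesis by (simp add: haver_commute)
    qed
    then show ?thesis using z_points T by (simp add: common_def)
  qed
  have mono: "gver M s \<le> g h" if "0 < h" "h < ?d" for h
  proof -
    have z_points: "gexp M t f h \<in> points M" using gexp_points[OF P(1) f(1)] .
    have "gdist M q t \<le> gdist M q (gexp M t f h)" using t(2) inT[OF that] by blast
    then have "haver M q t \<le> g h"
      unfolding g_def using gdist_le_iff[OF q P(1) gdist_gver(2)[OF q z_points]] gdist_gver(1)[OF q z_points] by simp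
    moreover have "haver M q t = gver M s" using haver_gexp_self[OF P(1) e(1)] e(2) by (simp add: haver_commute)
    ultimately show ?thesis by simp
  qed
  have key: "gsin M s * form M f e * (1 + gcos M h) \<le> gcos M s * gsin M h" if h: "0 < h" "h < ?d" "h < 1" for h
  proof -
    have ac: "acute M h" using h pi_gt3 by (auto simp: acute_def)
    have "gver M s \<le> (1 - kappa M * gver M h) * gver M s + gver M h - gsin M h * (gsin M s * form M f e)"
      using mono[OF h(1,2)] unfolding gq gcos_gver[of M h] .
    then have "gsin M h * (gsin M s * form M f e) \<le> gver M h * gcos M s"
      unfolding gcos_gver[of M s] by (simp add: algebra_simps)
    then have "gsin M h * (gsin M s * form M f e) * (1 + gcos M h) \<le> gver M h * gcos M s * (1 + gcos M h)"
      using gcos_pos[OF ac] by (intro mult_right_mono) auto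
    also have "\<dots> = gcos M s * (gsin M h * gsin M h)"
      using gsin_squared[of M h] by (simp add: power2_eq_square mult_ac)
    finally have "gsin M h * (gsin M s * form M f e * (1 + gcos M h)) \<le> gsin M h * (gcos M s * gsin M h)"
      by (simp add: mult_ac)
    then show ?thesis using gsin_pos[OF ac h(1)] by simp
  qed
  have "((\<lambda>h. gsin M s * form M f e * (1 + gcos M h)) \<longlongrightarrow> gsin M s * form M f e * (1 + gcos M 0)) (at_right 0)"
    and "((\<lambda>h. gcos M s * gsin M h) \<longlongrightarrow> gcos M s * gsin M 0) (at_right 0)"
  proof -
    have c: "isCont (gsin M) 0" "isCont (gcos M) 0"
      using continuous_on_gsin[OF continuous_on_id, of UNIV M] continuous_on_gcos[OF continuous_on_id, of UNIV M]
      by (auto simp: continuous_on_eq_continuous_at)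
    have l: "(gsin M \<longlongrightarrow> gsin M 0) (at_right 0)" "(gcos M \<longlongrightarrow> gcos M 0) (at_right 0)"
      using c unfolding isCont_def by (auto intro: tendsto_within_subset simp del: gcos_0 gsin_0)
    show "((\<lambda>h. gsin M s * form M f e * (1 + gcos M h)) \<longlongrightarrow> gsin M s * form M f e * (1 + gcos M 0)) (at_right 0)"
      by (intro tendsto_mult tendsto_add tendsto_const l)
    show "((\<lambda>h. gcos M s * gsin M h) \<longlongrightarrow> gcos M s * gsin M 0) (at_right 0)"
      by (intro tendsto_mult tendsto_const l)
  qed
  moreover have "\<forall>\<^sub>F h in at_right 0. gsin M s * form M f e * (1 + gcos M h) \<le> gcos M s * gsin M h"
  proof -
    have "\<forall>\<^sub>F h in at_right (0::real). h \<in> {0<..<min 1 ?d}" using dpos by (intro eventually_at_right_real) simp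
    then show ?thesis by eventually_elim (use key in auto)
  qed
  ultimately have "gsin M s * form M f e * (1 + gcos M 0) \<le> gcos M s * gsin M 0"
    by (intro tendsto_le[of "at_right 0"]) auto
  then have "gsin M s * form M f e \<le> 0" by simp
  then show False using Ss \<open>0 < form M e f\<close> by (simp add: form_commute mult_le_0_iff)
qed

locale regular_directions =
  fixes M :: geometry and m :: "real^3" and u :: "nat \<Rightarrow> real^3"
  assumes m_points: "m \<in> points M" and unit_u: "i < 3 \<Longrightarrow> unit M m (u i)"
    and form_u: "i < 3 \<Longrightarrow> j < 3 \<Longrightarrow> i \<noteq> j \<Longrightarrow> form M (u i) (u j) = - 1 / 2"
begin

lemma form_uu: "i < 3 \<Longrightarrow> form M (u i) (u i) = 1" using unit_u by (simp add: unit_def)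
lemma dual_mu: "i < 3 \<Longrightarrow> dual M m (u i) = 0" using unit_u by (simp add: unit_def)

lemma triples: assumes "i < 3" "j < 3" "k < 3" "i \<noteq> j" "i \<noteq> k" "j \<noteq> (k::nat)"
  shows "{..<3} = {i, j, k}"
  using assms by auto

lemma sum_u: assumes "i < 3" "j < 3" "k < 3" "i \<noteq> j" "i \<noteq> k" "j \<noteq> k"
  shows "u i + u j + u k = 0"
  using assms by (intro tangent_form_eq_0[OF m_points]) (auto simp: dual_mu form_uu form_u)

lemma sum_form_u: assumes "i < 3" "j < 3" "k < 3" "i \<noteq> j" "i \<noteq> k" "j \<noteq> k"
  shows "form M e (u i) + form M e (u j) + form M e (u k) = 0"
  using arg_cong[OF sum_u[OF assms], of "form M e"] by simp

text \<open>Parseval's identity for the tight frame formed by the three directions.\<close>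
lemma sum_form_u_sq: assumes "i < 3" "j < 3" "k < 3" "i \<noteq> j" "i \<noteq> k" "j \<noteq> k" "unit M m e"
  shows "(form M e (u i))\<^sup>2 + (form M e (u j))\<^sup>2 + (form M e (u k))\<^sup>2 = 3 / 2"
proof -
  define a b c where "a = form M e (u i)" "b = form M e (u j)" "c = form M e (u k)"
  define w where "w = e - (2/3) *\<^sub>R (a *\<^sub>R u i + b *\<^sub>R u j + c *\<^sub>R u k)"
  have abc: "a + b + c = 0" using sum_form_u[OF assms(1-6)] by (simp add: a_b_c_def)
  have wt: "dual M m w = 0" using assms by (simp add: w_def dual_mu unit_def)
  have wi: "form M w (u i) = 0" and wj: "form M w (u j) = 0"
    using assms abc by (simp_all add: w_def form_u form_uu a_b_c_def[symmetric] field_simps)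
  let ?r = "rot M m (u i)"
  have "form M (u j) ?r * form M w ?r = 0"
    using tangent_form[OF m_points unit_u[OF assms(1)] dual_mu[OF assms(2)], of w] wi wj
    by (simp add: form_commute[of M _ w] form_commute[of M ?r])
  moreover have "(form M (u j) ?r)\<^sup>2 = 3 / 4"
    using tangent_form[OF m_points unit_u[OF assms(1)] dual_mu[OF assms(2)], of "u j"] assms
    by (simp add: form_uu form_u form_commute[of M ?r] power2_eq_square)
  ultimately have "form M w ?r = 0" by auto
  then have "w = 0" using tangent_eq_0[OF m_points unit_u[OF assms(1)] wt wi] by blast
  then have "form M e w = 0" by simp
  moreover have "form M e w = 1 - (2/3) * (a * a + b * b + c * c)" using assms(7)
    by (simp add: w_def unit_def a_b_c_def[symmetric])
  ultimately show ?thesis by (simp add: a_b_c_def[symmetric] power2_eq_square)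
qed

text \<open>
  The components of \<open>e\<close> sum to \<open>0\<close> and their squares to \<open>3 / 2\<close>; if all exceeded \<open>- 1 / 2\<close>, one of
  them would exceed \<open>1\<close>.
\<close>
lemma ex_opposite_dir: assumes "unit M m e" shows "\<exists>i<3. form M e (u i) \<le> - 1 / 2"
proof (rule ccontr)
  assume "\<not> ?thesis"
  then have neg: "- 1 / 2 < form M e (u i)" if "i < 3" for i using that by force
  define a b c where "a = form M e (u 0)" "b = form M e (u 1)" "c = form M e (u 2)"
  have s: "a + b + c = 0" "a\<^sup>2 + b\<^sup>2 + c\<^sup>2 = 3 / 2"
    using sum_form_u[of 0 1 2 e] sum_form_u_sq[of 0 1 2 e] assms by (auto simp: a_b_c_def)
  have n: "- 1 / 2 < a" "- 1 / 2 < b" "- 1 / 2 < c" using neg by (auto simp: a_b_c_def)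
  have a1: "a \<le> 1" using form_unit_le[OF m_points assms unit_u[of 0]] by (simp add: a_b_c_def)
  have "0 < (b + 1/2) * (c + 1/2)" using n by (intro mult_pos_pos) auto
  moreover have c: "c = - a - b" using s by simp
  have "(b + 1/2) * (c + 1/2) = (a - 1) * (a + 1/2)"
    using s(2) unfolding c by (simp add: power2_eq_square field_simps)
  moreover have "(a - 1) * (a + 1/2) \<le> 0" using a1 n by (intro mult_nonpos_nonneg) auto
  ultimately show False by simp
qed

end

section \<open>Regular disk triangles\<close>

text \<open>
  The centers of the disks are at distance \<open>R\<close> from \<open>m\<close>, the vertices of the disk triangle at
  distance \<open>\<tau>\<close>. The equation for \<open>gver M r\<close> is the law of cosines with an angle of 120 degrees:
  the vertex in direction \<open>u j\<close> has distance \<open>r\<close> from the centers in the other two directions. The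
  case \<open>\<tau> = R\<close> is the Reuleaux triangle.
\<close>
locale regular_disk_triangle = regular_directions +
  fixes r R \<tau> :: real
  assumes r: "acute M r" and tau: "0 < \<tau>" "\<tau> \<le> R" and R: "R < r"
    and gver_r: "gver M r = gcos M R * gver M \<tau> + gver M R + gsin M R * gsin M \<tau> / 2"
begin

definition "x i = gexp M m (u i) R"
definition "v i = gexp M m (u i) \<tau>"
definition "T = common M r (x ` {..<3})"

lemma rpos: "0 < r" using tau R by simp
lemma acute_R: "acute M R" and acute_tau: "acute M \<tau>" and acute_R_minus_tau: "acute M (R - \<tau>)"
  using r tau R by (auto simp: acute_def)
lemma SR: "0 < gsin M R" and St: "0 < gsin M \<tau>" and Sr: "0 < gsin M r"
  using gsin_pos[OF acute_R] gsin_pos[OF acute_tau] gsin_pos[OF r] tau R by auto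
lemmas CR = gcos_pos[OF acute_R] and Ct = gcos_pos[OF acute_tau] and Cr = gcos_pos[OF r]
lemma x_points: "i < 3 \<Longrightarrow> x i \<in> points M" and v_points: "i < 3 \<Longrightarrow> v i \<in> points M"
  unfolding x_def v_def using gexp_points[OF m_points unit_u] by auto

lemma T_eq: "T = {t \<in> points M. \<forall>i<3. haver M (x i) t \<le> gver M r}"
  by (auto simp: T_def common_def)

lemma gver_swap: "gcos M s * gver M t + gver M s = gcos M t * gver M s + gver M t"
  unfolding gcos_gver by (simp add: algebra_simps)

lemma gver_mono: "acute M t \<Longrightarrow> 0 \<le> s \<Longrightarrow> s \<le> t \<Longrightarrow> gver M s \<le> gver M t"
  using gver_le_iff[of s M t] acute_lengths[of M t] acute_lengths[of M s] acute_mono[of M t s] by simp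
lemma gver_smono: "acute M t \<Longrightarrow> 0 \<le> s \<Longrightarrow> s < t \<Longrightarrow> gver M s < gver M t"
  using gver_less_iff[of s M t] acute_lengths[of M t] acute_lengths[of M s] acute_mono[of M t s] by simp

lemma haver_xv: "i < 3 \<Longrightarrow> j < 3 \<Longrightarrow> i \<noteq> j \<Longrightarrow> haver M (x i) (v j) = gver M r"
  unfolding x_def v_def gver_r by (simp add: haver_gexp_gexp[OF m_points unit_u unit_u] form_u)
lemma haver_xv_same: "i < 3 \<Longrightarrow> haver M (x i) (v i) = gver M (R - \<tau>)"
  unfolding x_def v_def gver_diff by (simp add: haver_gexp_gexp[OF m_points unit_u unit_u] form_uu)
lemma haver_vv: "i < 3 \<Longrightarrow> j < 3 \<Longrightarrow> i \<noteq> j \<Longrightarrow> haver M (v i) (v j) = gcos M \<tau> * gver M \<tau> + gver M \<tau> + gsin M \<tau> * gsin M \<tau> / 2"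
  unfolding v_def by (simp add: haver_gexp_gexp[OF m_points unit_u unit_u] form_u)
lemma haver_vv_le: assumes "i < 3" "j < 3" "i \<noteq> j" shows "haver M (v i) (v j) \<le> gver M r"
proof -
  have "haver M (v i) (v j) = gcos M \<tau> * gver M \<tau> + gver M \<tau> + gsin M \<tau> * gsin M \<tau> / 2" by (rule haver_vv[OF assms])
  also have "\<dots> \<le> gcos M \<tau> * gver M R + gver M \<tau> + gsin M R * gsin M \<tau> / 2"
    using Ct St gver_mono[OF acute_R] gsin_mono[OF acute_R, of \<tau>] tau by (intro add_mono mult_left_mono mult_right_mono divide_right_mono) auto
  also have "\<dots> = gver M r" unfolding gver_r gver_swap[of R] ..
  finally show ?thesis .
qed
lemma gver_rho_less: "gver M (R - \<tau>) < gver M r" using tau R r by (intro gver_smono) auto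
lemma v_in_T: assumes "i < 3" shows "v i \<in> T"
proof -
  have "haver M (x j) (v i) \<le> gver M r" if "j < 3" for j
    using haver_xv[OF that assms] haver_xv_same[OF assms] gver_rho_less by (cases "j = i") auto
  then show ?thesis using v_points[OF assms] by (simp add: T_eq)
qed
lemma gver_r_pos: "0 < gver M r" using gver_smono[OF r, of 0] rpos by simp
lemma haver_x_center: "i < 3 \<Longrightarrow> haver M (x i) m = gver M R"
  using haver_gexp_self[OF m_points unit_u, of i R] by (simp add: x_def haver_commute[of M _ m])
lemma gver_R_gap: "0 < gver M r - gver M R" using gver_smono[OF r _ R] tau by simp
lemma haver_xm: "i < 3 \<Longrightarrow> haver M (x i) m < gver M r"
  using haver_x_center[of i] gver_R_gap by simp

text \<open>
  The triangle lies in the disk of radius \<open>\<tau>\<close> around \<open>m\<close>: a point at distance \<open>\<sigma> > \<tau>\<close> makes an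
  angle of at least 120 degrees with some \<open>u i\<close>, so it is farther from \<open>x i\<close> than a vertex is. On
  the sphere, \<open>\<sigma>\<close> is first shown to be less than a right angle by averaging over the three
  centers.
\<close>
lemma T_polar:
  assumes t: "t \<in> T" and e: "unit M m e" "t = gexp M m e \<sigma>" "\<sigma> = gdist M m t"
  shows "acute M \<sigma>" and "\<sigma> \<le> \<tau>"
proof -
  have tP: "t \<in> points M" using t by (simp add: T_eq)
  have sl: "\<sigma> \<in> lengths M" using gdist_gver(2)[OF m_points tP] e(3) by simp
  have D: "haver M (x i) t = gcos M R * gver M \<sigma> + gver M R - gsin M R * gsin M \<sigma> * form M e (u i)" if "i < 3" for i
    using haver_gexp_gexp[OF m_points unit_u[OF that] e(1), of R \<sigma>] e(2) by (simp add: x_def form_commute)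
  have le: "haver M (x i) t \<le> gver M r" if "i < 3" for i using t that by (simp add: T_eq)
  show ac: "acute M \<sigma>"
  proof (cases "M = Spherical")
    case False then show ?thesis using sl by (simp add: acute_def lengths_def)
  next
    case True
    have "haver M (x 0) t + haver M (x 1) t + haver M (x 2) t
       = 3 * (gcos M R * gver M \<sigma> + gver M R) - gsin M R * gsin M \<sigma> * (form M e (u 0) + form M e (u 1) + form M e (u 2))"
      by (simp add: D algebra_simps)
    also have "form M e (u 0) + form M e (u 1) + form M e (u 2) = 0" by (rule sum_form_u) auto
    finally have "gcos M R * gver M \<sigma> + gver M R \<le> gver M r" using le[of 0] le[of 1] le[of 2] by simp
    moreover have "gver M r < 1" using Cr True by simp
    ultimately have "gcos M R * (1 - gcos M \<sigma>) < gcos M R" using True by simp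
    then have "0 < cos \<sigma>" using CR True by (simp add: algebra_simps zero_less_mult_iff)
    have "\<sigma> < pi / 2"
    proof (rule ccontr)
      assume "\<not> ?thesis"
      then have "cos \<sigma> \<le> cos (pi / 2)" using sl True by (intro cos_monotone_0_pi_le) (auto simp: lengths_def)
      then show False using \<open>0 < cos \<sigma>\<close> by simp
    qed
    then show ?thesis using sl by (simp add: acute_def lengths_def)
  qed
  show "\<sigma> \<le> \<tau>"
  proof (rule ccontr)
    assume "\<not> ?thesis"
    then have ts: "\<tau> < \<sigma>" by simp
    obtain i where i: "i < 3" "form M e (u i) \<le> - 1 / 2" using ex_opposite_dir[OF e(1)] by blast
    have "gver M \<tau> < gver M \<sigma>" "gsin M \<tau> < gsin M \<sigma>" using ts tau ac gver_smono gsin_strict_mono by auto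
    then have "gver M r < gcos M R * gver M \<sigma> + gver M R + gsin M R * gsin M \<sigma> / 2"
      unfolding gver_r using CR SR by (intro add_less_le_mono) (auto intro!: mult_strict_left_mono mult_left_mono)
    also have "\<dots> \<le> haver M (x i) t"
      unfolding D[OF i(1)] using i(2) SR \<open>gsin M \<tau> < gsin M \<sigma>\<close> St
        mult_left_mono[of "form M e (u i)" "- 1 / 2" "gsin M R * gsin M \<sigma>"] by simp
    finally show False using le[OF i(1)] by simp
  qed
qed

lemma T_in_circumdisk: assumes "t \<in> T" shows "gdist M m t \<le> \<tau>"
  using ex_gexp[OF m_points, of t] T_polar(2)[OF assms] assms by (auto simp: T_eq)

text \<open>
  The two centers being equidistant from \<open>t\<close> puts \<open>t\<close> on the axis through \<open>u k\<close>; on the ray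
  opposite to \<open>u k\<close> it would be too far from \<open>x k\<close>.
\<close>
lemma vertex_unique:
  assumes ijk: "i < 3" "j < 3" "k < 3" "i \<noteq> j" "i \<noteq> k" "j \<noteq> k"
    and t: "t \<in> T" "haver M (x i) t = gver M r" "haver M (x j) t = gver M r"
  shows "t = v k"
proof -
  have tP: "t \<in> points M" using t by (simp add: T_eq)
  define \<sigma> where "\<sigma> = gdist M m t"
  obtain e where e: "unit M m e" "t = gexp M m e \<sigma>" using ex_gexp[OF m_points tP] by (auto simp: \<sigma>_def)
  note ac = T_polar[OF t(1) e \<sigma>_def]
  have D: "haver M (x i) t = gcos M R * gver M \<sigma> + gver M R - gsin M R * gsin M \<sigma> * form M e (u i)" if "i < 3" for i
    using haver_gexp_gexp[OF m_points unit_u[OF that] e(1), of R \<sigma>] e(2) by (simp add: x_def form_commute)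
  have "\<sigma> \<noteq> 0" using e(2) t(2) haver_xm[OF ijk(1)] by auto
  then have s: "0 < \<sigma>" using ac(1) by (simp add: acute_def)
  then have S: "0 < gsin M \<sigma>" using gsin_pos ac by blast
  have "gsin M R * gsin M \<sigma> * form M e (u i) = gsin M R * gsin M \<sigma> * form M e (u j)"
    using D[OF ijk(1)] D[OF ijk(2)] t(2,3) by linarith
  then have ij: "form M e (u i) = form M e (u j)" using S SR by simp
  then have k: "form M e (u k) = - 2 * form M e (u i)" using sum_form_u[OF ijk, of e] by simp
  then have "(form M e (u i))\<^sup>2 = (1/2)\<^sup>2" using sum_form_u_sq[OF ijk e(1)] ij by (simp add: power2_eq_square)
  then consider "form M e (u i) = 1/2" | "form M e (u i) = - (1/2)" by (metis power2_eq_iff)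
  then show ?thesis
  proof cases
    case 1
    have "haver M (x i) t < haver M (x k) t" using 1 k S SR by (simp add: D ijk mult_pos_pos add_pos_pos)
    then show ?thesis using t ijk by (auto simp: T_eq not_less[symmetric])
  next
    case 2
    then have "form M (e - u k) (e - u k) = 0"
      using k e(1) ijk by (simp add: form_uu unit_def form_commute[of M "u k" e])
    then have "e - u k = 0" using e(1) ijk by (intro tangent_form_eq_0[OF m_points]) (auto simp: unit_def dual_mu)
    then have ek: "e = u k" by simp
    have "\<sigma> = \<tau>"
    proof (rule ccontr)
      assume "\<sigma> \<noteq> \<tau>"
      then have "\<sigma> < \<tau>" using ac by simp
      then have "gver M \<sigma> < gver M \<tau>" "gsin M \<sigma> < gsin M \<tau>" using s acute_tau gver_smono gsin_strict_mono by auto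
      then have "gcos M R * gver M \<sigma> + gver M R + gsin M R * gsin M \<sigma> / 2 < gver M r"
        unfolding gver_r using CR SR by (intro add_less_le_mono) (auto intro!: mult_strict_left_mono mult_left_mono)
      then show False using t(2) D[OF ijk(1)] 2 by simp
    qed
    then show ?thesis using e(2) ek by (simp add: v_def)
  qed
qed

lemma dual_uu: "k < 3 \<Longrightarrow> dual M (u k) (u k) = kappa M"
proof (cases "M = Euclidean")
  case True
  assume "k < 3"
  then have "u k $ 3 = 0" using dual_mu[of k] m_points True by (simp add: dual_def points.simps)
  then show ?thesis using True by (simp add: dual_def)
next
  case False
  assume "k < 3"
  then show ?thesis using dual_form[OF False] form_uu by simp
qed

text \<open>
  The axis through a vertex bisects the angle between the directions to the two active centers,
  and it runs from the vertex towards \<open>m\<close>.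
\<close>
lemma vertex_bisector:
  assumes ijk: "i < 3" "j < 3" "k < 3" "i \<noteq> j" "i \<noteq> k" "j \<noteq> k"
  shows "\<exists>\<gamma>>0. tpart M (v k) (x i) + tpart M (v k) (x j) = - \<gamma> *\<^sub>R gdir M m (u k) \<tau>"
proof -
  let ?t = "v k"
  have tP: "?t \<in> points M" using v_points ijk by auto
  define ez where "ez = gdir M m (u k) \<tau>"
  define A where "A = 2 * gcos M R - 2 * gcos M r * gcos M \<tau>"
  define B where "B = - gsin M R - 2 * gcos M r * gsin M \<tau>"
  have Bneg: "B < 0" using SR mult_pos_pos[OF Cr St] unfolding B_def by linarith
  have sumx: "tpart M ?t (x i) + tpart M ?t (x j) = A *\<^sub>R m + B *\<^sub>R u k"
  proof -
    have d: "dual M ?t (x l) = gcos M r" if "l < 3" "l \<noteq> k" for l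
      unfolding dual_haver[OF tP x_points[OF that(1)]] gcos_gver[of M r] haver_commute[of M ?t] haver_xv[OF that(1) ijk(3) that(2)] ..
    have uij: "u i = - u j - u k" using sum_u[OF ijk] by (simp add: eq_neg_iff_add_eq_0 algebra_simps)
    show ?thesis unfolding tpart_def unfolding d[OF ijk(1,5)] d[OF ijk(2,6)] unfolding x_def v_def gexp_def uij A_def B_def
      by (simp add: vec_eq_iff algebra_simps)
  qed
  have "dual M ?t (A *\<^sub>R m + B *\<^sub>R u k) = 0" unfolding sumx[symmetric] using tpart_active(2)[OF tP x_points haver_xv] ijk by simp
  then have AB: "gcos M \<tau> * A + kappa M * gsin M \<tau> * B = 0"
    using dual_mu[OF ijk(3)] dual_uu[OF ijk(3)] points_dual[OF m_points]
    by (simp add: v_def gexp_def dual_commute[of M "u k" m] algebra_simps)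
  have "A *\<^sub>R m + B *\<^sub>R u k = (B / gcos M \<tau>) *\<^sub>R ez"
  proof -
    have "A = - (B / gcos M \<tau>) * (kappa M * gsin M \<tau>)" using AB Ct by (simp add: field_simps)
    then show ?thesis using Ct by (simp add: ez_def gdir_def algebra_simps)
  qed
  then have sz: "tpart M ?t (x i) + tpart M ?t (x j) = (B / gcos M \<tau>) *\<^sub>R ez" using sumx by simp
  show ?thesis using sz Bneg Ct unfolding ez_def
    by (intro exI[of _ "- B / gcos M \<tau>"]) (auto simp: divide_neg_pos)
qed

text \<open>
  A point beyond the vertex \<open>v k\<close> in the normal cone there, at distance \<open>s > R - \<tau>\<close>, cannot have
  distance at most \<open>r\<close> from both other vertices. By symmetry the outer normal \<open>e\<close> lies between the
  axis direction \<open>ez\<close> and the direction \<open>ei\<close> away from \<open>x i\<close>. For these two extreme directions the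
  distance to \<open>v i\<close> exceeds \<open>r\<close>. Since \<open>haver\<close> is affine in the direction, with a nonnegative
  linear part in both cases, and the coefficients of \<open>e\<close> sum to at least \<open>1\<close>, this carries over to
  \<open>e\<close>.
\<close>
lemma vertex_not_nearest:
  assumes ijk: "i < 3" "j < 3" "k < 3" "i \<noteq> j" "i \<noteq> k" "j \<noteq> k"
    and ab: "0 \<le> b" "b \<le> a" and e: "unit M (v k) e" "- e = a *\<^sub>R tpart M (v k) (x i) + b *\<^sub>R tpart M (v k) (x j)"
    and s: "R - \<tau> < s" "s \<le> r" and near: "haver M (gexp M (v k) e s) (v i) \<le> gver M r"
  shows False
proof -
  \<comment> \<open>the distance is shortened from \<open>s\<close> to \<open>h\<close> so that \<open>\<tau> + h < r\<close> is still acute\<close>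
  define \<sigma> where "\<sigma> = min (\<tau> + s) ((R + r) / 2)"
  have \<sigma>: "R < \<sigma>" "\<sigma> \<le> \<tau> + s" "\<sigma> < r" using s R by (auto simp: \<sigma>_def min_less_iff_disj)
  have ac\<sigma>: "acute M \<sigma>" using \<sigma> r tau by (intro acute_mono[OF r]) auto
  define h where "h = \<sigma> - \<tau>"
  have h: "R - \<tau> < h" "h \<le> s" "0 < h" using \<sigma> tau by (auto simp: h_def)
  have ach: "acute M h" "acute M s" using h s by (auto intro!: acute_mono[OF r])
  have Sh: "0 < gsin M h" using gsin_pos[OF ach(1) h(3)] .
  let ?t = "v k"
  have tP: "?t \<in> points M" using v_points ijk by auto
  have hP: "gexp M ?t f h \<in> points M" if "unit M ?t f" for f using gexp_points[OF tP that] .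
  have le: "haver M (gexp M ?t e h) (v i) \<le> gver M r"
  proof (rule haver_between(1)[OF hP[OF e(1)] unit_gdir[OF tP e(1)] v_points[OF ijk(1)] r, of "s - h" h])
    have "acute M (s - h)" using h s by (intro acute_mono[OF r]) auto
    then show "s - h \<in> lengths M" "h \<in> lengths M" using ach acute_lengths by auto
    show "0 < gsin M (s - h + h)" using gsin_pos[OF ach(2)] h by simp
    show "haver M (gexp M (gexp M ?t e h) (gdir M ?t e h) (s - h)) (v i) \<le> gver M r" using near by (simp add: gexp_gexp)
    show "haver M (gexp M (gexp M ?t e h) (- gdir M ?t e h) h) (v i) \<le> gver M r"
      using haver_vv_le[OF ijk(3,1)] ijk by (simp add: gexp_back)
  qed
  define D0 where "D0 = haver M ?t (v i)"
  have D0: "0 \<le> D0" using haver_bounds(1)[OF tP v_points[OF ijk(1)]] by (simp add: D0_def)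
  have hv: "haver M (gexp M ?t f h) (v i) = gcos M h * D0 + gver M h - gsin M h * form M f (v i - ?t)" if "unit M ?t f" for f
    using haver_gexp[OF tP that v_points[OF ijk(1)]] by (simp add: D0_def del: form_diff)
  have act': "x l = gcos M r *\<^sub>R ?t + tpart M ?t (x l)" "dual M ?t (tpart M ?t (x l)) = 0"
    "form M (tpart M ?t (x l)) (tpart M ?t (x l)) = (gsin M r)\<^sup>2" if "l < 3" "l \<noteq> k" for l
    using tpart_active[OF tP x_points[OF that(1)] haver_xv[OF that(1) ijk(3) that(2)]] by auto
  define ei where "ei = (- 1 / gsin M r) *\<^sub>R tpart M ?t (x i)"
  have ei: "unit M ?t ei" using act'[OF ijk(1,5)] Sr by (simp add: ei_def unit_def power2_eq_square)
  have xi: "x i = gexp M ?t (- ei) r" using act'(1)[OF ijk(1,5)] Sr by (simp add: gexp_def ei_def)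
  define ez where "ez = gdir M m (u k) \<tau>"
  have ez: "unit M ?t ez" unfolding ez_def v_def by (rule unit_gdir[OF m_points unit_u[OF ijk(3)]])
  have gi: "gver M r < haver M (gexp M ?t ei h) (v i)"
  proof -
    have "haver M (x i) (gexp M ?t ei h) = gver M (r + h)"
      unfolding xi gver_add using haver_gexp_gexp[OF tP unit_minus[OF ei] ei, of r h] ei by (simp add: unit_def)
    then have "gdist M (x i) (gexp M ?t ei h) = r + h"
      using gdist_eq_iff[OF x_points[OF ijk(1)] hP[OF ei] acute_add[OF r ach(1)]] by simp
    moreover have "gdist M (x i) (v i) = R - \<tau>"
      using gdist_eq_iff[OF x_points[OF ijk(1)] v_points[OF ijk(1)] acute_lengths[OF acute_R_minus_tau]] haver_xv_same[OF ijk(1)] by simp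
    moreover have "gdist M (x i) (gexp M ?t ei h) \<le> gdist M (x i) (v i) + gdist M (v i) (gexp M ?t ei h)"
      by (rule gdist_triangle[OF x_points[OF ijk(1)] v_points[OF ijk(1)] hP[OF ei]])
    ultimately have "\<not> gdist M (gexp M ?t ei h) (v i) \<le> r"
      using h gdist_commute[OF v_points[OF ijk(1)] hP[OF ei]] by simp
    then show ?thesis using gdist_le_iff[OF hP[OF ei] v_points[OF ijk(1)] acute_lengths[OF r]] by simp
  qed
  have gz: "gver M r < haver M (gexp M ?t ez h) (v i)"
  proof -
    have "gexp M ?t ez h = gexp M m (u k) \<sigma>" by (simp add: v_def ez_def gexp_gexp h_def)
    then have "haver M (gexp M ?t ez h) (v i) = gcos M \<sigma> * gver M \<tau> + gver M \<sigma> + gsin M \<sigma> * gsin M \<tau> / 2"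
      using haver_gexp_gexp[OF m_points unit_u[OF ijk(3)] unit_u[OF ijk(1)], of \<sigma> \<tau>] form_u[OF ijk(3,1)] ijk by (simp add: v_def)
    also have "\<dots> = gcos M \<tau> * gver M \<sigma> + gver M \<tau> + gsin M \<sigma> * gsin M \<tau> / 2" unfolding gver_swap[of \<sigma>] ..
    also have "\<dots> > gcos M \<tau> * gver M R + gver M \<tau> + gsin M R * gsin M \<tau> / 2"
      using gver_smono[OF ac\<sigma> _ \<sigma>(1)] gsin_strict_mono[OF ac\<sigma> _ \<sigma>(1)] tau Ct St
      by (intro add_less_le_mono) (auto intro!: mult_strict_left_mono mult_right_mono)
    finally show ?thesis unfolding gver_r gver_swap[of R] by simp
  qed
  have ni: "form M ei (v i - ?t) \<le> 0"
  proof -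
    have "gver M (R - \<tau>) = gcos M r * D0 + gver M r - gsin M r * form M (- ei) (v i - ?t)"
      using haver_gexp[OF tP unit_minus[OF ei] v_points[OF ijk(1)], of r] haver_xv_same[OF ijk(1)] by (simp only: xi D0_def)
    then have "gsin M r * form M (- ei) (v i - ?t) \<ge> 0"
      using gver_rho_less D0 Cr mult_nonneg_nonneg[of "gcos M r" D0] by linarith
    then have "0 \<le> form M (- ei) (v i - ?t)" using Sr by (simp add: zero_le_mult_iff del: form_diff form_minus)
    then show ?thesis by (simp only: form_minus)
  qed
  have nz: "form M ez (v i - ?t) \<le> 0"
  proof -
    have "form M ez (v i - ?t) = gcos M \<tau> * form M (u k) (v i - m) - gsin M \<tau> * dual M m (v i)"
      unfolding ez_def v_def[of k] by (rule form_gdir(1)[OF m_points unit_u[OF ijk(3)] v_points[OF ijk(1)]])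
    also have "form M (u k) (v i - m) = gsin M \<tau> * (- 1 / 2)"
      unfolding v_def using form_gexp[OF m_points unit_u[OF ijk(1)] dual_mu[OF ijk(3)]] form_u[OF ijk(3,1)] ijk by simp
    also have "dual M m (v i) = gcos M \<tau>"
      by (simp add: v_def gexp_def dual_mu[OF ijk(1)] points_dual[OF m_points])
    finally have "form M ez (v i - ?t) = - (3 / 2) * (gcos M \<tau> * gsin M \<tau>)" by (simp add: field_simps)
    then show ?thesis using Ct St by simp
  qed
  obtain \<gamma> where g: "0 < \<gamma>" and sz: "tpart M ?t (x i) + tpart M ?t (x j) = - \<gamma> *\<^sub>R ez"
    using vertex_bisector[OF ijk] unfolding ez_def by blast
  define \<alpha> where "\<alpha> = (a - b) * gsin M r"
  define \<beta> where "\<beta> = b * \<gamma>"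
  have ab0: "0 \<le> \<alpha>" "0 \<le> \<beta>" using ab Sr g by (auto simp: \<alpha>_def \<beta>_def)
  have e_eq: "e = \<alpha> *\<^sub>R ei + \<beta> *\<^sub>R ez"
  proof -
    have "e = - ((a - b) *\<^sub>R tpart M ?t (x i) + b *\<^sub>R (tpart M ?t (x i) + tpart M ?t (x j)))"
      using e(2) by (simp add: algebra_simps minus_equation_iff[of e])
    then show ?thesis unfolding sz using Sr by (simp add: \<alpha>_def \<beta>_def ei_def)
  qed
  have "1 \<le> \<alpha> + \<beta>"
  proof -
    have "1 = form M e e" using e by (simp add: unit_def)
    also have "\<dots> = \<alpha> * \<alpha> + \<beta> * \<beta> + 2 * (\<alpha> * \<beta>) * form M ei ez"
      unfolding e_eq using ei ez by (simp add: unit_def form_commute[of M ez ei] algebra_simps)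
    also have "\<dots> \<le> \<alpha> * \<alpha> + \<beta> * \<beta> + 2 * (\<alpha> * \<beta>) * 1"
      using form_unit_le[OF tP ei ez] ab0 by (intro add_left_mono mult_left_mono) auto
    finally have "1\<^sup>2 \<le> (\<alpha> + \<beta>)\<^sup>2" by (simp add: power2_eq_square algebra_simps)
    then show ?thesis using ab0 by (intro power2_le_imp_le[of 1]) auto
  qed
  define \<mu> where "\<mu> = min (- form M ei (v i - ?t)) (- form M ez (v i - ?t))"
  have mu: "0 \<le> \<mu>" "\<mu> \<le> - form M ei (v i - ?t)" "\<mu> \<le> - form M ez (v i - ?t)"
    using ni nz by (auto simp: \<mu>_def)
  have "\<mu> \<le> (\<alpha> + \<beta>) * \<mu>" using mult_right_mono[OF \<open>1 \<le> \<alpha> + \<beta>\<close> mu(1)] by simp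
  also have "\<dots> = \<alpha> * \<mu> + \<beta> * \<mu>" by (simp add: algebra_simps)
  also have "\<dots> \<le> \<alpha> * (- form M ei (v i - ?t)) + \<beta> * (- form M ez (v i - ?t))"
    using mu ab0 by (intro add_mono mult_left_mono)
  also have "\<dots> = - form M e (v i - ?t)" unfolding e_eq by (simp add: algebra_simps)
  finally have "gsin M h * \<mu> \<le> gsin M h * (- form M e (v i - ?t))" using Sh by (intro mult_left_mono) auto
  moreover have "gver M r < gcos M h * D0 + gver M h + gsin M h * \<mu>"
    using gi gz unfolding hv[OF ei] hv[OF ez] \<mu>_def by (auto simp: min_def simp del: form_diff)
  ultimately show False using le unfolding hv[OF e(1)] by (simp add: algebra_simps del: form_diff)
qed

lemma gdist_le_mono:
  assumes "q \<in> points M" "t \<in> points M" "t' \<in> points M" "haver M q t \<le> haver M q t'"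
  shows "gdist M q t \<le> gdist M q t'"
  using gdist_le_iff[OF assms(1,2) gdist_gver(2)[OF assms(1,3)]] gdist_gver(1)[OF assms(1,3)] assms(4) by simp

lemma x_image: "finite (x ` {..<3})" "x ` {..<3} \<subseteq> points M" "x ` {..<3} \<noteq> {}"
  using x_points by (auto simp: lessThan_empty_iff)

text \<open>
  Let \<open>t\<close> be the point of \<open>T\<close> nearest to \<open>q\<close> and suppose that its distance \<open>s\<close> exceeds \<open>R - \<tau>\<close>.
  The direction from \<open>t\<close> to \<open>q\<close> is an outer normal, hence opposite to a positive combination of
  directions to active centers. If one center \<open>x i\<close> is active, then \<open>x i\<close>, \<open>t\<close>, \<open>q\<close> are on a
  geodesic and \<open>q\<close> has distance \<open>r + s\<close> from \<open>x i\<close>, but the path through \<open>v i\<close> has length at most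
  \<open>(R - \<tau>) + r\<close>. If two are active, \<open>t\<close> is a vertex and \<open>vertex_not_nearest\<close> applies.
\<close>
theorem ex_near_point_of_T:
  assumes q: "q \<in> points M" "\<And>t. t \<in> T \<Longrightarrow> haver M q t \<le> gver M r"
  shows "\<exists>t\<in>T. gdist M q t \<le> R - \<tau>"
proof -
  have 1: "compact T" unfolding T_def using compact_common x_image r by blast
  have 2: "continuous_on T (\<lambda>t. haver M q t)" by (intro continuous_intros)
  have 3: "T \<noteq> {}" using v_in_T[of 0] by auto
  obtain t where t: "t \<in> T" "\<And>t'. t' \<in> T \<Longrightarrow> haver M q t \<le> haver M q t'"
    using continuous_attains_inf[OF 1 3 2] by auto
  have TP: "T \<subseteq> points M" by (auto simp: T_eq)
  then have tP: "t \<in> points M" using t by auto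
  have tmin: "gdist M q t \<le> gdist M q t'" if "t' \<in> T" for t'
    using gdist_le_mono[OF q(1) tP _ t(2)[OF that]] that TP by auto
  show ?thesis
  proof (rule ccontr)
    assume neg: "\<not> ?thesis"
    define s where "s = gdist M t q"
    have sq: "s = gdist M q t" using gdist_commute[OF tP q(1)] by (simp add: s_def)
    have s1: "R - \<tau> < s" using neg t(1) sq by force
    have s2: "s \<le> r" using q(2)[OF t(1)] gdist_le_iff[OF q(1) tP acute_lengths[OF r]] sq by simp
    have s0: "0 < s" using s1 tau by simp
    have sac: "acute M s" using s0 s2 by (intro acute_mono[OF r]) auto
    obtain e where e: "unit M t e" "q = gexp M t e s" using ex_gexp[OF tP q(1)] by (auto simp: s_def)
    have nn: "0 \<le> form M (- e) (y - t)" if "y \<in> T" for y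
      using nearest_point_normal[OF T_def x_image(2) r q(1) t(1) tmin e acute_lengths[OF sac] s0 _ that] sac pi_gt_zero
      by (auto simp: acute_def)
    obtain l where l: "\<forall>q. 0 \<le> l q" "- e = (\<Sum>q\<in>{q\<in>x ` {..<3}. haver M q t = gver M r}. l q *\<^sub>R tpart M t q)"
    proof -
      have "\<exists>l. (\<forall>q. 0 \<le> l q) \<and> - e = (\<Sum>q\<in>{q\<in>x ` {..<3}. haver M q t = gver M r}. l q *\<^sub>R tpart M t q)"
      proof (rule common_tangent_disk(1)[OF x_image(1,2) r rpos m_points])
        show "haver M q m < gver M r" if "q \<in> x ` {..<3}" for q using that haver_xm by auto
      qed (use t(1) nn unit_minus[OF e(1)] in \<open>auto simp: T_def simp del: form_diff form_minus\<close>)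
      then show ?thesis using that by blast
    qed
    have injx: "inj_on x {..<3}"
    proof (rule inj_onI)
      fix i j :: nat assume "i \<in> {..<3}" "j \<in> {..<3}" "x i = x j"
      then show "i = j" using haver_xv[of i j] haver_xv_same[of j] gver_rho_less by (metis lessThan_iff less_irrefl)
    qed
    define J where "J = {i. i < 3 \<and> haver M (x i) t = gver M r}"
    have "{q\<in>x ` {..<3}. haver M q t = gver M r} = x ` J" by (auto simp: J_def)
    moreover have "inj_on x J" using injx by (rule inj_on_subset) (auto simp: J_def)
    ultimately have eJ: "- e = (\<Sum>i\<in>J. l (x i) *\<^sub>R tpart M t (x i))" using l(2) by (simp add: sum.reindex)
    have "e \<noteq> 0" using e(1) by (auto simp: unit_def)
    then have "J \<noteq> {}" using eJ by auto
    then obtain i where i: "i \<in> J" by auto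
    have iP: "i < 3" "haver M (x i) t = gver M r" using i by (auto simp: J_def)
    show False
    proof (cases "J = {i}")
      case True
      note ta = tpart_active[OF tP x_points[OF iP(1)] iP(2)]
      have e1: "- e = l (x i) *\<^sub>R tpart M t (x i)" using eJ True by simp
      have "form M (- e) (- e) = 1" using e(1) by (simp add: unit_def)
      then have "(l (x i) * gsin M r)\<^sup>2 = 1" unfolding e1 using ta(3) by (simp add: power2_eq_square mult_ac)
      then have "l (x i) * gsin M r = 1" using l(1) Sr
        by (metis less_imp_le mult_nonneg_nonneg power2_eq_1_iff neg_0_le_iff_le not_one_le_zero)
      then have "gsin M r *\<^sub>R (- e) = tpart M t (x i)" unfolding e1 by (simp add: mult.commute)
      then have xi: "x i = gexp M t (- e) r" using ta(1) by (simp add: gexp_def)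
      have "haver M (x i) q = gver M (r + s)"
        unfolding xi e(2) gver_add using haver_gexp_gexp[OF tP unit_minus[OF e(1)] e(1), of r s] e(1) by (simp add: unit_def)
      then have "gdist M (x i) q = r + s"
        using gdist_eq_iff[OF x_points[OF iP(1)] q(1) acute_add[OF r sac]] by simp
      moreover have "gdist M (x i) (v i) = R - \<tau>"
        using gdist_eq_iff[OF x_points[OF iP(1)] v_points[OF iP(1)] acute_lengths[OF acute_R_minus_tau]] haver_xv_same[OF iP(1)] by simp
      moreover have "gdist M (v i) q \<le> r"
        using q(2)[OF v_in_T[OF iP(1)]] gdist_le_iff[OF v_points[OF iP(1)] q(1) acute_lengths[OF r]] haver_commute by metis
      ultimately show False using gdist_triangle[OF x_points[OF iP(1)] v_points[OF iP(1)] q(1)] s1 by linarith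
    next
      case False
      then obtain j where j: "j \<in> J" "i \<noteq> j" using i by auto
      have jP: "j < 3" "haver M (x j) t = gver M r" using j by (auto simp: J_def)
      define k where "k = 3 - i - j"
      have ijk: "i < 3" "j < 3" "k < 3" "i \<noteq> j" "i \<noteq> k" "j \<noteq> k" using iP(1) jP(1) j(2) unfolding k_def by presburger+
      have tv: "t = v k" by (rule vertex_unique[OF ijk t(1) iP(2) jP(2)])
      have "k \<notin> J" using haver_xv_same[OF ijk(3)] gver_rho_less tv by (simp add: J_def)
      then have "J = {i, j}" using triples[OF ijk] i j by (auto simp: J_def)
      then have ee: "- e = l (x i) *\<^sub>R tpart M t (x i) + l (x j) *\<^sub>R tpart M t (x j)" using eJ ijk by simp
      have near: "haver M (gexp M (v k) e s) (v i) \<le> gver M r" "haver M (gexp M (v k) e s) (v j) \<le> gver M r"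
        using q(2) v_in_T ijk e(2) tv by auto
      show False
      proof (cases "l (x j) \<le> l (x i)")
        case True
        show False by (rule vertex_not_nearest[OF ijk _ True _ _ s1 s2 near(1)]) (use l e ee tv in auto)
      next
        case False
        have jik: "j < 3" "i < 3" "k < 3" "j \<noteq> i" "j \<noteq> k" "i \<noteq> k" using ijk by auto
        show False by (rule vertex_not_nearest[OF jik, of "l (x i)" "l (x j)"]) (use l e ee tv near s1 s2 False in \<open>auto simp: add.commute\<close>)
      qed
    qed
  qed
qed

text \<open>
  Every disk of radius \<open>r\<close> containing an intersection that contains \<open>T\<close> also contains \<open>T\<close>, so the
  depth estimate for \<open>T\<close> is inherited by all larger intersections of disks.
\<close>
lemma wide_set_common:
  assumes Q: "finite Q" "Q \<subseteq> points M" "Q \<noteq> {}" "\<And>q. q \<in> Q \<Longrightarrow> haver M q m < gver M r" and T: "T \<subseteq> common M r Q"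
  shows "wide_set M (common M r Q) r (r - (R - \<tau>))"
proof
  let ?K = "common M r Q" and ?w = "r - (R - \<tau>)"
  show "?K \<subseteq> points M" by (auto simp: common_def)
  show "compact ?K" using compact_common Q r by blast
  show "acute M r" "0 < r" by (fact r, fact rpos)
  show "acute M ?w" "0 < ?w" using r tau R by (auto simp: acute_def)
  show "r - ?w \<in> {- pi / 2<..<pi / 2} \<or> M \<noteq> Spherical" using acute_R_minus_tau pi_gt_zero by (auto simp: acute_def)
  fix p e assume p: "p \<in> ?K" "unit M p e" "\<And>t. t \<in> ?K \<Longrightarrow> 0 \<le> form M e (t - p)"
  have pP: "p \<in> points M" using p by (auto simp: common_def)
  have tang: "haver M (gexp M p e r) t \<le> gver M r" if "t \<in> ?K" for t
    by (rule common_tangent_disk(2)[OF Q(1,2) r rpos m_points _ p(1,2) _ that]) (fact Q(4) p(3))+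
  show "haver M (gexp M p e r) t \<le> gver M r" if "t \<in> ?K" for t by (rule tang[OF that])
  obtain t where t: "t \<in> T" "gdist M (gexp M p e r) t \<le> R - \<tau>"
    using ex_near_point_of_T[OF gexp_points[OF pP p(2)]] tang T by blast
  have tP: "t \<in> points M" using t by (auto simp: T_eq)
  have w: "0 \<le> ?w" "?w \<le> r" "gdist M (gexp M p e r) t \<le> r - ?w" using t tau R by auto
  note b = beyond_of_near[OF pP p(2) tP r w]
  have "gsin M ?w \<le> form M e (t - p)"
    using b(2) gsin_le_of_beyond[OF pP p(2) tP _ w(1) b(1)] by (cases M) auto
  then show "\<exists>t\<in>?K. 0 \<le> gcos M ?w * form M e (t - p) - gsin M ?w * dual M p t \<and> gsin M ?w \<le> form M e (t - p)"
    using b(1) t(1) T by blast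
qed

end

section \<open>The one-parameter family of enlarged bodies\<close>

context regular_disk_triangle
begin

text \<open>
  The point of the arc around \<open>x 0\<close> on the axis through \<open>v 0\<close>.
\<close>
lemma foot_in_T: "gexp M m (u 0) (R - r) \<in> T"
proof -
  have ac: "acute M (r - R)" using r R tau by (auto simp: acute_def)
  have S: "0 < gsin M (r - R)" using gsin_pos[OF ac] R by simp
  have g: "gver M r = gcos M R * gver M (r - R) + gver M R + gsin M R * gsin M (r - R)"
    using gver_add[of M R "r - R"] by simp
  have sym: "gver M (R - r) = gver M (r - R)" "gsin M (R - r) = - gsin M (r - R)"
    using gver_minus[of M "r - R"] gsin_minus[of M "r - R"] by simp_all
  have "haver M (x i) (gexp M m (u 0) (R - r)) \<le> gver M r" if "i < 3" for i
  proof -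
    have "haver M (x i) (gexp M m (u 0) (R - r)) = gcos M R * gver M (r - R) + gver M R + gsin M R * gsin M (r - R) * form M (u i) (u 0)"
      unfolding x_def using haver_gexp_gexp[OF m_points unit_u[OF that] unit_u[of 0], of R "R - r"] by (simp add: sym)
    moreover have "gsin M R * gsin M (r - R) * form M (u i) (u 0) \<le> gsin M R * gsin M (r - R) * 1"
      using SR S form_unit_le[OF m_points unit_u[OF that] unit_u[of 0]] by (intro mult_left_mono) auto
    ultimately show ?thesis unfolding g by simp
  qed
  then show ?thesis using gexp_points[OF m_points unit_u[of 0]] by (simp add: T_eq)
qed

text \<open>
  The axis from the foot to the vertex \<open>v 0\<close> has length \<open>r - (R - \<tau>)\<close>. The disk around \<open>x 0\<close>
  touches at the foot; the disk touching at \<open>v 0\<close> is centered on the axis, at distance \<open>r\<close> from \<open>v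
  0\<close>.
\<close>
lemma minimal_width_common:
  assumes Q: "finite Q" "Q \<subseteq> points M" "\<And>q. q \<in> Q \<Longrightarrow> haver M q m < gver M r" and T: "T \<subseteq> common M r Q"
    and x0: "x 0 \<in> Q" and c: "\<And>t. t \<in> common M r Q \<Longrightarrow> haver M (gexp M m (u 0) (\<tau> - r)) t \<le> gver M r"
  shows "minimal_width M (common M r Q) = r - (R - \<tau>)"
proof -
  interpret wide_set M "common M r Q" r "r - (R - \<tau>)" by (rule wide_set_common[OF Q(1,2) _ Q(3) T]) (use x0 in auto)
  let ?a = "gexp M m (u 0) (R - r)" and ?n = "gdir M m (u 0) (R - r)"
  have eq: "gexp M ?a ?n (r - (R - \<tau>)) = v 0" "gexp M ?a ?n r = x 0" "gexp M ?a ?n (r - (R - \<tau>) - r) = gexp M m (u 0) (\<tau> - r)"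
    by (simp_all add: gexp_gexp v_def x_def)
  show ?thesis
  proof (rule minimal_width_eq[of ?a ?n])
    show "?a \<in> common M r Q" using foot_in_T T by auto
    show "unit M ?a ?n" by (rule unit_gdir[OF m_points unit_u]) simp
    show "gexp M ?a ?n (r - (R - \<tau>)) \<in> common M r Q" unfolding eq using v_in_T[of 0] T by auto
    show "r - (R - \<tau>) \<le> r" using tau by simp
    show "haver M (gexp M ?a ?n r) t \<le> gver M r" if "t \<in> common M r Q" for t
      unfolding eq using that x0 by (auto simp: common_def)
    show "haver M (gexp M ?a ?n (r - (R - \<tau>) - r)) t \<le> gver M r" if "t \<in> common M r Q" for t
      unfolding eq using c[OF that] .
  qed
qed

text \<open>
  The directions, scaled by \<open>gsin M r\<close>, from the vertex \<open>v 0\<close> to the two centers on whose circles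
  it lies.
\<close>
definition "\<eta> i = tpart M (v 0) (x i)"

lemma eta: assumes "i < 3" "i \<noteq> 0"
  shows "x i = gcos M r *\<^sub>R v 0 + \<eta> i" "dual M (v 0) (\<eta> i) = 0" "form M (\<eta> i) (\<eta> i) = (gsin M r)\<^sup>2"
  unfolding \<eta>_def using tpart_active[OF v_points[of 0] x_points[OF assms(1)] haver_xv[OF assms(1) _ assms(2)]] by auto

text \<open>The cosine of the angle at \<open>v 0\<close> between these directions.\<close>
definition "cos_eta = form M (\<eta> 1) (\<eta> 2) / (gsin M r)\<^sup>2"

lemma cos_eta: "form M (\<eta> 1) (\<eta> 2) = cos_eta * (gsin M r)\<^sup>2" "cos_eta < 1" "- 1 < cos_eta"
proof -
  have S: "0 < (gsin M r)\<^sup>2" using Sr by simp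
  show *: "form M (\<eta> 1) (\<eta> 2) = cos_eta * (gsin M r)\<^sup>2" using Sr by (simp add: cos_eta_def)
  have p: "dual M (v 0) (\<eta> 1 - \<eta> 2) = 0" "dual M (v 0) (\<eta> 1 + \<eta> 2) = 0" using eta by simp_all
  have f: "form M (\<eta> 1 - \<eta> 2) (\<eta> 1 - \<eta> 2) = 2 * (1 - cos_eta) * (gsin M r)\<^sup>2" "form M (\<eta> 1 + \<eta> 2) (\<eta> 1 + \<eta> 2) = 2 * (1 + cos_eta) * (gsin M r)\<^sup>2"
    using * eta(3)[of 1] eta(3)[of 2] by (simp_all add: form_commute[of M "\<eta> 2" "\<eta> (Suc 0)"] algebra_simps)
  have "\<eta> 1 - \<eta> 2 \<noteq> 0"
  proof
    assume "\<eta> 1 - \<eta> 2 = 0"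
    then have "x 1 = x 2" using eta(1)[of 1] eta(1)[of 2] by simp
    then show False using haver_xv[of 1 2] haver_xv_same[of 2] gver_rho_less by simp
  qed
  then have "form M (\<eta> 1 - \<eta> 2) (\<eta> 1 - \<eta> 2) > 0"
    using tangent_form_nonneg[OF v_points[of 0] p(1)] tangent_form_eq_0[OF v_points[of 0] p(1)] by force
  then show "cos_eta < 1" unfolding f using S by (simp add: zero_less_mult_iff)
  have "\<eta> 1 + \<eta> 2 \<noteq> 0"
  proof
    assume "\<eta> 1 + \<eta> 2 = 0"
    then obtain g where g: "0 < g" "- g *\<^sub>R gdir M m (u 0) \<tau> = 0" using vertex_bisector[of 1 2 0] unfolding \<eta>_def by auto
    then show False using unit_gdir[OF m_points unit_u[of 0], of \<tau>] by (auto simp: unit_def)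
  qed
  then have "form M (\<eta> 1 + \<eta> 2) (\<eta> 1 + \<eta> 2) > 0"
    using tangent_form_nonneg[OF v_points[of 0] p(2)] tangent_form_eq_0[OF v_points[of 0] p(2)] by force
  then show "- 1 < cos_eta" unfolding f using S by (simp add: zero_less_mult_iff)
qed

text \<open>
  The moving center \<open>z s\<close> stays at distance \<open>r\<close> from \<open>v 0\<close>; its direction is the normalized convex
  combination of \<open>\<eta> 2\<close> (at \<open>s = 0\<close>) and \<open>\<eta> 1\<close> (at \<open>s = 1\<close>), and \<open>N s\<close> is the relative length
  before normalization.
\<close>
definition "N s = sqrt (1 - 2 * s * (1 - s) * (1 - cos_eta))"
definition "\<zeta> s = (1 / N s) *\<^sub>R ((1 - s) *\<^sub>R \<eta> 2 + s *\<^sub>R \<eta> 1)"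
definition "z s = gcos M r *\<^sub>R v 0 + \<zeta> s"

lemma N: assumes "0 \<le> s" "s \<le> 1"
  shows "(1 + cos_eta) / 2 \<le> (N s)\<^sup>2" "(N s)\<^sup>2 = 1 - 2 * s * (1 - s) * (1 - cos_eta)" "0 < N s" "N s \<le> 1"
proof -
  have "4 * (s * (1 - s)) \<le> 1" using zero_le_power2[of "2 * s - 1"] by (simp add: power2_eq_square algebra_simps)
  then have "(1 - cos_eta) * (4 * (s * (1 - s))) \<le> (1 - cos_eta) * 1" using cos_eta by (intro mult_left_mono) auto
  then have *: "(1 + cos_eta) / 2 \<le> 1 - 2 * s * (1 - s) * (1 - cos_eta)" by (simp add: field_simps)
  have p: "0 < 1 - 2 * s * (1 - s) * (1 - cos_eta)" by (rule less_le_trans[OF _ *]) (use cos_eta(3) in simp)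
  show N2: "(N s)\<^sup>2 = 1 - 2 * s * (1 - s) * (1 - cos_eta)" using p by (simp add: N_def)
  show "(1 + cos_eta) / 2 \<le> (N s)\<^sup>2" using * N2 by simp
  show "0 < N s" using p by (simp add: N_def)
  have "0 \<le> 2 * s * (1 - s) * (1 - cos_eta)" using assms cos_eta by simp
  then show "N s \<le> 1" by (simp add: N_def)
qed

lemma zeta: assumes "0 \<le> s" "s \<le> 1"
  shows "dual M (v 0) (\<zeta> s) = 0" "form M (\<zeta> s) (\<zeta> s) = (gsin M r)\<^sup>2"
proof -
  show "dual M (v 0) (\<zeta> s) = 0" using eta by (simp add: \<zeta>_def)
  have "form M ((1 - s) *\<^sub>R \<eta> 2 + s *\<^sub>R \<eta> 1) ((1 - s) *\<^sub>R \<eta> 2 + s *\<^sub>R \<eta> 1) = (N s)\<^sup>2 * (gsin M r)\<^sup>2"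
    unfolding N(2)[OF assms] using eta(3)[of 1] eta(3)[of 2] cos_eta(1) by (simp add: form_commute[of M "\<eta> 2" "\<eta> (Suc 0)"] algebra_simps)
  then show "form M (\<zeta> s) (\<zeta> s) = (gsin M r)\<^sup>2"
    unfolding \<zeta>_def form_scaleR using N(3)[OF assms] by (simp add: power2_eq_square)
qed

lemma z_points: "0 \<le> s \<Longrightarrow> s \<le> 1 \<Longrightarrow> z s \<in> points M"
  unfolding z_def by (intro point_step v_points zeta) auto

lemma z_0: "z 0 = x 2" using eta(1)[of 2] by (simp add: z_def \<zeta>_def N_def)

lemma haver_z_le:
  assumes s: "0 \<le> s" "s \<le> 1" and t: "t \<in> points M" "haver M (x 1) t \<le> gver M r" "haver M (x 2) t \<le> gver M r"
  shows "haver M (z s) t \<le> gver M r"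
  unfolding z_def
proof (rule in_disk_of_positive_combination2[OF r rpos v_points[of 0] t(1), of "\<eta> 1" "\<eta> 2" "s / N s" "(1 - s) / N s"])
  show "haver M (gcos M r *\<^sub>R v 0 + \<eta> 1) t \<le> gver M r" "haver M (gcos M r *\<^sub>R v 0 + \<eta> 2) t \<le> gver M r"
    using t eta(1)[of 1] eta(1)[of 2] by simp_all
  show "\<zeta> s = (s / N s) *\<^sub>R \<eta> 1 + ((1 - s) / N s) *\<^sub>R \<eta> 2" by (simp add: \<zeta>_def scaleR_right_distrib)
qed (use eta s N(3)[OF s] zeta[OF s] in auto)

lemma haver_z:
  assumes s: "0 \<le> s" "s \<le> 1" and t: "t \<in> points M"
  shows "haver M (z s) t = gcos M r * haver M (v 0) t + gver M r - form M (\<zeta> s) (t - v 0)"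
  unfolding z_def by (rule haver_step[OF v_points[of 0] zeta[OF s] t]) simp

lemma form_eta_haver: assumes "i < 3" "i \<noteq> 0" "t \<in> points M"
  shows "form M (\<eta> i) (t - v 0) = gcos M r * haver M (v 0) t + gver M r - haver M (x i) t"
  using haver_step[OF v_points[of 0] eta(2,3)[OF assms(1,2)] assms(3)] eta(1)[OF assms(1,2)] by (simp del: form_diff)

lemma form_zeta: "form M (\<zeta> s) w = ((1 - s) * form M (\<eta> 2) w + s * form M (\<eta> 1) w) / N s"
  by (simp add: \<zeta>_def)

lemma haver_z_m: assumes s: "0 \<le> s" "s \<le> 1" shows "haver M (z s) m \<le> gver M R"
proof -
  define g where "g = gcos M r * haver M (v 0) m + gver M r - gver M R"
  have "form M (\<zeta> s) (m - v 0) = ((1 - s) * g + s * g) / N s"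
    unfolding form_zeta using form_eta_haver[of 1 m] form_eta_haver[of 2 m] haver_x_center m_points by (simp add: g_def del: form_diff)
  also have "\<dots> = g / N s" by (simp add: algebra_simps)
  also have "\<dots> \<ge> g"
  proof -
    have "0 \<le> gcos M r * haver M (v 0) m" using Cr haver_bounds(1)[OF v_points[of 0] m_points] by simp
    then have "0 \<le> g" using gver_R_gap by (simp add: g_def)
    then have "g * N s \<le> g * 1" using N(4)[OF s] by (intro mult_left_mono) auto
    then show ?thesis using N(3)[OF s] by (simp add: pos_le_divide_eq)
  qed
  finally show ?thesis unfolding haver_z[OF s m_points] by (simp add: g_def)
qed

definition "Ks s = common M r {x 0, x 1, z s}"

lemma T_subset_Ks: "0 \<le> s \<Longrightarrow> s \<le> 1 \<Longrightarrow> T \<subseteq> Ks s"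
  unfolding Ks_def T_eq common_def using haver_z_le by auto

lemma lessThan_3: "{..<3} = {0, 1, 2::nat}" by auto

lemma Ks_0: "Ks 0 = T" by (simp add: Ks_def T_def z_0 lessThan_3)

lemma Ks_centers: assumes "0 \<le> s" "s \<le> 1"
  shows "finite {x 0, x 1, z s}" "{x 0, x 1, z s} \<subseteq> points M" "{x 0, x 1, z s} \<noteq> {}"
    "q \<in> {x 0, x 1, z s} \<Longrightarrow> haver M q m \<le> gver M R" "q \<in> {x 0, x 1, z s} \<Longrightarrow> haver M q m < gver M r"
proof -
  show *: "q \<in> {x 0, x 1, z s} \<Longrightarrow> haver M q m \<le> gver M R" using haver_x_center[of 0] haver_x_center[of 1] haver_z_m[OF assms] by auto
  then show "q \<in> {x 0, x 1, z s} \<Longrightarrow> haver M q m < gver M r" using gver_R_gap by linarith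
qed (use x_points z_points[OF assms] in auto)

lemma ball_convex_Ks: "0 \<le> s \<Longrightarrow> s \<le> 1 \<Longrightarrow> ball_convex_body M r (Ks s)"
  unfolding Ks_def by (rule ball_convex_common[OF Ks_centers(1-3) r m_points Ks_centers(5)])

text \<open>
  The disk that touches at \<open>v 0\<close> orthogonally to the axis contains \<open>Ks s\<close> because the axis lies
  between the directions to \<open>x 1\<close> and \<open>z s\<close>: it bisects the angle between \<open>\<eta> 1\<close> and \<open>\<eta> 2\<close>, and for
  \<open>s \<le> 1 / 2\<close> the direction to \<open>z s\<close> is still on the side of \<open>\<eta> 2\<close>.
\<close>
lemma minimal_width_Ks: assumes s: "0 \<le> s" "s \<le> 1 / 2"
  shows "minimal_width M (Ks s) = r - (R - \<tau>)"
proof -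
  have s': "s \<le> 1" using s by simp
  obtain g where g: "0 < g" "\<eta> 1 + \<eta> 2 = - g *\<^sub>R gdir M m (u 0) \<tau>" using vertex_bisector[of 1 2 0] unfolding \<eta>_def by auto
  define e where "e = - gdir M m (u 0) \<tau>"
  have e: "unit M (v 0) e" unfolding e_def v_def by (intro unit_minus unit_gdir m_points unit_u) simp
  have c: "gexp M m (u 0) (\<tau> - r) = gcos M r *\<^sub>R v 0 + gsin M r *\<^sub>R e"
    using gexp_back[of M m "u 0" \<tau> r] by (simp add: gexp_def[of M "gexp M m (u 0) \<tau>"] v_def e_def)
  have n: "(1 - s) *\<^sub>R \<eta> 2 = N s *\<^sub>R \<zeta> s - s *\<^sub>R \<eta> 1" using N(3)[OF s(1) s'] by (simp add: \<zeta>_def)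
  have "\<eta> 2 = (1 / (1 - s)) *\<^sub>R ((1 - s) *\<^sub>R \<eta> 2)" using s by simp
  then have e2: "\<eta> 2 = (1 / (1 - s)) *\<^sub>R (N s *\<^sub>R \<zeta> s - s *\<^sub>R \<eta> 1)" unfolding n .
  have s2: "1 - s / (1 - s) \<ge> 0" using s by (simp add: field_simps)
  have "g *\<^sub>R e = \<eta> 1 + \<eta> 2" using g by (simp add: e_def)
  also have "\<dots> = (1 - s / (1 - s)) *\<^sub>R \<eta> 1 + (N s / (1 - s)) *\<^sub>R \<zeta> s"
    by (subst e2) (simp add: algebra_simps)
  finally have ge: "g *\<^sub>R e = (1 - s / (1 - s)) *\<^sub>R \<eta> 1 + (N s / (1 - s)) *\<^sub>R \<zeta> s" .
  have "e = (1 / g) *\<^sub>R (g *\<^sub>R e)" using g by simp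
  then have ee: "gsin M r *\<^sub>R e = (gsin M r / g * (1 - s / (1 - s))) *\<^sub>R \<eta> 1 + (gsin M r / g * (N s / (1 - s))) *\<^sub>R \<zeta> s"
    unfolding ge by (metis (no_types, lifting) scaleR_add_right scaleR_scaleR times_divide_eq_left mult.commute mult_1)
  have near: "haver M (gexp M m (u 0) (\<tau> - r)) t \<le> gver M r" if t: "t \<in> Ks s" for t
    unfolding c
  proof (rule in_disk_of_positive_combination2[OF r rpos v_points[of 0] _ _ _ _ _ _ _ _ _ ee])
    show "t \<in> points M" using t by (simp add: Ks_def common_def)
    show "haver M (gcos M r *\<^sub>R v 0 + \<eta> 1) t \<le> gver M r" using t eta(1)[of 1] by (simp add: Ks_def common_def)
    show "haver M (gcos M r *\<^sub>R v 0 + \<zeta> s) t \<le> gver M r" using t by (simp add: Ks_def common_def z_def)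
    show "0 \<le> gsin M r / g * (1 - s / (1 - s))" using s2 g Sr by (intro mult_nonneg_nonneg) auto
    show "0 \<le> gsin M r / g * (N s / (1 - s))" using s g Sr N(3)[OF s(1) s'] by (intro mult_nonneg_nonneg) auto
    show "form M (gsin M r *\<^sub>R e) (gsin M r *\<^sub>R e) = (gsin M r)\<^sup>2" using e by (simp add: unit_def power2_eq_square)
  qed (use eta zeta[OF s(1) s'] in auto)
  show ?thesis unfolding Ks_def
    by (rule minimal_width_common[OF Ks_centers(1,2,5)[OF s(1) s'] _ _ near])
      (use T_subset_Ks[OF s(1) s'] in \<open>auto simp: Ks_def\<close>)
qed

text \<open>
  The directions, scaled by \<open>gsin M r\<close>, from the center \<open>x 0\<close> to the two vertices on its circle.
  The point \<open>P \<theta>\<close> lies on that circle beyond \<open>v 1\<close> as seen from \<open>v 2\<close>, and \<open>nx \<theta>\<close> is the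
  normalizing factor of its direction.
\<close>
definition "\<xi> i = tpart M (x 0) (v i)"
definition "cos_xi = form M (\<xi> 1) (\<xi> 2) / (gsin M r)\<^sup>2"
definition "nx \<theta> = sqrt (1 - 2 * \<theta> * cos_xi + \<theta>\<^sup>2)"
definition "\<Xi> \<theta> = (1 / nx \<theta>) *\<^sub>R (\<xi> 1 - \<theta> *\<^sub>R \<xi> 2)"
definition "P \<theta> = gcos M r *\<^sub>R x 0 + \<Xi> \<theta>"

lemma xi: assumes "i < 3" "i \<noteq> 0"
  shows "v i = gcos M r *\<^sub>R x 0 + \<xi> i" "dual M (x 0) (\<xi> i) = 0" "form M (\<xi> i) (\<xi> i) = (gsin M r)\<^sup>2"
proof -
  have "haver M (v i) (x 0) = gver M r" using haver_xv[of 0 i] assms by (simp add: haver_commute)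
  then show "v i = gcos M r *\<^sub>R x 0 + \<xi> i" "dual M (x 0) (\<xi> i) = 0" "form M (\<xi> i) (\<xi> i) = (gsin M r)\<^sup>2"
    unfolding \<xi>_def using tpart_active[OF x_points[of 0] v_points[OF assms(1)]] by auto
qed

lemma haver_v_form_xi: assumes "i < 3" "i \<noteq> 0" "t \<in> points M"
  shows "haver M (v i) t = gcos M r * haver M (x 0) t + gver M r - form M (\<xi> i) (t - x 0)"
  using haver_step[OF x_points[of 0] xi(2,3)[OF assms(1,2)] assms(3)] xi(1)[OF assms(1,2)] by (simp del: form_diff)

lemma form_xi_v: assumes "j < 3" "j \<noteq> 0" "dual M (x 0) w = 0" shows "form M w (v j - x 0) = form M w (\<xi> j)"
  unfolding \<xi>_def using form_tpart[OF x_points[of 0] v_points[OF assms(1)] assms(3)] by (simp del: form_diff)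

lemma cos_xi: "form M (\<xi> 1) (\<xi> 2) = cos_xi * (gsin M r)\<^sup>2" "0 < cos_xi" "cos_xi < 1"
proof -
  have S: "0 < (gsin M r)\<^sup>2" using Sr by simp
  show *: "form M (\<xi> 1) (\<xi> 2) = cos_xi * (gsin M r)\<^sup>2" using Sr by (simp add: cos_xi_def)
  have x0v: "haver M (x 0) (v 2) = gver M r" by (rule haver_xv) auto
  have h: "haver M (v 1) (v 2) = (gsin M r)\<^sup>2 * (1 - cos_xi)"
    using haver_v_form_xi[of 1 "v 2"] v_points[of 2] form_xi_v[of 2 "\<xi> 1"] xi(2)[of 1] * gsin_squared[of M r]
    by (simp add: x0v algebra_simps del: form_diff)
  have "gver M r * (1 + gcos M r) * (1 - cos_xi) \<le> gver M r" using h haver_vv_le[of 1 2] unfolding gsin_squared by simp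
  then have "(1 + gcos M r) * (1 - cos_xi) \<le> 1" using gver_r_pos by (simp add: mult.assoc)
  then have "gcos M r \<le> (1 + gcos M r) * cos_xi" by (simp add: algebra_simps)
  then show "0 < cos_xi" using Cr by (smt (verit) zero_less_mult_pos)
  have "0 < haver M (v 1) (v 2)"
    using haver_vv[of 1 2] Ct St gver_nonneg[of M \<tau>] mult_pos_pos[OF St St] by (simp add: add_nonneg_pos)
  then show "cos_xi < 1" unfolding h using S by (simp add: zero_less_mult_iff)
qed

lemma nx: assumes "0 \<le> \<theta>" "\<theta> \<le> cos_xi"
  shows "(nx \<theta>)\<^sup>2 = 1 - 2 * \<theta> * cos_xi + \<theta>\<^sup>2" "0 < 1 - \<theta> * cos_xi" "1 - \<theta> * cos_xi \<le> nx \<theta>" "1 - \<theta> \<le> nx \<theta>" "nx \<theta> \<le> 1" "0 < nx \<theta>"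
proof -
  have t1: "\<theta> * cos_xi < 1" using assms cos_xi mult_le_one[of \<theta> cos_xi] mult_right_mono[of \<theta> 1 cos_xi] by (smt (verit) mult_less_cancel_right2)
  then show p: "0 < 1 - \<theta> * cos_xi" by simp
  have cc: "cos_xi * cos_xi \<le> 1" using cos_xi mult_le_one[of cos_xi cos_xi] by simp
  have *: "1 - 2 * \<theta> * cos_xi + \<theta>\<^sup>2 = (1 - \<theta> * cos_xi)\<^sup>2 + \<theta>\<^sup>2 * (1 - cos_xi * cos_xi)" by (simp add: power2_eq_square algebra_simps)
  have ge: "(1 - \<theta> * cos_xi)\<^sup>2 \<le> 1 - 2 * \<theta> * cos_xi + \<theta>\<^sup>2" unfolding * using cc by simp
  then show n2: "(nx \<theta>)\<^sup>2 = 1 - 2 * \<theta> * cos_xi + \<theta>\<^sup>2" using order_trans[OF zero_le_power2 ge] by (simp add: nx_def)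
  show 1: "1 - \<theta> * cos_xi \<le> nx \<theta>" using ge by (simp add: nx_def real_le_rsqrt)
  then show "0 < nx \<theta>" using p by simp
  have "\<theta> * cos_xi \<le> \<theta>" using assms cos_xi by (simp add: mult_left_le)
  then show "1 - \<theta> \<le> nx \<theta>" using 1 by simp
  have "\<theta>\<^sup>2 \<le> \<theta> * cos_xi" using assms by (simp add: power2_eq_square mult_left_mono)
  also have "\<dots> \<le> 2 * \<theta> * cos_xi" using assms cos_xi by simp
  finally show "nx \<theta> \<le> 1" by (simp add: nx_def)
qed

lemma Xi: assumes "0 \<le> \<theta>" "\<theta> \<le> cos_xi"
  shows "dual M (x 0) (\<Xi> \<theta>) = 0" "form M (\<Xi> \<theta>) (\<Xi> \<theta>) = (gsin M r)\<^sup>2"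
proof -
  show "dual M (x 0) (\<Xi> \<theta>) = 0" using xi by (simp add: \<Xi>_def)
  have "form M (\<xi> 1 - \<theta> *\<^sub>R \<xi> 2) (\<xi> 1 - \<theta> *\<^sub>R \<xi> 2) = (nx \<theta>)\<^sup>2 * (gsin M r)\<^sup>2"
    unfolding nx(1)[OF assms] using xi(3)[of 1] xi(3)[of 2] cos_xi(1)
    by (simp add: form_commute[of M "\<xi> 2" "\<xi> (Suc 0)"] power2_eq_square algebra_simps)
  then show "form M (\<Xi> \<theta>) (\<Xi> \<theta>) = (gsin M r)\<^sup>2"
    unfolding \<Xi>_def form_scaleR using nx(6)[OF assms] by (simp add: power2_eq_square)
qed

lemma P_points: "0 \<le> \<theta> \<Longrightarrow> \<theta> \<le> cos_xi \<Longrightarrow> P \<theta> \<in> points M"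
  unfolding P_def by (intro point_step x_points Xi) auto

lemma haver_P:
  assumes th: "0 \<le> \<theta>" "\<theta> \<le> cos_xi" and t: "t \<in> points M"
  shows "haver M (P \<theta>) t = gcos M r * haver M (x 0) t + gver M r - (form M (\<xi> 1) (t - x 0) - \<theta> * form M (\<xi> 2) (t - x 0)) / nx \<theta>"
proof -
  have "form M (\<Xi> \<theta>) (t - x 0) = (form M (\<xi> 1) (t - x 0) - \<theta> * form M (\<xi> 2) (t - x 0)) / nx \<theta>"
    by (simp add: \<Xi>_def del: form_diff(2))
  then show ?thesis unfolding P_def using haver_step[OF x_points[of 0] Xi[OF th] t] by (simp del: form_diff)
qed

lemma haver_P_x0: "0 \<le> \<theta> \<Longrightarrow> \<theta> \<le> cos_xi \<Longrightarrow> haver M (P \<theta>) (x 0) = gver M r"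
  using haver_P[of \<theta> "x 0"] x_points[of 0] by simp

text \<open>
  A disk that contains \<open>v 1\<close> with enough slack contains \<open>P \<theta>\<close>; the required slack is linear in
  \<open>\<theta>\<close>.
\<close>
lemma haver_P_le:
  assumes th: "0 \<le> \<theta>" "\<theta> \<le> cos_xi" and q: "q \<in> points M"
    and m: "\<theta> * (gcos M r * haver M (x 0) q + gver M r) \<le> gver M r - haver M (v 1) q"
  shows "haver M (P \<theta>) q \<le> gver M r"
proof -
  define E where "E = gcos M r * haver M (x 0) q"
  have E: "0 \<le> E" using Cr haver_bounds(1)[OF x_points[of 0] q] by (simp add: E_def)
  have F1: "form M (\<xi> 1) (q - x 0) = E + gver M r - haver M (v 1) q"
    using haver_v_form_xi[of 1 q] q by (simp add: E_def del: form_diff)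
  have "form M (\<xi> 2) (q - x 0) \<le> E + gver M r"
    using haver_v_form_xi[of 2 q] q haver_bounds(1)[OF v_points[of 2] q] by (simp add: E_def del: form_diff)
  then have "\<theta> * form M (\<xi> 2) (q - x 0) \<le> \<theta> * (E + gver M r)" using th by (intro mult_left_mono) auto
  then have "E \<le> form M (\<xi> 1) (q - x 0) - \<theta> * form M (\<xi> 2) (q - x 0)" using m F1 by (simp add: E_def)
  moreover have "E * nx \<theta> \<le> E * 1" using E nx(5)[OF th] by (intro mult_left_mono) auto
  ultimately have "E \<le> (form M (\<xi> 1) (q - x 0) - \<theta> * form M (\<xi> 2) (q - x 0)) / nx \<theta>"
    using nx(6)[OF th] by (simp add: pos_le_divide_eq del: form_diff)
  then show ?thesis unfolding haver_P[OF th q] by (simp add: E_def)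
qed

text \<open>
  The slack \<open>\<Delta>\<close> is what the disk around \<open>x 1\<close> has at \<open>v 1\<close>. The disk around \<open>z s\<close> has slack at
  least \<open>s * \<Delta>\<close> there, so \<open>\<theta> = rate * s\<close> keeps \<open>P \<theta>\<close> inside, with \<open>2 * r\<close> as a bound for the
  distance from \<open>x 0\<close> to the centers.
\<close>
definition "\<Delta> = gver M r - gver M (R - \<tau>)"
definition "rate = \<Delta> / (gcos M r * gver M (2 * r) + gver M r)"

lemma Delta_pos: "0 < \<Delta>" using gver_rho_less by (simp add: \<Delta>_def)
lemma rate: "0 < rate" and rate_eq: "rate * (gcos M r * gver M (2 * r) + gver M r) = \<Delta>"
proof -
  have "0 < gcos M r * gver M (2 * r) + gver M r" using gver_r_pos Cr gver_nonneg[of M "2 * r"] by (simp add: add_nonneg_pos)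
  then show "0 < rate" and "rate * (gcos M r * gver M (2 * r) + gver M r) = \<Delta>" using Delta_pos by (simp_all add: rate_def)
qed

lemma haver_z_v1: assumes s: "0 \<le> s" "s \<le> 1" shows "haver M (z s) (v 1) \<le> gver M r - s * \<Delta>"
proof -
  define E where "E = gcos M r * haver M (v 0) (v 1)"
  have E: "0 \<le> E" using Cr haver_bounds(1)[OF v_points[of 0] v_points[of 1]] by (simp add: E_def)
  have "form M (\<eta> 1) (v 1 - v 0) = E + \<Delta>" "form M (\<eta> 2) (v 1 - v 0) = E"
    using form_eta_haver[of 1 "v 1"] form_eta_haver[of 2 "v 1"] v_points[of 1] haver_xv[of 2 1] haver_xv_same[of 1]
    by (simp_all add: E_def \<Delta>_def del: form_diff)
  then have "form M (\<zeta> s) (v 1 - v 0) = (E + s * \<Delta>) / N s" unfolding form_zeta by (simp add: algebra_simps)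
  moreover have "(E + s * \<Delta>) * N s \<le> (E + s * \<Delta>) * 1" using E s Delta_pos N(4)[OF s] by (intro mult_left_mono) auto
  ultimately have "E + s * \<Delta> \<le> form M (\<zeta> s) (v 1 - v 0)" using N(3)[OF s] by (simp add: pos_le_divide_eq del: form_diff)
  then show ?thesis using haver_z[OF s v_points[of 1]] by (simp add: E_def)
qed

lemma lengths_2r: "2 * r \<in> lengths M" using acute_add[OF r r] by simp

lemma haver_x0_center:
  assumes "q \<in> points M" "haver M q m \<le> gver M R" shows "haver M (x 0) q \<le> gver M (2 * r)"
proof -
  have "gdist M (x 0) m \<le> R" "gdist M q m \<le> R"
    using haver_x_center[of 0] gdist_le_iff[OF x_points[of 0] m_points acute_lengths[OF acute_R]] gdist_le_iff[OF assms(1) m_points acute_lengths[OF acute_R]] assms by auto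
  then have "gdist M (x 0) q \<le> 2 * r"
    using gdist_triangle[OF x_points[of 0] m_points assms(1)] gdist_commute[OF m_points assms(1)] R by simp
  then show ?thesis using gdist_le_iff[OF x_points[of 0] assms(1) lengths_2r] by simp
qed

lemma P_in_Ks: assumes s: "0 \<le> s" "s \<le> 1" "rate * s \<le> cos_xi" shows "P (rate * s) \<in> Ks s"
proof -
  have th: "0 \<le> rate * s" using rate s by simp
  have le: "haver M q (P (rate * s)) \<le> gver M r" if q: "q \<in> points M" "haver M q m \<le> gver M R" "haver M (v 1) q \<le> gver M r - s * \<Delta>" for q
  proof -
    have "rate * s * (gcos M r * haver M (x 0) q + gver M r) \<le> rate * s * (gcos M r * gver M (2 * r) + gver M r)"
      using haver_x0_center[OF q(1,2)] th Cr by (intro mult_left_mono add_right_mono) auto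
    also have "\<dots> = s * \<Delta>" using rate_eq by (simp add: mult_ac)
    finally have "haver M (P (rate * s)) q \<le> gver M r" using q by (intro haver_P_le[OF th s(3)]) auto
    then show ?thesis by (simp add: haver_commute)
  qed
  have "haver M (v 1) (x 1) \<le> gver M r - s * \<Delta>"
  proof -
    have "s * \<Delta> \<le> \<Delta>" using s Delta_pos by (simp add: mult_left_le_one_le)
    then show ?thesis using haver_xv_same[of 1] by (simp add: haver_commute[of M "v (Suc 0)"] \<Delta>_def)
  qed
  then have "haver M (x 1) (P (rate * s)) \<le> gver M r" using Ks_centers[OF s(1,2)] x_points[of 1] by (intro le) auto
  moreover have "haver M (z s) (P (rate * s)) \<le> gver M r"
    using Ks_centers[OF s(1,2)] z_points[OF s(1,2)] haver_z_v1[OF s(1,2)] by (intro le) (auto simp: haver_commute[of M "v (Suc 0)"])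
  moreover have "haver M (x 0) (P (rate * s)) \<le> gver M r" using haver_P_x0[OF th s(3)] by (simp add: haver_commute)
  ultimately show ?thesis using P_points[OF th s(3)] by (simp add: Ks_def common_def)
qed

text \<open>
  The distance from \<open>P \<theta>\<close> to \<open>v 2\<close> grows at a linear rate, since \<open>P \<theta>\<close> moves on the circle around
  \<open>x 0\<close> away from \<open>v 2\<close>.
\<close>
lemma haver_P_v2: assumes th: "0 \<le> \<theta>" "\<theta> \<le> cos_xi"
  shows "haver M (v 1) (v 2) + (gsin M r)\<^sup>2 * (1 - cos_xi\<^sup>2) * \<theta> \<le> haver M (P \<theta>) (v 2)"
proof -
  have f: "form M (\<xi> 1) (v 2 - x 0) = cos_xi * (gsin M r)\<^sup>2" "form M (\<xi> 2) (v 2 - x 0) = (gsin M r)\<^sup>2"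
    using form_xi_v[of 2 "\<xi> 1"] form_xi_v[of 2 "\<xi> 2"] xi(2)[of 1] xi(2,3)[of 2] cos_xi(1) by (simp_all del: form_diff)
  have "(cos_xi - \<theta>) / nx \<theta> \<le> (cos_xi - \<theta>) / (1 - \<theta> * cos_xi)"
    using nx[OF th] th by (intro divide_left_mono) auto
  also have "\<dots> \<le> cos_xi - \<theta> * (1 - cos_xi\<^sup>2)"
  proof -
    have "(cos_xi - \<theta> * (1 - cos_xi\<^sup>2)) * (1 - \<theta> * cos_xi) = cos_xi - \<theta> + \<theta>\<^sup>2 * cos_xi * (1 - cos_xi\<^sup>2)"
      by (simp add: power2_eq_square algebra_simps)
    moreover have "0 \<le> \<theta>\<^sup>2 * cos_xi * (1 - cos_xi\<^sup>2)" using cos_xi by (simp add: power_le_one)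
    ultimately show ?thesis using nx(2)[OF th] by (simp add: pos_divide_le_eq)
  qed
  finally have "(gsin M r)\<^sup>2 * ((cos_xi - \<theta>) / nx \<theta>) \<le> (gsin M r)\<^sup>2 * (cos_xi - \<theta> * (1 - cos_xi\<^sup>2))" by (intro mult_left_mono) auto
  moreover have "haver M (P \<theta>) (v 2) = gcos M r * haver M (x 0) (v 2) + gver M r - (gsin M r)\<^sup>2 * ((cos_xi - \<theta>) / nx \<theta>)"
    unfolding haver_P[OF th v_points[of 2, simplified]] f by (simp add: algebra_simps diff_divide_distrib)
  moreover have "haver M (v 1) (v 2) = gcos M r * haver M (x 0) (v 2) + gver M r - (gsin M r)\<^sup>2 * cos_xi"
    using haver_v_form_xi[of 1 "v 2"] v_points[of 2] f by (simp del: form_diff)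
  ultimately show ?thesis by (simp add: algebra_simps)
qed

lemma haver_P_v0: assumes th: "0 \<le> \<theta>" "\<theta> \<le> cos_xi"
  shows "haver M (v 1) (v 0) \<le> haver M (P \<theta>) (v 0)"
proof -
  define g where "g = gcos M r * haver M (x 0) (v 0) + gver M r - haver M (v 1) (v 0)"
  have f: "form M (\<xi> 1) (v 0 - x 0) = g" "form M (\<xi> 2) (v 0 - x 0) = g"
    using haver_v_form_xi[of 1 "v 0"] haver_v_form_xi[of 2 "v 0"] v_points[of 0] haver_vv[of 1 0] haver_vv[of 2 0]
    by (simp_all add: g_def del: form_diff)
  have "0 \<le> gcos M r * haver M (x 0) (v 0)" using Cr haver_bounds(1)[OF x_points[of 0] v_points[of 0]] by simp
  then have "0 \<le> g" using haver_vv_le[of 1 0] by (simp add: g_def)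
  then have "g * (1 - \<theta>) \<le> g * nx \<theta>" using nx(4)[OF th] by (intro mult_left_mono)
  then have "(g - \<theta> * g) / nx \<theta> \<le> g" using nx(6)[OF th] by (simp add: pos_divide_le_eq algebra_simps)
  then show ?thesis unfolding haver_P[OF th v_points[of 0, simplified]] f by (simp add: g_def)
qed

end

section \<open>Circumradius and Hausdorff distance\<close>

text \<open>
  In the Euclidean plane this is the inequality between the sum of squared distances from \<open>c\<close> and
  from the centroid. For curved planes it is the nonnegativity of the squared length of the
  component of \<open>a1 + a2 + a3\<close> tangent at \<open>c\<close>. Equality holds for a regular triangle with center
  \<open>c\<close>.
\<close>
lemma three_points:
  assumes c: "c \<in> points M" and a: "a1 \<in> points M" "a2 \<in> points M" "a3 \<in> points M"
    and X: "haver M c a1 + haver M c a2 + haver M c a3 = 3 * X"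
  shows "2 * (haver M a1 a2 + haver M a1 a3 + haver M a2 a3) \<le> 9 * (X * (2 - kappa M * X))"
proof -
  define s where "s = a1 + a2 + a3"
  define Q where "Q = haver M a1 a2 + haver M a1 a3 + haver M a2 a3"
  show ?thesis
  proof (cases "M = Euclidean")
    case True
    define d where "d = 3 *\<^sub>R c - s"
    have f: "form M w w \<ge> 0" for w using True by (simp add: form_def)
    have "form M d d = 18 * X - 2 * Q"
      using X True unfolding Q_def d_def s_def haver_def by (simp add: form_def field_simps)
    then show ?thesis using f[of d] True by (simp add: Q_def)
  next
    case False
    have ds: "dual M c s = 3 - 3 * kappa M * X"
      using X kappa_cases[OF False] by (auto simp: s_def dual_haver[OF c a(1)] dual_haver[OF c a(2)] dual_haver[OF c a(3)])
    have ss: "dual M s s = 9 - 2 * kappa M * Q"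
      using points_dual[OF a(1)] points_dual[OF a(2)] points_dual[OF a(3)]
      by (simp add: s_def Q_def dual_commute[of M a2 a1] dual_commute[of M a3 a1] dual_commute[of M a3 a2]
          dual_haver[OF a(1,2)] dual_haver[OF a(1,3)] dual_haver[OF a(2,3)] algebra_simps)
    \<comment> \<open>the tangential part of the sum is spacelike\<close>
    have "0 \<le> form M (s - dual M c s *\<^sub>R c) (s - dual M c s *\<^sub>R c)"
      using points_dual[OF c] by (intro tangent_form_nonneg[OF c]) simp
    also have "\<dots> = kappa M * (dual M s s - (dual M c s)\<^sup>2)"
    proof -
      have f: "form M v w = kappa M * dual M v w" for v w using dual_form[OF False, of v w] kappa_cases[OF False] by auto
      show ?thesis unfolding f using points_dual[OF c] by (simp add: dual_commute[of M s c] power2_eq_square algebra_simps)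
    qed
    finally have "0 \<le> kappa M * (9 - 2 * kappa M * Q - (3 - 3 * kappa M * X)\<^sup>2)" unfolding ds ss .
    then show ?thesis unfolding Q_def[symmetric] using kappa_cases[OF False] by (auto simp: power2_eq_square algebra_simps)
  qed
qed

lemma sup_inf_approx:
  assumes A: "A \<subseteq> points M" "a \<in> A" and B: "B \<subseteq> points M" "B \<noteq> {}" and bd: "\<And>a b. a \<in> A \<Longrightarrow> b \<in> B \<Longrightarrow> gdist M a b \<le> C" and e: "0 < e"
  obtains b where "b \<in> B" "gdist M a b < hausdorff_distance M A B + e"
proof -
  obtain b0 where b0: "b0 \<in> B" using B by auto
  have bb: "bdd_below (gdist M x ` B)" if "x \<in> A" for x
    using that A(1) B(1) gdist_nonneg by (intro bdd_belowI2[of _ 0]) blast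
  have "(INF b\<in>B. gdist M x b) \<le> C" if "x \<in> A" for x
    using cINF_lower[OF bb[OF that] b0] bd[OF that b0] by linarith
  then have "bdd_above ((\<lambda>a. INF b\<in>B. gdist M a b) ` A)" by (intro bdd_aboveI2) blast
  then have "(INF b\<in>B. gdist M a b) \<le> (SUP a\<in>A. INF b\<in>B. gdist M a b)" using A(2) by (rule cSUP_upper[rotated])
  also have "\<dots> \<le> hausdorff_distance M A B" by (simp add: hausdorff_distance_def)
  finally have "(INF b\<in>B. gdist M a b) < hausdorff_distance M A B + e" using e by simp
  then obtain b where "b \<in> B" "gdist M a b < hausdorff_distance M A B + e"
    using cINF_less_iff[OF B(2) bb[OF A(2)]] by blast
  then show thesis by (rule that)
qed

context regular_disk_triangle
begin

lemma m_in_T: "m \<in> T" using haver_xm m_points by (auto simp: T_eq intro: less_imp_le)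

lemma dist_Ks_m: assumes "0 \<le> s" "s \<le> 1" "t \<in> Ks s" shows "gdist M m t \<le> 2 * r"
proof -
  have t: "t \<in> points M" "haver M (x 0) t \<le> gver M r" using assms(3) by (auto simp: Ks_def common_def)
  have "gdist M (x 0) m \<le> r" "gdist M (x 0) t \<le> r"
    using haver_xm[of 0] t gdist_le_iff[OF x_points[of 0] m_points acute_lengths[OF r]] gdist_le_iff[OF x_points[of 0] t(1) acute_lengths[OF r]] by auto
  then show ?thesis using gdist_triangle[OF m_points x_points[of 0] t(1)] gdist_commute[OF m_points x_points[of 0]] by simp
qed

text \<open>
  The mean value theorem; the constant is the larger of the derivatives of \<open>gsin\<close> at \<open>0\<close> and at
  \<open>r\<close>.
\<close>
lemma gsin_diff_le: assumes "0 \<le> h" "\<tau> + h \<le> r"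
  shows "gsin M (\<tau> + h) - gsin M \<tau> \<le> max 1 (gcos M r) * h"
proof (cases M)
  case Euclidean then show ?thesis by simp
next
  case Spherical
  show ?thesis
  proof (cases "h = 0")
    case False
    then have "\<tau> < \<tau> + h" using assms by simp
    then obtain y where y: "sin (\<tau> + h) - sin \<tau> = (\<tau> + h - \<tau>) * cos y"
      using MVT2[of \<tau> "\<tau> + h" sin cos] by (auto intro!: derivative_eq_intros)
    have "h * cos y \<le> h * max 1 (cos r)" using assms by (intro mult_left_mono) (auto simp: le_max_iff_disj)
    then show ?thesis using y Spherical by (simp add: mult.commute)
  qed simp
next
  case Hyperbolic
  show ?thesis
  proof (cases "h = 0")
    case False
    then have "\<tau> < \<tau> + h" using assms by simp
    then obtain y where y: "\<tau> < y" "y < \<tau> + h" "sinh (\<tau> + h) - sinh \<tau> = (\<tau> + h - \<tau>) * cosh y"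
      using MVT2[of \<tau> "\<tau> + h" sinh cosh] has_field_derivative_sinh[OF DERIV_ident] by auto
    then have "cosh y \<le> cosh r" using assms tau by (simp add: cosh_real_nonneg_le_iff)
    then have "h * cosh y \<le> h * max 1 (cosh r)" using assms by (intro mult_left_mono) auto
    then show ?thesis using y Hyperbolic by (simp add: mult.commute)
  qed simp
qed

text \<open>
  A disk containing \<open>v 0\<close>, \<open>v 2\<close> and \<open>P \<theta>\<close> is larger than the disk of radius \<open>\<tau>\<close>, the circumdisk
  of the regular triangle of vertices, by an amount linear in \<open>\<theta>\<close>: compared with the vertices, one
  mutual distance has increased at a linear rate and no other has decreased.
\<close>
lemma circumradius_growth:
  assumes th: "0 \<le> \<theta>" "\<theta> \<le> cos_xi" and c: "c \<in> points M" and W: "acute M W"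
    and le: "haver M c (v 0) \<le> gver M W" "haver M c (v 2) \<le> gver M W" "haver M c (P \<theta>) \<le> gver M W"
  shows "9 * (gsin M \<tau>)\<^sup>2 + 2 * ((gsin M r)\<^sup>2 * (1 - cos_xi\<^sup>2) * \<theta>) \<le> 9 * (gsin M W)\<^sup>2"
proof -
  have pts: "v 0 \<in> points M" "v 2 \<in> points M" "P \<theta> \<in> points M" using v_points P_points[OF th] by auto
  define X where "X = (haver M c (v 0) + haver M c (v 2) + haver M c (P \<theta>)) / 3"
  have X: "0 \<le> X" "X \<le> gver M W" using le haver_bounds(1)[OF c] pts by (auto simp: X_def)
  have tp: "2 * (haver M (v 0) (v 2) + haver M (v 0) (P \<theta>) + haver M (v 2) (P \<theta>)) \<le> 9 * (X * (2 - kappa M * X))"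
    by (rule three_points[OF c pts]) (simp add: X_def)
  have "X * (2 - kappa M * X) \<le> gver M W * (2 - kappa M * gver M W)"
  proof -
    have "0 < 1 - kappa M * gver M W" using gcos_pos[OF W] by (simp add: gcos_gver)
    then have "0 \<le> (gver M W - X) * (2 - kappa M * (gver M W + X))"
      using X by (intro mult_nonneg_nonneg) (cases M; simp)+
    then show ?thesis by (simp add: algebra_simps)
  qed
  also have "\<dots> = (gsin M W)\<^sup>2" by (simp add: gsin_squared gcos_gver)
  finally have XW: "X * (2 - kappa M * X) \<le> (gsin M W)\<^sup>2" .
  have vv: "2 * (3 * haver M (v 1) (v 2)) = 9 * (gsin M \<tau>)\<^sup>2"
    using haver_vv[of 1 2] gsin_squared[of M \<tau>] by (simp add: power2_eq_square algebra_simps)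
  have e1: "haver M (v 0) (v 2) = haver M (v 1) (v 2)" "haver M (v 1) (v 0) = haver M (v 1) (v 2)"
    using haver_vv[of 0 2] haver_vv[of 1 2] haver_vv[of 1 0] by simp_all
  show ?thesis
  proof -
    define A B where "A = (gsin M r)\<^sup>2 * (1 - cos_xi\<^sup>2) * \<theta>" "B = X * (2 - kappa M * X)"
    have "haver M (v 1) (v 2) + A \<le> haver M (v 2) (P \<theta>)" "haver M (v 1) (v 2) \<le> haver M (v 0) (P \<theta>)"
      using haver_P_v2[OF th] haver_P_v0[OF th] e1(2) by (simp_all add: A_B_def haver_commute[of M "P \<theta>"])
    then show ?thesis using tp XW vv e1(1) unfolding A_B_def[symmetric] by simp
  qed
qed

text \<open>
  If \<open>h\<close> is the Hausdorff distance, the disk of radius \<open>\<tau> + h\<close> around the image of \<open>m\<close> contains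
  \<open>Ks s\<close>; then \<open>circumradius_growth\<close> bounds \<open>h\<close> from below. The constant is a minimum because \<open>\<tau> +
  h\<close> may exceed \<open>r\<close>, the range in which \<open>gsin\<close> is under control; in that case \<open>h\<close> is at least \<open>r -
  \<tau>\<close> already.
\<close>
lemma Hausdorff_bound:
  "\<exists>c>0. \<forall>s \<phi>. 0 \<le> s \<and> s \<le> 1 / 2 \<and> rate * s \<le> cos_xi \<and> isometry_of M \<phi> \<longrightarrow> c * s \<le> hausdorff_distance M (Ks s) (\<phi> ` T)"
proof -
  define L where "L = max 1 (gcos M r)"
  have L: "1 \<le> L" by (simp add: L_def)
  define c0 where "c0 = (gsin M r)\<^sup>2 * (1 - cos_xi\<^sup>2) * rate"
  have c0: "0 < c0"
  proof -
    have "cos_xi\<^sup>2 < 1" using cos_xi by (simp add: abs_square_less_1)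
    then show ?thesis using Sr rate by (simp add: c0_def)
  qed
  define c where "c = min (r - \<tau>) (c0 / (9 * gsin M r * L))"
  have c: "0 < c" using tau R c0 Sr L by (simp add: c_def)
  have "c * s \<le> hausdorff_distance M (Ks s) (\<phi> ` T)"
    if s: "0 \<le> s" "s \<le> 1 / 2" "rate * s \<le> cos_xi" and phi: "isometry_of M \<phi>" for s \<phi>
  proof -
    define h where "h = hausdorff_distance M (Ks s) (\<phi> ` T)"
    have s1: "s \<le> 1" using s by simp
    have th: "0 \<le> rate * s" using rate s by simp
    have TP: "T \<subseteq> points M" and KP: "Ks s \<subseteq> points M" by (auto simp: T_eq Ks_def common_def)
    have phiP: "\<phi> y \<in> points M" if "y \<in> points M" for y using phi that by (auto simp: isometry_of_def bij_betw_def)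
    have iso: "gdist M (\<phi> y) (\<phi> y') = gdist M y y'" if "y \<in> points M" "y' \<in> points M" for y y'
      using phi that by (simp add: isometry_of_def)
    have B: "\<phi> ` T \<subseteq> points M" "\<phi> ` T \<noteq> {}" using TP phiP m_in_T by auto
    have bd: "gdist M a b \<le> 2 * r + gdist M m (\<phi> m) + \<tau>" if ab: "a \<in> Ks s" "b \<in> \<phi> ` T" for a b
    proof -
      obtain t where t: "t \<in> T" "b = \<phi> t" using ab by auto
      have P: "a \<in> points M" "t \<in> points M" "\<phi> m \<in> points M" "b \<in> points M" using ab t KP TP phiP m_points by auto
      have "gdist M a b \<le> gdist M a m + gdist M m b" by (rule gdist_triangle[OF P(1) m_points P(4)])
      moreover have "gdist M m b \<le> gdist M m (\<phi> m) + gdist M (\<phi> m) b" by (rule gdist_triangle[OF m_points P(3,4)])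
      moreover have "gdist M (\<phi> m) b \<le> \<tau>" using iso[OF m_points P(2)] T_in_circumdisk[OF t(1)] t(2) by simp
      moreover have "gdist M a m \<le> 2 * r" using dist_Ks_m[OF s(1) s1 ab(1)] gdist_commute[OF P(1) m_points] by simp
      ultimately show ?thesis by linarith
    qed
    have near: "gdist M (\<phi> m) a \<le> \<tau> + h" if a: "a \<in> Ks s" for a
    proof (rule field_le_epsilon)
      fix e :: real assume "0 < e"
      obtain b where b: "b \<in> \<phi> ` T" "gdist M a b < h + e"
        using sup_inf_approx[OF KP a B bd \<open>0 < e\<close>] unfolding h_def by blast
      obtain t where t: "t \<in> T" "b = \<phi> t" using b by auto
      have P: "a \<in> points M" "t \<in> points M" "\<phi> m \<in> points M" "b \<in> points M" using a t KP TP phiP m_points by auto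
      have "gdist M (\<phi> m) a \<le> gdist M (\<phi> m) b + gdist M b a" by (rule gdist_triangle[OF P(3,4,1)])
      moreover have "gdist M (\<phi> m) b \<le> \<tau>" using iso[OF m_points P(2)] T_in_circumdisk[OF t(1)] t(2) by simp
      moreover have "gdist M b a < h + e" using b gdist_commute[OF P(1,4)] by simp
      ultimately show "gdist M (\<phi> m) a \<le> \<tau> + h + e" by linarith
    qed
    show ?thesis
    proof (cases "\<tau> + h \<le> r")
      case False
      have "c * s \<le> (r - \<tau>) * 1" using s tau R by (intro mult_mono) (auto simp: c_def)
      then show ?thesis using False by (simp add: h_def)
    next
      case True
      define W where "W = \<tau> + h"
      have "0 \<le> gdist M (\<phi> m) (v 0)" using gdist_nonneg phiP[OF m_points] v_points[of 0] by simp
      then have W0: "0 \<le> W" using near[of "v 0"] T_subset_Ks[OF s(1) s1] v_in_T[of 0] by (force simp: W_def)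
      have acW: "acute M W" using W0 True by (intro acute_mono[OF r]) (auto simp: W_def)
      have vK: "v 0 \<in> Ks s" "v 2 \<in> Ks s" "P (rate * s) \<in> Ks s"
        using T_subset_Ks[OF s(1) s1] v_in_T P_in_Ks[OF s(1) s1 s(3)] by auto
      have cP: "\<phi> m \<in> points M" using phiP[OF m_points] .
      have VW: "haver M (\<phi> m) a \<le> gver M W" if "a \<in> Ks s" for a
        using near[OF that] gdist_le_iff[OF cP _ acute_lengths[OF acW]] that KP by (auto simp: W_def)
      have main: "9 * (gsin M \<tau>)\<^sup>2 + 2 * c0 * s \<le> 9 * (gsin M W)\<^sup>2"
        using circumradius_growth[OF th s(3) cP acW VW[OF vK(1)] VW[OF vK(2)] VW[OF vK(3)]] by (simp add: c0_def mult_ac)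
      have h0: "0 \<le> h"
      proof (rule ccontr)
        assume "\<not> 0 \<le> h"
        then have "W < \<tau>" by (simp add: W_def)
        then have "gsin M W < gsin M \<tau>" using gsin_strict_mono[OF acute_tau W0] by blast
        then have "(gsin M W)\<^sup>2 < (gsin M \<tau>)\<^sup>2" using gsin_nonneg[OF acute_lengths[OF acW]] by (intro power_strict_mono) auto
        then show False using main c0 s by (smt (verit) mult_nonneg_nonneg)
      qed
      have d: "gsin M W - gsin M \<tau> \<le> L * h" unfolding W_def L_def using gsin_diff_le[OF h0 True] .
      have le: "gsin M W \<le> gsin M r" "gsin M \<tau> \<le> gsin M r" "0 \<le> gsin M W"
        using gsin_mono[OF r W0] gsin_mono[OF r, of \<tau>] True tau R gsin_nonneg[OF acute_lengths[OF acW]] by (auto simp: W_def)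
      have "2 * c0 * s \<le> 9 * ((gsin M W - gsin M \<tau>) * (gsin M W + gsin M \<tau>))"
        using main by (simp add: power2_eq_square algebra_simps)
      also have "\<dots> \<le> 9 * ((L * h) * (2 * gsin M r))"
        using d le St h0 L by (intro mult_left_mono mult_mono) auto
      finally have "c0 * s \<le> 9 * gsin M r * L * h" by (simp add: mult_ac)
      then have "c0 / (9 * gsin M r * L) * s \<le> h" using Sr L by (simp add: field_simps)
      moreover have "c * s \<le> c0 / (9 * gsin M r * L) * s" using s by (intro mult_right_mono) (auto simp: c_def)
      ultimately show ?thesis by (simp add: h_def)
    qed
  qed
  then show ?thesis using c by blast
qed

text \<open>
  Otherwise \<open>v 0\<close>, \<open>v 2\<close> and \<open>P\<close> would lie in the circumdisk of \<open>T\<close>, whose radius is \<open>\<tau>\<close>.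
\<close>
lemma P_notin_T: assumes s: "0 < s" "s \<le> 1" "rate * s \<le> cos_xi" shows "P (rate * s) \<notin> T"
proof
  assume PT: "P (rate * s) \<in> T"
  have th: "0 \<le> rate * s" using rate s by simp
  have le: "haver M m t \<le> gver M \<tau>" if "t \<in> T" for t
    using T_in_circumdisk[OF that] gdist_le_iff[OF m_points _ acute_lengths[OF acute_tau]] that by (auto simp: T_eq)
  have "cos_xi\<^sup>2 < 1" using cos_xi by (simp add: abs_square_less_1)
  then have "0 < (gsin M r)\<^sup>2 * (1 - cos_xi\<^sup>2) * (rate * s)" using Sr rate s by simp
  moreover have "9 * (gsin M \<tau>)\<^sup>2 + 2 * ((gsin M r)\<^sup>2 * (1 - cos_xi\<^sup>2) * (rate * s)) \<le> 9 * (gsin M \<tau>)\<^sup>2"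
    using v_in_T[of 0] v_in_T[of 2] PT by (intro circumradius_growth[OF th s(3) m_points acute_tau] le) auto
  ultimately show False by linarith
qed

end

section \<open>Area as the volume of a cone\<close>

text \<open>
  The apex \<open>0\<close> is left out, so that cones over disjoint subsets of the plane are disjoint.
\<close>
definition cone_over :: "(real^3) set \<Rightarrow> (real^3) set" where
  "cone_over A = {h *\<^sub>R t | h t. 0 < h \<and> h \<le> 1 \<and> t \<in> A}"

definition proj :: "real^3 \<Rightarrow> real^2" where "proj y = vector [y $ 1, y $ 2]"

lemma proj_nth [simp]: "proj y $ 1 = y $ 1" "proj y $ 2 = y $ 2" by (simp_all add: proj_def)
lemma proj_lift [simp]: "proj (lift p h) = p" by (simp add: vec_eq_iff forall_2)
lemma lift_proj [simp]: "lift (proj y) (y $ 3) = y" by (simp add: vec_eq_iff forall_3)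
lemma linear_proj: "linear proj" by (auto simp: linear_iff vec_eq_iff forall_2)
lemma bounded_linear_proj: "bounded_linear proj" by (simp add: linear_proj linear_conv_bounded_linear[symmetric])

lemma continuous_on_lift [continuous_intros]:
  "continuous_on S f \<Longrightarrow> continuous_on S g \<Longrightarrow> continuous_on S (\<lambda>x. lift (f x) (g x))"
proof -
  assume *: "continuous_on S f" "continuous_on S g"
  have "lift p h = p $ 1 *\<^sub>R axis 1 1 + p $ 2 *\<^sub>R axis 2 1 + h *\<^sub>R axis 3 1" for p h
    by (simp add: vec_eq_iff forall_3 axis_def)
  then show ?thesis using * by (simp only:) (intro continuous_intros)
qed

lemma Basis_3: "(Basis :: (real^3) set) = {axis 1 1, axis 2 1, axis 3 1}"
  by (auto simp: Basis_vec_def UNIV_3)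
lemma Basis_2: "(Basis :: (real^2) set) = {axis 1 1, axis 2 1}"
  by (auto simp: Basis_vec_def UNIV_2)
lemma axis_neq: "axis (1::3) (1::real) \<noteq> axis 2 1" "axis (1::3) (1::real) \<noteq> axis 3 1" "axis (2::3) (1::real) \<noteq> axis 3 1"
  "axis (1::2) (1::real) \<noteq> axis 2 1"
  by (simp_all add: axis_eq_axis)

text \<open>
  Lebesgue measure on \<open>real^3\<close> as a product, in the form needed for Fubini's theorem.
\<close>
lemma distr_lift: "distr (lborel \<Otimes>\<^sub>M lborel) borel (\<lambda>(p::real^2, h::real). lift p h) = lborel"
proof (rule lborel_eqI[symmetric])
  have m: "(\<lambda>(p::real^2, h::real). lift p h) \<in> borel_measurable (lborel \<Otimes>\<^sub>M lborel)"
    unfolding lborel_prod measurable_lborel2 case_prod_beta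
    by (intro borel_measurable_continuous_onI continuous_intros)
  fix l u :: "real^3" assume lu: "\<And>b. b \<in> Basis \<Longrightarrow> l \<bullet> b \<le> u \<bullet> b"
  have lu': "l $ 1 \<le> u $ 1" "l $ 2 \<le> u $ 2" "l $ 3 \<le> u $ 3"
    using lu[of "axis 1 1"] lu[of "axis 2 1"] lu[of "axis 3 1"] by (auto simp: Basis_3 inner_axis)
  have vi: "(\<lambda>(p::real^2, h::real). lift p h) -` box l u \<inter> space (lborel \<Otimes>\<^sub>M lborel) = box (proj l) (proj u) \<times> {l $ 3<..<u $ 3}"
    by (auto simp: mem_box_cart forall_2 forall_3 space_pair_measure)
  have "emeasure (distr (lborel \<Otimes>\<^sub>M lborel) borel (\<lambda>(p::real^2, h::real). lift p h)) (box l u)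
     = emeasure (lborel \<Otimes>\<^sub>M lborel) (box (proj l) (proj u) \<times> {l $ 3<..<u $ 3})"
    using m by (subst emeasure_distr) (simp_all only: vi, simp_all)
  also have "\<dots> = emeasure lborel (box (proj l) (proj u)) * emeasure lborel {l $ 3<..<u $ 3}"
    by (rule lborel.emeasure_pair_measure_Times) auto
  also have "emeasure lborel (box (proj l) (proj u)) = ennreal ((u $ 1 - l $ 1) * (u $ 2 - l $ 2))"
    using lu' axis_neq(4) by (subst emeasure_lborel_box) (auto simp: Basis_2 inner_axis)
  also have "emeasure lborel {l $ 3<..<u $ 3} = ennreal (u $ 3 - l $ 3)" using lu' by simp
  also have "ennreal ((u $ 1 - l $ 1) * (u $ 2 - l $ 2)) * ennreal (u $ 3 - l $ 3) = ennreal (\<Prod>b\<in>Basis. (u - l) \<bullet> b)"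
    using lu' axis_neq(1-3) by (simp add: Basis_3 inner_axis ennreal_mult[symmetric] mult.assoc)
  finally show "emeasure (distr (lborel \<Otimes>\<^sub>M lborel) borel (\<lambda>(p::real^2, h::real). lift p h)) (box l u) = ennreal (\<Prod>b\<in>Basis. (u - l) \<bullet> b)" .
qed simp

text \<open>
  The third coordinate of the point above \<open>p\<close>, where the sign \<open>\<sigma>\<close> selects the sheet; only the
  sphere has two sheets.
\<close>
definition chart :: "geometry \<Rightarrow> real \<Rightarrow> real^2 \<Rightarrow> real" where
  "chart M \<sigma> p = \<sigma> * sqrt (1 - kappa M * (norm p)\<^sup>2)"

lemma norm_squared_2: "(norm (p :: real^2))\<^sup>2 = (p $ 1)\<^sup>2 + (p $ 2)\<^sup>2"
  by (simp only: power2_norm_eq_inner) (simp add: inner_vec_def sum_2 power2_eq_square)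

lemma chart_derivative:
  assumes s: "\<sigma>\<^sup>2 = 1" and p: "kappa M * (norm p)\<^sup>2 < 1"
  shows "(chart M \<sigma> has_derivative (\<lambda>v. - (kappa M * (p \<bullet> v)) / chart M \<sigma> p)) (at p)"
proof -
  have q: "0 < 1 - kappa M * (norm p)\<^sup>2" using p by simp
  have "((\<lambda>p. \<sigma> * sqrt (1 - kappa M * (p \<bullet> p))) has_derivative (\<lambda>v. \<sigma> * (- (kappa M * (p \<bullet> v + v \<bullet> p)) * (inverse (sqrt (1 - kappa M * (p \<bullet> p))) / 2)))) (at p)"
    using q unfolding power2_norm_eq_inner by (auto intro!: derivative_eq_intros simp: fun_eq_iff field_simps)
  moreover have "\<sigma> * (- (kappa M * (p \<bullet> v + v \<bullet> p)) * (inverse (sqrt (1 - kappa M * (p \<bullet> p))) / 2)) = - (kappa M * (p \<bullet> v)) / chart M \<sigma> p" for v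
  proof -
    have "\<sigma> = 1 \<or> \<sigma> = -1" using s by (simp add: power2_eq_1_iff)
    then show ?thesis using q unfolding chart_def power2_norm_eq_inner by (auto simp: inner_commute[of v p] field_simps)
  qed
  ultimately show ?thesis unfolding chart_def[abs_def] power2_norm_eq_inner chart_def by simp
qed

lemma chart_square: "\<sigma>\<^sup>2 = 1 \<Longrightarrow> kappa M * (norm p)\<^sup>2 \<le> 1 \<Longrightarrow> (chart M \<sigma> p)\<^sup>2 = 1 - kappa M * (norm p)\<^sup>2"
  by (simp add: chart_def power_mult_distrib)

text \<open>
  A point \<open>lift p h\<close> is sent to \<open>h\<close> times the point of the plane above \<open>p\<close>, which parametrizes the
  cone.
\<close>
definition cone_map :: "geometry \<Rightarrow> real \<Rightarrow> real^3 \<Rightarrow> real^3" where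
  "cone_map M \<sigma> y = y $ 3 *\<^sub>R lift (proj y) (chart M \<sigma> (proj y))"

lemma continuous_on_chart: "continuous_on S (chart M \<sigma>)"
  unfolding chart_def by (intro continuous_intros)

text \<open>
  The absolute value of the Jacobian determinant of \<open>cone_map\<close> at \<open>lift p h\<close> is \<open>h\<^sup>2\<close> times the
  area density \<open>1 / sqrt (1 - kappa M * (norm p)\<^sup>2)\<close>. Integrating over \<open>h\<close> in the unit interval
  gives the factor \<open>1 / 3\<close>.
\<close>
lemma cone_volume:
  assumes s: "\<sigma>\<^sup>2 = 1" and U: "U \<in> sets borel" and Up: "\<And>p. p \<in> U \<Longrightarrow> kappa M * (norm p)\<^sup>2 < 1"
    and lm: "cone_over ((\<lambda>p. lift p (chart M \<sigma> p)) ` U) \<in> lmeasurable"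
  shows "(LINT p:U|lebesgue. 1 / sqrt (1 - kappa M * (norm p)\<^sup>2)) = 3 * measure lebesgue (cone_over ((\<lambda>p. lift p (chart M \<sigma> p)) ` U))"
proof -
  let ?f = "chart M \<sigma>"
  define S where "S = {y :: real^3. proj y \<in> U \<and> y $ 3 \<in> {0<..1}}"
  have prm: "proj \<in> borel_measurable borel"
    by (intro borel_measurable_continuous_onI linear_continuous_on bounded_linear_proj)
  have n3: "(\<lambda>y::real^3. y $ 3) \<in> borel_measurable borel" by (intro borel_measurable_continuous_onI continuous_intros)
  have Sb: "S \<in> sets borel"
  proof -
    have "S = (proj -` U \<inter> space borel) \<inter> ((\<lambda>y. y $ 3) -` {0<..1} \<inter> space borel)" by (auto simp: S_def)
    then show ?thesis using measurable_sets[OF prm U] measurable_sets[OF n3, of "{0<..1}"] by auto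
  qed
  then have Sl: "S \<in> sets lebesgue" by simp
  have fnz: "?f p \<noteq> 0" if "p \<in> U" for p
    using Up[OF that] s by (auto simp: chart_def)
  define D where "D y v = lift (y $ 3 *\<^sub>R proj v + v $ 3 *\<^sub>R proj y) (y $ 3 * (- (kappa M * (proj y \<bullet> proj v)) / ?f (proj y)) + v $ 3 * ?f (proj y))" for y v :: "real^3"
  have der: "(cone_map M \<sigma> has_derivative D y) (at y within S)" if y: "y \<in> S" for y
  proof -
    have 1: "((\<lambda>y. ?f (proj y)) has_derivative (\<lambda>v. - (kappa M * (proj y \<bullet> proj v)) / ?f (proj y))) (at y)"
    proof -
      have "(proj has_derivative proj) (at y)" by (rule bounded_linear_imp_has_derivative[OF bounded_linear_proj])
      moreover have "(?f has_derivative (\<lambda>v. - (kappa M * (proj y \<bullet> v)) / ?f (proj y))) (at (proj y))"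
        by (rule chart_derivative[OF s Up]) (use y in \<open>simp add: S_def\<close>)
      ultimately show ?thesis by (rule has_derivative_compose)
    qed
    have nth: "((\<lambda>y::real^3. y $ k) has_derivative (\<lambda>v. v $ k)) (at y)" for k
      by (rule bounded_linear_imp_has_derivative[OF bounded_linear_vec_nth])
    have lift_eq: "lift p h = p $ 1 *\<^sub>R axis 1 1 + p $ 2 *\<^sub>R axis 2 1 + h *\<^sub>R axis 3 1" for p h
      by (simp add: vec_eq_iff forall_3 axis_def)
    have "((\<lambda>y. (y $ 3 * y $ 1) *\<^sub>R axis 1 1 + (y $ 3 * y $ 2) *\<^sub>R axis 2 1 + (y $ 3 * ?f (proj y)) *\<^sub>R (axis 3 1 :: real^3)) has_derivative
      (\<lambda>v. (y $ 3 * v $ 1 + v $ 3 * y $ 1) *\<^sub>R axis 1 1 + (y $ 3 * v $ 2 + v $ 3 * y $ 2) *\<^sub>R axis 2 1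
        + (y $ 3 * (- (kappa M * (proj y \<bullet> proj v)) / ?f (proj y)) + v $ 3 * ?f (proj y)) *\<^sub>R axis 3 1)) (at y)"
      by (intro has_derivative_add has_derivative_scaleR_left has_derivative_mult nth 1)
    moreover have "cone_map M \<sigma> = (\<lambda>y. (y $ 3 * y $ 1) *\<^sub>R axis 1 1 + (y $ 3 * y $ 2) *\<^sub>R axis 2 1 + (y $ 3 * ?f (proj y)) *\<^sub>R axis 3 1)"
      by (auto simp: fun_eq_iff cone_map_def lift_eq scaleR_right_distrib)
    moreover have "D y = (\<lambda>v. (y $ 3 * v $ 1 + v $ 3 * y $ 1) *\<^sub>R axis 1 1 + (y $ 3 * v $ 2 + v $ 3 * y $ 2) *\<^sub>R axis 2 1
        + (y $ 3 * (- (kappa M * (proj y \<bullet> proj v)) / ?f (proj y)) + v $ 3 * ?f (proj y)) *\<^sub>R axis 3 1)"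
      by (auto simp: fun_eq_iff D_def lift_eq)
    ultimately have "(cone_map M \<sigma> has_derivative D y) (at y)" by simp
    then show ?thesis by (rule has_derivative_at_withinI)
  qed
  have det: "\<bar>det (matrix (D y))\<bar> = (y $ 3)\<^sup>2 / sqrt (1 - kappa M * (norm (proj y))\<^sup>2)" if y: "y \<in> S" for y
  proof -
    have U': "proj y \<in> U" using y by (simp add: S_def)
    have f2: "(?f (proj y))\<^sup>2 = 1 - kappa M * ((y $ 1)\<^sup>2 + (y $ 2)\<^sup>2)" using chart_square[OF s, of M "proj y"] Up[OF U'] by (simp add: norm_squared_2)
    have in2: "p \<bullet> q = p $ 1 * q $ 1 + p $ 2 * q $ 2" for p q :: "real^2" by (simp add: inner_vec_def sum_2)
    have "det (matrix (D y)) = (y $ 3)\<^sup>2 * (((?f (proj y))\<^sup>2 + kappa M * ((y $ 1)\<^sup>2 + (y $ 2)\<^sup>2)) / ?f (proj y))"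
      using fnz[OF U'] by (simp add: det_3 matrix_def D_def axis_def in2 field_simps power2_eq_square)
    also have "\<dots> = (y $ 3)\<^sup>2 / ?f (proj y)" unfolding f2 by simp
    finally have "\<bar>det (matrix (D y))\<bar> = (y $ 3)\<^sup>2 / \<bar>?f (proj y)\<bar>" by (simp add: abs_divide)
    moreover have "\<bar>?f (proj y)\<bar> = sqrt (1 - kappa M * (norm (proj y))\<^sup>2)"
      using s Up[OF U'] by (auto simp: chart_def abs_mult power2_eq_1_iff)
    ultimately show ?thesis by simp
  qed
  have inj: "inj_on (cone_map M \<sigma>) S"
  proof (rule inj_onI)
    fix y w assume yw: "y \<in> S" "w \<in> S" "cone_map M \<sigma> y = cone_map M \<sigma> w"
    have N: "(cone_map M \<sigma> y $ 3)\<^sup>2 + kappa M * ((cone_map M \<sigma> y $ 1)\<^sup>2 + (cone_map M \<sigma> y $ 2)\<^sup>2) = (y $ 3)\<^sup>2" if "y \<in> S" for y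
    proof -
      have "kappa M * (norm (proj y))\<^sup>2 \<le> 1" using Up[of "proj y"] that by (simp add: S_def)
      then have f2: "(?f (proj y))\<^sup>2 = 1 - kappa M * ((y $ 1)\<^sup>2 + (y $ 2)\<^sup>2)" using chart_square[OF s, of M "proj y"] by (simp add: norm_squared_2)
      show ?thesis by (simp add: cone_map_def power_mult_distrib f2 algebra_simps)
    qed
    have "(y $ 3)\<^sup>2 = (w $ 3)\<^sup>2" using N[OF yw(1)] N[OF yw(2)] yw(3) by simp
    then have 3: "y $ 3 = w $ 3" using yw by (simp add: S_def)
    have "cone_map M \<sigma> y $ 1 = cone_map M \<sigma> w $ 1" "cone_map M \<sigma> y $ 2 = cone_map M \<sigma> w $ 2" using yw(3) by simp_all
    then show "y = w" using 3 yw(1) by (simp add: cone_map_def S_def vec_eq_iff forall_3)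
  qed
  have img: "cone_map M \<sigma> ` S = cone_over ((\<lambda>p. lift p (?f p)) ` U)"
  proof
    show "cone_map M \<sigma> ` S \<subseteq> cone_over ((\<lambda>p. lift p (?f p)) ` U)"
      by (auto simp: cone_over_def cone_map_def S_def)
    show "cone_over ((\<lambda>p. lift p (?f p)) ` U) \<subseteq> cone_map M \<sigma> ` S"
    proof
      fix y assume "y \<in> cone_over ((\<lambda>p. lift p (?f p)) ` U)"
      then obtain h p where hp: "0 < h" "h \<le> 1" "p \<in> U" "y = h *\<^sub>R lift p (?f p)" by (auto simp: cone_over_def)
      then show "y \<in> cone_map M \<sigma> ` S" by (intro image_eqI[of _ _ "lift p h"]) (auto simp: cone_map_def S_def)
    qed
  qed
  define m where "m = measure lebesgue (cone_over ((\<lambda>p. lift p (?f p)) ` U))"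
  define F where "F y = indicat_real S y * ((y $ 3)\<^sup>2 / sqrt (1 - kappa M * (norm (proj y))\<^sup>2))" for y :: "real^3"
  have "((\<lambda>y. \<bar>det (matrix (D y))\<bar>) has_integral m) S"
    using has_measure_differentiable_image[OF Sl der inj, of m] lm unfolding img m_def by simp
  then have hi: "((\<lambda>y. (y $ 3)\<^sup>2 / sqrt (1 - kappa M * (norm (proj y))\<^sup>2)) has_integral m) S"
    using det by (subst has_integral_cong[symmetric]) auto
  have ai: "(\<lambda>y. (y $ 3)\<^sup>2 / sqrt (1 - kappa M * (norm (proj y))\<^sup>2)) absolutely_integrable_on S"
    using hi Up by (intro nonnegative_absolutely_integrable_1) (auto simp: S_def intro!: divide_nonneg_nonneg less_imp_le)
  have Fm: "F \<in> borel_measurable borel"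
  proof -
    have "(\<lambda>y. sqrt (1 - kappa M * (norm (proj y))\<^sup>2)) \<in> borel_measurable borel"
      by (intro borel_measurable_continuous_onI continuous_intros linear_continuous_on bounded_linear_proj)
    moreover have "(\<lambda>y::real^3. (y $ 3)\<^sup>2) \<in> borel_measurable borel" by (intro borel_measurable_continuous_onI continuous_intros)
    ultimately show ?thesis unfolding F_def using Sb by measurable
  qed
  have intF: "integrable lebesgue F" "integral\<^sup>L lebesgue F = m"
  proof -
    show "integrable lebesgue F" using ai by (simp add: set_integrable_def F_def[abs_def])
    have "integral\<^sup>L lebesgue F = integral S (\<lambda>y. (y $ 3)\<^sup>2 / sqrt (1 - kappa M * (norm (proj y))\<^sup>2))"
      using set_lebesgue_integral_eq_integral(2)[OF ai] by (simp add: set_lebesgue_integral_def F_def[abs_def])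
    also have "\<dots> = m" using hi by (rule integral_unique)
    finally show "integral\<^sup>L lebesgue F = m" .
  qed
  then have intL: "integrable lborel F" "integral\<^sup>L lborel F = m"
    using Fm by (simp_all add: integrable_completion integral_completion)
  let ?P = "lborel \<Otimes>\<^sub>M lborel :: ((real^2) \<times> real) measure"
  have lm': "(\<lambda>(p::real^2, h::real). lift p h) \<in> measurable ?P borel"
    unfolding lborel_prod measurable_lborel2 case_prod_beta by (intro borel_measurable_continuous_onI continuous_intros)
  define G where "G p = indicat_real U p * (1 / sqrt (1 - kappa M * (norm p)\<^sup>2))" for p :: "real^2"
  have FG: "F (lift p h) = G p * (indicat_real {0<..1} h * h\<^sup>2)" for p h
    by (simp add: F_def G_def S_def indicator_def)
  have iP: "integrable ?P (\<lambda>x. F (lift (fst x) (snd x)))" and eP: "integral\<^sup>L ?P (\<lambda>x. F (lift (fst x) (snd x))) = m"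
  proof -
    have "integrable (distr ?P borel (\<lambda>(p, h). lift p h)) F" "integral\<^sup>L (distr ?P borel (\<lambda>(p, h). lift p h)) F = m"
      unfolding distr_lift using intL by auto
    then show "integrable ?P (\<lambda>x. F (lift (fst x) (snd x)))" "integral\<^sup>L ?P (\<lambda>x. F (lift (fst x) (snd x))) = m"
      using integrable_distr_eq[OF lm' Fm] integral_distr[OF lm' Fm] by (simp_all add: case_prod_beta)
  qed
  have sq: "(LINT h|lborel. indicat_real {0<..1} h * h\<^sup>2) = 1 / 3"
  proof -
    have "((\<lambda>h::real. h\<^sup>2) has_integral (1 ^ 3 / 3 - 0 ^ 3 / 3)) {0..1}"
      by (rule fundamental_theorem_of_calculus)
        (auto intro!: derivative_eq_intros simp: has_real_derivative_iff_has_vector_derivative[symmetric] power2_eq_square)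
    then have hi: "((\<lambda>h::real. h\<^sup>2) has_integral 1 / 3) {0..1}" by simp
    have "(LINT h|lborel. indicat_real {0<..1} h * h\<^sup>2) = (LINT h|lborel. indicat_real {0..1} h * h\<^sup>2)"
      by (rule Bochner_Integration.integral_cong) (auto simp: indicator_def)
    also have "\<dots> = (LINT h|lebesgue. indicat_real {0..1} h * h\<^sup>2)" by (subst integral_completion) auto
    also have "\<dots> = integral {0..1} (\<lambda>h. h\<^sup>2)"
    proof -
      have "(\<lambda>h::real. h\<^sup>2) absolutely_integrable_on {0..1}"
        using hi by (intro nonnegative_absolutely_integrable_1) auto
      from set_lebesgue_integral_eq_integral(2)[OF this] show ?thesis by (simp add: set_lebesgue_integral_def)
    qed
    also have "\<dots> = 1 / 3" using hi by (rule integral_unique)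
    finally show ?thesis .
  qed
  have "m = (LINT p|lborel. (LINT h|lborel. F (lift p h)))"
    using lborel_pair.integral_fst'[OF iP] eP by simp
  also have "\<dots> = (LINT p|lborel. G p * (1 / 3))" unfolding FG integral_mult_right_zero sq ..
  also have "\<dots> = (LINT p|lborel. G p) / 3" by simp
  also have "(LINT p|lborel. G p) = (LINT p|lebesgue. G p)"
  proof -
    have "(\<lambda>p::real^2. sqrt (1 - kappa M * (norm p)\<^sup>2)) \<in> borel_measurable borel"
      by (intro borel_measurable_continuous_onI continuous_intros)
    then have "G \<in> borel_measurable lborel" unfolding G_def using U by measurable
    then show ?thesis by (simp add: integral_completion)
  qed
  finally show ?thesis by (simp add: set_lebesgue_integral_def G_def m_def)
qed

lemma compact_cone_closure:
  fixes A :: "(real^3) set"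
  shows "compact A \<Longrightarrow> compact {h *\<^sub>R t | h t. h \<in> {0..1} \<and> t \<in> A}"
proof -
  assume A: "compact A"
  have "{h *\<^sub>R t | h t. h \<in> {0..1} \<and> t \<in> A} = (\<lambda>(h, t). h *\<^sub>R t) ` ({0..1} \<times> A)" by (force simp: image_def)
  moreover have "compact ((\<lambda>(h::real, t). h *\<^sub>R t) ` ({0..1} \<times> A))"
    using A unfolding case_prod_beta
    by (intro compact_continuous_image compact_Times continuous_on_scaleR continuous_on_fst continuous_on_snd continuous_on_id) auto
  ultimately show ?thesis by simp
qed

lemma cone_over_measurable:
  assumes A: "compact A" "0 \<notin> A" shows "cone_over A \<in> sets borel" "cone_over A \<in> lmeasurable"
proof -
  have eq: "cone_over A = {h *\<^sub>R t | h t. h \<in> {0..1} \<and> t \<in> A} - {0}"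
    using A(2) by (force simp: cone_over_def)
  have c: "compact {h *\<^sub>R t | h t. h \<in> {0..1} \<and> t \<in> A}" by (rule compact_cone_closure[OF A(1)])
  show b: "cone_over A \<in> sets borel" unfolding eq using borel_compact[OF c] by auto
  have "bounded (cone_over A)" unfolding eq using compact_imp_bounded[OF c] by (rule bounded_subset) auto
  then show "cone_over A \<in> lmeasurable" using b by (intro bounded_set_imp_lmeasurable) auto
qed

lemma chart_piece:
  assumes A: "A \<subseteq> points M" and s: "\<sigma> = 1 \<or> \<sigma> = -1"
  shows "cone_over ((\<lambda>p. lift p (chart M \<sigma> p)) ` {p. kappa M * (norm p)\<^sup>2 < 1 \<and> lift p (chart M \<sigma> p) \<in> A}) = cone_over A \<inter> {y. 0 < \<sigma> * y $ 3}" (is "?L = ?R")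
proof
  show "?L \<subseteq> ?R"
  proof
    fix y assume "y \<in> ?L"
    then obtain h p where hp: "0 < h" "h \<le> 1" "kappa M * (norm p)\<^sup>2 < 1" "lift p (chart M \<sigma> p) \<in> A" "y = h *\<^sub>R lift p (chart M \<sigma> p)"
      by (auto simp: cone_over_def)
    moreover have c: "0 < \<sigma> * chart M \<sigma> p" using hp(3) s by (auto simp: chart_def)
    have "0 < h * (\<sigma> * chart M \<sigma> p)" using hp(1) c by (rule mult_pos_pos)
    then have "0 < \<sigma> * y $ 3" unfolding hp(5) by (simp add: mult_ac)
    ultimately show "y \<in> ?R" unfolding cone_over_def by blast
  qed
  show "?R \<subseteq> ?L"
  proof
    fix y assume "y \<in> ?R"
    then obtain h t where ht: "0 < h" "h \<le> 1" "t \<in> A" "y = h *\<^sub>R t" "0 < \<sigma> * (h * t $ 3)" by (auto simp: cone_over_def)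
    have "0 < h * (\<sigma> * t $ 3)" using ht(5) by (simp add: mult_ac)
    then have t3: "0 < \<sigma> * t $ 3" using ht(1) by (rule zero_less_mult_pos)
    have "(t $ 3)\<^sup>2 + kappa M * ((t $ 1)\<^sup>2 + (t $ 2)\<^sup>2) = 1" using ht(3) A by (auto simp: in_points)
    then have q: "1 - kappa M * (norm (proj t))\<^sup>2 = (t $ 3)\<^sup>2" by (simp add: norm_squared_2)
    have "chart M \<sigma> (proj t) = t $ 3" using t3 s by (auto simp: chart_def q)
    moreover have "kappa M * (norm (proj t))\<^sup>2 < 1"
    proof -
      have "0 < (t $ 3)\<^sup>2" using t3 by auto
      then show ?thesis using q by linarith
    qed
    ultimately have "t \<in> (\<lambda>p. lift p (chart M \<sigma> p)) ` {p. kappa M * (norm p)\<^sup>2 < 1 \<and> lift p (chart M \<sigma> p) \<in> A}"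
      using ht(3) by (intro image_eqI[of _ _ "proj t"]) auto
    then show "y \<in> ?L" using ht unfolding cone_over_def by blast
  qed
qed

lemma chart_area:
  assumes A: "compact A" "A \<subseteq> points M" and s: "\<sigma> = 1 \<or> \<sigma> = -1"
  shows "(LINT p:{p. kappa M * (norm p)\<^sup>2 < 1 \<and> lift p (chart M \<sigma> p) \<in> A}|lebesgue. 1 / sqrt (1 - kappa M * (norm p)\<^sup>2))
    = 3 * measure lebesgue (cone_over A \<inter> {y. 0 < \<sigma> * y $ 3})"
    and "cone_over A \<inter> {y. 0 < \<sigma> * y $ 3} \<in> lmeasurable"
proof -
  have 0: "0 \<notin> A" using A(2) by (auto simp: in_points)
  have o: "open {y::real^3. 0 < \<sigma> * y $ 3}" by (intro open_Collect_less continuous_intros)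
  show lm: "cone_over A \<inter> {y. 0 < \<sigma> * y $ 3} \<in> lmeasurable"
    using cone_over_measurable(2)[OF A(1) 0] o by (intro fmeasurable_Int_fmeasurable) auto
  let ?U = "{p. kappa M * (norm p)\<^sup>2 < 1 \<and> lift p (chart M \<sigma> p) \<in> A}"
  have "?U = {p. kappa M * (norm p)\<^sup>2 < 1} \<inter> (\<lambda>p. lift p (chart M \<sigma> p)) -` A" by auto
  moreover have "open {p::real^2. kappa M * (norm p)\<^sup>2 < 1}" by (intro open_Collect_less continuous_intros)
  moreover have "closed ((\<lambda>p. lift p (chart M \<sigma> p)) -` A)"
    by (intro closed_vimage compact_imp_closed[OF A(1)] continuous_intros continuous_on_chart)
  ultimately have U: "?U \<in> sets borel" by auto
  have "\<sigma>\<^sup>2 = 1" using s by auto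
  from cone_volume[OF this U, of M] show "(LINT p:?U|lebesgue. 1 / sqrt (1 - kappa M * (norm p)\<^sup>2))
    = 3 * measure lebesgue (cone_over A \<inter> {y. 0 < \<sigma> * y $ 3})"
    using lm unfolding chart_piece[OF A(2) s] by simp
qed

text \<open>
  One formula for the area in all three planes. It makes areas accessible to the linear structure
  of \<open>real^3\<close>; on the sphere the cone over the equator is a null set.
\<close>
theorem area_cone_over:
  assumes A: "compact A" "A \<subseteq> points M" shows "area M A = 3 * measure lebesgue (cone_over A)"
proof (cases M)
  case Euclidean
  have "cone_over A \<inter> {y. 0 < 1 * y $ 3} = cone_over A" using A(2) Euclidean by (auto simp: cone_over_def in_points subset_iff)
  then have "(LINT p:{p. lift p 1 \<in> A}|lebesgue. 1) = 3 * measure lebesgue (cone_over A)"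
    using chart_area(1)[OF A, of 1] Euclidean by (simp add: chart_def)
  then show ?thesis using Euclidean by (simp add: set_lebesgue_integral_def)
next
  case Hyperbolic
  have "cone_over A \<inter> {y. 0 < 1 * y $ 3} = cone_over A" using A(2) Hyperbolic by (auto simp: cone_over_def in_points subset_iff)
  moreover have "{p :: real^2. kappa M * (norm p)\<^sup>2 < 1 \<and> lift p (chart M 1 p) \<in> A} = {p. lift p (sqrt (1 + (norm p)\<^sup>2)) \<in> A}"
    using Hyperbolic by (auto simp: chart_def) (metis less_le_trans neg_less_0_iff_less not_le zero_le_power2 zero_less_one less_1_mult neg_le_0_iff_le order_le_less_trans)
  ultimately show ?thesis using chart_area(1)[OF A, of 1] Hyperbolic by simp
next
  case Spherical
  have b: "{p :: real^2. kappa M * (norm p)\<^sup>2 < 1 \<and> lift p (chart M \<sigma> p) \<in> A} = {p \<in> ball 0 1. lift p (\<sigma> * sqrt (1 - (norm p)\<^sup>2)) \<in> A}" for \<sigma>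
    using Spherical by (auto simp: chart_def abs_square_less_1)
  have 0: "0 \<notin> A" using A(2) by (auto simp: in_points)
  note lm = chart_area(2)[OF A, of 1] chart_area(2)[OF A, of "-1"]
  have null: "negligible (cone_over A \<inter> {y. y $ 3 = 0})"
    by (rule negligible_subset[OF negligible_standard_hyperplane_cart[of 3]]) auto
  have "cone_over A = (cone_over A \<inter> {y. 0 < 1 * y $ 3}) \<union> (cone_over A \<inter> {y. 0 < -1 * y $ 3}) \<union> (cone_over A \<inter> {y. y $ 3 = 0})" by auto
  then have "measure lebesgue (cone_over A) = measure lebesgue ((cone_over A \<inter> {y. 0 < 1 * y $ 3}) \<union> (cone_over A \<inter> {y. 0 < -1 * y $ 3}))"
    using measure_Un_null_set[of "(cone_over A \<inter> {y. 0 < 1 * y $ 3}) \<union> (cone_over A \<inter> {y. 0 < -1 * y $ 3})" lebesgue "cone_over A \<inter> {y. y $ 3 = 0}"]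
      null lm by (auto simp: negligible_iff_null_sets)
  also have "\<dots> = measure lebesgue (cone_over A \<inter> {y. 0 < 1 * y $ 3}) + measure lebesgue (cone_over A \<inter> {y. 0 < -1 * y $ 3})"
    using lm by (intro measure_Union) (auto simp: fmeasurable_def)
  finally show ?thesis using chart_area(1)[OF A, of 1] chart_area(1)[OF A, of "-1"] Spherical unfolding b by simp
qed

section \<open>Area along the family\<close>

text \<open>
  The open cone \<open>point_cone M\<close> consists of the positive multiples of points; a vector in it is its
  \<open>height\<close> times the point \<open>central M y\<close>.
\<close>
definition height :: "geometry \<Rightarrow> real^3 \<Rightarrow> real" where "height M y = sqrt (dual M y y)"

definition central :: "geometry \<Rightarrow> real^3 \<Rightarrow> real^3" where "central M y = (1 / height M y) *\<^sub>R y"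

definition point_cone :: "geometry \<Rightarrow> (real^3) set" where
  "point_cone M = {y. 0 < dual M y y \<and> (M \<noteq> Spherical \<longrightarrow> 0 < y $ 3)}"

lemma height_pos: "y \<in> point_cone M \<Longrightarrow> 0 < height M y" by (simp add: height_def point_cone_def)

lemma central_points: "y \<in> point_cone M \<Longrightarrow> central M y \<in> points M"
proof -
  assume y: "y \<in> point_cone M"
  have "dual M (central M y) (central M y) = 1"
    using y by (simp add: central_def height_def point_cone_def)
  then show ?thesis using y height_pos[OF y]
    by (auto simp: in_points dual_def power2_eq_square central_def point_cone_def)
qed

lemma scale_point: "t \<in> points M \<Longrightarrow> 0 < h \<Longrightarrow> h *\<^sub>R t \<in> point_cone M"
  "t \<in> points M \<Longrightarrow> 0 < h \<Longrightarrow> height M (h *\<^sub>R t) = h" "t \<in> points M \<Longrightarrow> 0 < h \<Longrightarrow> central M (h *\<^sub>R t) = t"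
proof -
  assume t: "t \<in> points M" "0 < h"
  show f: "h *\<^sub>R t \<in> point_cone M" using t points_dual[OF t(1)] by (auto simp: point_cone_def in_points)
  show h: "height M (h *\<^sub>R t) = h" using t points_dual[OF t(1)] by (simp add: height_def)
  show "central M (h *\<^sub>R t) = t" using t h by (simp add: central_def)
qed

lemma point_cone_eq: "y \<in> point_cone M \<Longrightarrow> y = height M y *\<^sub>R central M y"
  using height_pos[of y M] by (simp add: central_def)

text \<open>
  The point \<open>a\<close> excludes, on the sphere, that \<open>y\<close> and \<open>y'\<close> cancel.
\<close>
lemma point_cone_add:
  assumes y: "y \<in> point_cone M" "y' \<in> point_cone M" and a: "a \<in> points M" "0 < dual M a y" "0 < dual M a y'"
  shows "y + y' \<in> point_cone M"
proof (cases M)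
  case Spherical
  have "0 < dual M a (y + y')" using a by simp
  then have "y + y' \<noteq> 0" using dual_zero(2)[of M a] by (metis less_irrefl)
  then have "0 < (y + y') \<bullet> (y + y')" by simp
  then show ?thesis using Spherical by (simp add: point_cone_def dual_def inner_vec_def sum_3)
next
  case Euclidean
  then show ?thesis using y by (simp add: point_cone_def dual_def)
next
  case Hyperbolic
  have P: "central M y \<in> points M" "central M y' \<in> points M" using y central_points by auto
  have d: "1 \<le> dual M (central M y) (central M y')"
    using dual_haver[OF P] haver_bounds(1)[OF P] Hyperbolic by simp
  have "dual M y y' = height M y * height M y' * dual M (central M y) (central M y')"
    using height_pos[OF y(1)] height_pos[OF y(2)] by (simp add: central_def)
  then have "0 \<le> dual M y y'" using d height_pos[OF y(1)] height_pos[OF y(2)] by simp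
  moreover have "dual M (y + y') (y + y') = dual M y y + 2 * dual M y y' + dual M y' y'"
    by (simp add: dual_commute[of M y' y])
  ultimately show ?thesis using y by (auto simp: point_cone_def simp del: dual_add)
qed

text \<open>
  The homogeneous extension of degree one of the function \<open>haver M q t - gver M r\<close>, which is
  nonpositive on the disk.
\<close>
definition excess :: "geometry \<Rightarrow> real \<Rightarrow> real^3 \<Rightarrow> real^3 \<Rightarrow> real" where
  "excess M r q y = height M y * (haver M q (central M y) - gver M r)"

lemma excess_scale: "t \<in> points M \<Longrightarrow> 0 < h \<Longrightarrow> excess M r q (h *\<^sub>R t) = h * (haver M q t - gver M r)"
  by (simp add: excess_def scale_point)

text \<open>
  Disks are convex in a quantitative sense. For curved planes the \<open>haver\<close> part is linear up to a
  multiple of the height, and \<open>height (y + y')\<close> differs from \<open>height y + height y'\<close> in the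
  direction given by the sign of the curvature; the remaining factor is \<open>gcos M r > 0\<close>. In the
  Euclidean plane heights are additive and the claim is convexity of the squared norm.
\<close>
lemma excess_sublinear:
  assumes y: "y \<in> point_cone M" "y' \<in> point_cone M" and a: "a \<in> points M" "0 < dual M a y" "0 < dual M a y'"
    and q: "q \<in> points M" and r: "acute M r"
  shows "excess M r q (y + y') \<le> excess M r q y + excess M r q y'"
proof -
  define h h' k where "h = height M y" "h' = height M y'" "k = height M (y + y')"
  define t t' s where "t = central M y" "t' = central M y'" "s = central M (y + y')"
  note defs = h_h'_k_def t_t'_s_def
  have yy: "y + y' \<in> point_cone M" by (rule point_cone_add[OF y a])
  have P: "t \<in> points M" "t' \<in> points M" "s \<in> points M" using central_points y yy by (auto simp: defs)
  have pos: "0 < h" "0 < h'" "0 < k" using height_pos y yy by (auto simp: defs)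
  have eq: "k *\<^sub>R s = h *\<^sub>R t + h' *\<^sub>R t'" using point_cone_eq[OF y(1)] point_cone_eq[OF y(2)] point_cone_eq[OF yy] by (simp add: defs)
  have "k * (haver M q s - gver M r) \<le> h * (haver M q t - gver M r) + h' * (haver M q t' - gver M r)"
  proof (cases "M = Euclidean")
    case True
    have k: "k = h + h'" using arg_cong[OF eq, of "\<lambda>v. v $ 3"] P True by (simp add: points.simps)
    define c d where "c = t - q" "d = t' - q"
    have sq: "k *\<^sub>R (s - q) = h *\<^sub>R c + h' *\<^sub>R d" using eq k by (simp add: c_d_def algebra_simps)
    have f: "haver M q v = form M (v - q) (v - q) / 2" for v by (simp add: haver_def form_def algebra_simps)
    have "0 \<le> form M (c - d) (c - d)" using True by (simp add: form_def)
    then have n: "0 \<le> h * h' * (form M c c + form M d d - 2 * form M c d)"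
      using pos form_commute[of M d c] by simp
    have "k * (k * form M (s - q) (s - q)) = form M (k *\<^sub>R (s - q)) (k *\<^sub>R (s - q))" by (simp del: form_diff)
    also have "\<dots> = h * h * form M c c + h' * h' * form M d d + 2 * h * h' * form M c d"
      unfolding sq by (simp add: form_commute[of M d c] algebra_simps)
    finally have "k * (k * form M (s - q) (s - q)) \<le> k * (h * form M c c + h' * form M d d)"
      using n unfolding k by (simp add: algebra_simps del: form_diff)
    then have "k * form M (s - q) (s - q) \<le> h * form M c c + h' * form M d d" using pos(3) by (simp del: form_diff)
    then have "k * haver M q s \<le> h * haver M q t + h' * haver M q t'" unfolding f c_d_def by (simp del: form_diff)
    then show ?thesis using k by (simp add: algebra_simps)
  next
    case False
    have D: "k * dual M q s = h * dual M q t + h' * dual M q t'"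
      using arg_cong[OF eq, of "dual M q"] by simp
    have K: "k\<^sup>2 = h\<^sup>2 + h'\<^sup>2 + 2 * h * h' * dual M t t'"
    proof -
      have "dual M (k *\<^sub>R s) (k *\<^sub>R s) = k\<^sup>2" using points_dual[OF P(3)] by (simp add: power2_eq_square)
      moreover have "dual M (k *\<^sub>R s) (k *\<^sub>R s) = h\<^sup>2 + h'\<^sup>2 + 2 * h * h' * dual M t t'"
        unfolding eq using points_dual[OF P(1)] points_dual[OF P(2)]
        by (simp add: dual_commute[of M t' t] power2_eq_square algebra_simps)
      ultimately show ?thesis by simp
    qed
    have "(h + h')\<^sup>2 - k\<^sup>2 = 2 * h * h' * (kappa M * haver M t t')"
      unfolding K dual_haver[OF P(1,2)] by (simp add: power2_eq_square algebra_simps)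
    then have "kappa M * ((h + h' - k) * (h + h' + k)) = 2 * h * h' * haver M t t'"
      using kappa_cases[OF False] by (auto simp: power2_eq_square algebra_simps)
    moreover have "0 \<le> 2 * h * h' * haver M t t'" using pos haver_bounds(1)[OF P(1,2)] by simp
    ultimately have "0 \<le> (kappa M * (h + h' - k)) * (h + h' + k)" by (simp add: mult.assoc)
    then have n: "0 \<le> kappa M * (h + h' - k)" using pos by (simp add: zero_le_mult_iff)
    have D': "k * (1 - kappa M * haver M q s) = h * (1 - kappa M * haver M q t) + h' * (1 - kappa M * haver M q t')"
      using D unfolding dual_haver[OF q P(1)] dual_haver[OF q P(2)] dual_haver[OF q P(3)] .
    have "k * (haver M q s - gver M r) = h * (haver M q t - gver M r) + h' * (haver M q t' - gver M r)
       - (1 - kappa M * gver M r) * (kappa M * (h + h' - k))"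
      using D' kappa_cases[OF False] by (auto simp: algebra_simps)
    moreover have "0 \<le> (1 - kappa M * gver M r) * (kappa M * (h + h' - k))"
      using n gcos_pos[OF r] unfolding gcos_gver by simp
    ultimately show ?thesis by simp
  qed
  then show ?thesis by (simp add: excess_def defs)
qed

lemma continuous_on_excess: "continuous_on (point_cone M) (excess M r q)"
proof -
  have "continuous_on (point_cone M) (height M)" unfolding height_def by (intro continuous_intros)
  then show ?thesis unfolding excess_def central_def
    by (intro continuous_intros) (use height_pos in force)+
qed

lemma open_point_cone: "open (point_cone M)"
proof -
  have "point_cone M = {y. 0 < dual M y y} \<inter> (if M = Spherical then UNIV else {y. 0 < y $ 3})" by (auto simp: point_cone_def)
  then show ?thesis by (auto intro!: open_Int open_Collect_less continuous_intros)
qed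

context regular_disk_triangle
begin

text \<open>
  Up to terms independent of \<open>s\<close>, the value \<open>haver M (z s) t\<close> is the quotient of an affine
  function of \<open>s\<close> by \<open>N s\<close>, which is bounded away from \<open>0\<close>.
\<close>
lemma haver_z_lipschitz:
  "\<exists>L>0. \<forall>s s' t. 0 \<le> s \<and> s \<le> 1 \<and> 0 \<le> s' \<and> s' \<le> 1 \<and> t \<in> points M \<and> haver M (x 1) t \<le> gver M r
     \<longrightarrow> \<bar>haver M (z s) t - haver M (z s') t\<bar> \<le> L * \<bar>s - s'\<bar>"
proof -
  define V where "V = gver M (2 * r)"
  have V: "0 \<le> V" by (simp add: V_def gver_nonneg)
  define B where "B = gsin M r * sqrt (V * (2 + V))"
  have B: "0 \<le> B" using V Sr by (simp add: B_def)
  define \<nu> where "\<nu> = (1 + cos_eta) / 2"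
  have nu: "0 < \<nu>" using cos_eta by (simp add: \<nu>_def)
  define L where "L = 2 * B / \<nu> + 2 * B / (\<nu> * \<nu> * \<nu>) + 1"
  have L: "0 < L" using B nu by (simp add: L_def add_nonneg_pos)
  have "\<bar>haver M (z s) t - haver M (z s') t\<bar> \<le> L * \<bar>s - s'\<bar>"
    if s: "0 \<le> s" "s \<le> 1" and s': "0 \<le> s'" "s' \<le> 1" and t: "t \<in> points M" "haver M (x 1) t \<le> gver M r" for s s' t
  proof -
    have tV: "haver M (v 0) t \<le> V"
    proof -
      have "gdist M (x 1) (v 0) \<le> r" "gdist M (x 1) t \<le> r"
        using haver_xv[of 1 0] t gdist_le_iff[OF x_points[of 1] v_points[of 0] acute_lengths[OF r]] gdist_le_iff[OF x_points[of 1] t(1) acute_lengths[OF r]] by auto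
      then have "gdist M (v 0) t \<le> 2 * r" using gdist_triangle[OF v_points[of 0] x_points[of 1] t(1)] gdist_commute[OF v_points[of 0] x_points[of 1]] by simp
      then show ?thesis using gdist_le_iff[OF v_points[of 0] t(1) lengths_2r] by (simp add: V_def)
    qed
    define f where "f i = form M (\<eta> i) (t - v 0)" for i
    have f: "\<bar>f i\<bar> \<le> B" if i: "i < 3" "i \<noteq> 0" for i
    proof -
      let ?e = "tpart M (v 0) t"
      have e: "dual M (v 0) ?e = 0" by (rule dual_tpart[OF v_points[of 0]]) simp
      have h0: "0 \<le> haver M (v 0) t" using haver_bounds(1)[OF v_points[of 0] t(1)] by simp
      have "form M ?e ?e = haver M (v 0) t * (2 - kappa M * haver M (v 0) t)" by (rule form_tpart_tpart[OF v_points[of 0] t(1)]) simp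
      also have "\<dots> \<le> V * (2 + V)"
        using tV h0 V haver_bounds(2)[OF v_points[of 0] t(1)] by (intro mult_mono) (cases M; auto)+
      finally have ee: "form M ?e ?e \<le> (sqrt (V * (2 + V)))\<^sup>2" using V by simp
      have "f i = form M (\<eta> i) ?e" unfolding f_def using form_tpart[OF v_points[of 0] t(1) eta(2)[OF i]] by (simp del: form_diff)
      moreover have "\<bar>form M (\<eta> i) ?e\<bar> \<le> gsin M r * sqrt (V * (2 + V))"
        using V Sr eta(3)[OF i] by (intro form_le_norms[OF v_points[of 0] eta(2)[OF i] e _ ee]) auto
      ultimately show ?thesis by (simp add: B_def)
    qed
    define h where "h s = (1 - s) * f 2 + s * f 1" for s
    have hb: "\<bar>h s\<bar> \<le> B" if "0 \<le> s" "s \<le> 1" for s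
    proof -
      have "\<bar>h s\<bar> \<le> \<bar>(1 - s) * f 2\<bar> + \<bar>s * f 1\<bar>" unfolding h_def by (rule abs_triangle_ineq)
      also have "\<dots> = (1 - s) * \<bar>f 2\<bar> + s * \<bar>f 1\<bar>" using that by (simp add: abs_mult)
      also have "\<dots> \<le> (1 - s) * B + s * B" using f[of 2] f[of 1] that by (intro add_mono mult_left_mono) auto
      finally show ?thesis by (simp add: algebra_simps)
    qed
    have hl: "\<bar>h s - h s'\<bar> \<le> 2 * B * \<bar>s - s'\<bar>"
    proof -
      have "h s - h s' = (s - s') * (f 1 - f 2)" by (simp add: h_def algebra_simps)
      also have "\<bar>\<dots>\<bar> \<le> \<bar>s - s'\<bar> * (2 * B)" unfolding abs_mult using f[of 1] f[of 2] by (intro mult_left_mono) auto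
      finally show ?thesis by (simp add: mult_ac)
    qed
    have Nn: "\<nu> \<le> N s" if "0 \<le> s" "s \<le> 1" for s
    proof -
      have "\<nu> \<le> (N s)\<^sup>2" using N(1)[OF that] by (simp add: \<nu>_def)
      also have "\<dots> \<le> N s * 1" unfolding power2_eq_square using N(3,4)[OF that] by (intro mult_left_mono) auto
      finally show ?thesis by simp
    qed
    have Nl: "\<bar>1 / N s - 1 / N s'\<bar> \<le> 2 * \<bar>s - s'\<bar> / (\<nu> * \<nu> * \<nu>)"
    proof -
      have n: "0 < N s" "0 < N s'" using N(3) s s' by auto
      have "1 / N s - 1 / N s' = ((N s')\<^sup>2 - (N s)\<^sup>2) / (N s * N s' * (N s + N s'))"
      proof -
        have "(N s')\<^sup>2 - (N s)\<^sup>2 = (N s' - N s) * (N s + N s')" by (simp add: power2_eq_square algebra_simps)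
        moreover have "1 / N s - 1 / N s' = (N s' - N s) / (N s * N s')" using n by (simp add: field_simps)
        ultimately show ?thesis using n by simp
      qed
      also have "(N s')\<^sup>2 - (N s)\<^sup>2 = 2 * (1 - cos_eta) * ((s - s') * (1 - s - s'))"
        unfolding N(2)[OF s] N(2)[OF s'] by (simp add: power2_eq_square algebra_simps)
      also have "\<bar>2 * (1 - cos_eta) * ((s - s') * (1 - s - s')) / (N s * N s' * (N s + N s'))\<bar>
         \<le> 4 * \<bar>s - s'\<bar> / (\<nu> * \<nu> * (2 * \<nu>))"
      proof -
        have 1: "\<bar>2 * (1 - cos_eta) * ((s - s') * (1 - s - s'))\<bar> \<le> 4 * \<bar>s - s'\<bar>"
        proof -
          have "\<bar>2 * (1 - cos_eta) * ((s - s') * (1 - s - s'))\<bar> = (2 * (1 - cos_eta)) * (\<bar>s - s'\<bar> * \<bar>1 - s - s'\<bar>)"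
            using cos_eta by (simp add: abs_mult)
          also have "\<dots> \<le> 4 * (\<bar>s - s'\<bar> * 1)"
            using cos_eta s s' by (intro mult_mono mult_left_mono) auto
          finally show ?thesis by simp
        qed
        have 2: "\<nu> * \<nu> * (2 * \<nu>) \<le> N s * N s' * (N s + N s')"
          using Nn[OF s] Nn[OF s'] nu n by (intro mult_mono) auto
        have "\<bar>2 * (1 - cos_eta) * ((s - s') * (1 - s - s')) / (N s * N s' * (N s + N s'))\<bar>
          = \<bar>2 * (1 - cos_eta) * ((s - s') * (1 - s - s'))\<bar> / (N s * N s' * (N s + N s'))"
          using n by (simp add: abs_divide abs_mult)
        also have "\<dots> \<le> 4 * \<bar>s - s'\<bar> / (\<nu> * \<nu> * (2 * \<nu>))"
          using 1 2 nu by (intro frac_le) auto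
        finally show ?thesis .
      qed
      finally show ?thesis using nu by (simp add: field_simps)
    qed
    have "haver M (z s) t - haver M (z s') t = h s' / N s' - h s / N s"
      unfolding haver_z[OF s t(1)] haver_z[OF s' t(1)] form_zeta f_def[symmetric] h_def by simp
    also have "\<dots> = (h s' - h s) * (1 / N s') + h s * (1 / N s' - 1 / N s)" by (simp add: algebra_simps diff_divide_distrib)
    also have "\<bar>\<dots>\<bar> \<le> \<bar>(h s' - h s) * (1 / N s')\<bar> + \<bar>h s * (1 / N s' - 1 / N s)\<bar>" by (rule abs_triangle_ineq)
    also have "\<dots> \<le> 2 * B * \<bar>s - s'\<bar> * (1 / \<nu>) + B * (2 * \<bar>s - s'\<bar> / (\<nu> * \<nu> * \<nu>))"
      unfolding abs_mult
      using hl hb[OF s] Nl Nn[OF s'] N(3)[OF s'] nu B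
      by (intro add_mono mult_mono) (auto simp: abs_minus_commute frac_le)
    also have "\<dots> = (L - 1) * \<bar>s - s'\<bar>" by (simp add: L_def algebra_simps)
    also have "\<dots> \<le> L * \<bar>s - s'\<bar>" by (intro mult_right_mono) auto
    finally show ?thesis .
  qed
  then show ?thesis using L by blast
qed

text \<open>
  The cone over the intersection of the disks around \<open>x 0\<close> and \<open>x 1\<close>, truncated by a plane rather
  than by \<open>height M y \<le> 1\<close>: in the hyperbolic case the latter does not define a convex set,
  whereas the former is preserved by the contraction towards \<open>m\<close>. The bound \<open>H0\<close> is chosen such
  that \<open>W\<close> contains all cones over the bodies \<open>Ks s\<close>. In \<open>E s \<delta>\<close> the third disk condition is
  relaxed by \<open>\<delta>\<close>.
\<close>
definition "H0 = max 1 (gcos M r)"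
definition "W = {y \<in> point_cone M. excess M r (x 0) y \<le> 0 \<and> excess M r (x 1) y \<le> 0 \<and> dual M (x 0) y \<le> H0}"
definition "E s \<delta> = {y \<in> W. excess M r (z s) y \<le> \<delta>}"

lemma W_dual_pos: assumes "y \<in> point_cone M" "excess M r (x 0) y \<le> 0" shows "min 1 (gcos M r) * height M y \<le> dual M (x 0) y" "0 < dual M (x 0) y"
proof -
  have cP: "central M y \<in> points M" and hp: "0 < height M y" using assms central_points height_pos by auto
  have le: "haver M (x 0) (central M y) \<le> gver M r" using assms(2) hp by (simp add: excess_def mult_le_0_iff)
  have "min 1 (gcos M r) \<le> dual M (x 0) (central M y)"
    unfolding dual_haver[OF x_points[of 0, simplified] cP] gcos_gver using le haver_bounds(1)[OF x_points[of 0, simplified] cP] by (cases M) auto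
  then have "min 1 (gcos M r) * height M y \<le> dual M (x 0) (central M y) * height M y" using hp by (intro mult_right_mono) auto
  also have "\<dots> = dual M (x 0) y" using point_cone_eq[OF assms(1)] by (metis dual_scaleR(2) mult.commute)
  finally show *: "min 1 (gcos M r) * height M y \<le> dual M (x 0) y" .
  have "0 < min 1 (gcos M r) * height M y" using Cr hp by simp
  then show "0 < dual M (x 0) y" using * by linarith
qed

lemma bounded_W: "bounded W"
proof -
  obtain B where B: "\<And>t. t \<in> disk M (x 0) r \<Longrightarrow> norm t \<le> B"
    using compact_imp_bounded[OF compact_disk[OF x_points[of 0] r]] by (auto simp: bounded_iff)
  define c where "c = min 1 (gcos M r)"
  have c: "0 < c" using Cr by (simp add: c_def)
  have "norm y \<le> (H0 / c) * max B 0" if y: "y \<in> W" for y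
  proof -
    have f: "y \<in> point_cone M" using y by (simp add: W_def)
    have "excess M r (x 0) y \<le> 0" "dual M (x 0) y \<le> H0" using y by (auto simp: W_def)
    then have "c * height M y \<le> H0" using W_dual_pos[OF f] by (simp add: c_def)
    then have h: "height M y \<le> H0 / c" using c by (simp add: pos_le_divide_eq mult.commute)
    have hp: "0 < height M y" using height_pos[OF f] .
    have "haver M (x 0) (central M y) \<le> gver M r" using y hp by (simp add: W_def excess_def mult_le_0_iff)
    then have "norm (central M y) \<le> B" using central_points[OF f] by (intro B) (simp add: disk_eq[OF x_points[of 0] r])
    then have "height M y * norm (central M y) \<le> (H0 / c) * max B 0" using h hp by (intro mult_mono) auto
    then show ?thesis using point_cone_eq[OF f] hp by (metis norm_scaleR abs_of_pos)
  qed
  then show ?thesis by (auto simp: bounded_iff)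
qed

lemma borel_excess: "{y \<in> point_cone M. excess M r q y \<le> c} \<in> sets borel"
proof -
  have "closedin (top_of_set (point_cone M)) {y \<in> point_cone M. excess M r q y \<le> c}"
    using continuous_closedin_preimage[OF continuous_on_excess[of M r q], of "{..c}"] by (simp add: vimage_def Int_def conj_commute)
  then obtain C where "closed C" "{y \<in> point_cone M. excess M r q y \<le> c} = point_cone M \<inter> C" by (auto simp: closedin_closed)
  then show ?thesis using open_point_cone[of M] by auto
qed

lemma E_measurable: "E s \<delta> \<in> lmeasurable"
proof -
  have cl: "closed {y. dual M (x 0) y \<le> H0}" by (intro closed_Collect_le continuous_intros)
  have eq: "E s \<delta> = {y \<in> point_cone M. excess M r (x 0) y \<le> 0} \<inter> {y \<in> point_cone M. excess M r (x 1) y \<le> 0}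
      \<inter> {y \<in> point_cone M. excess M r (z s) y \<le> \<delta>} \<inter> {y. dual M (x 0) y \<le> H0}"
    by (auto simp: E_def W_def)
  have "E s \<delta> \<in> sets borel" unfolding eq by (intro sets.Int borel_excess borel_closed cl)
  moreover have "bounded (E s \<delta>)" using bounded_W by (rule bounded_subset) (auto simp: E_def)
  ultimately show ?thesis by (intro bounded_set_imp_lmeasurable) auto
qed

definition "vol s = measure lebesgue (cone_over (Ks s))"

lemma Ks_compact: "0 \<le> s \<Longrightarrow> s \<le> 1 \<Longrightarrow> compact (Ks s)"
  unfolding Ks_def by (rule compact_common[OF Ks_centers(2,3) r])

lemma Ks_points: "Ks s \<subseteq> points M" by (auto simp: Ks_def common_def)

lemma area_Ks: "0 \<le> s \<Longrightarrow> s \<le> 1 \<Longrightarrow> area M (Ks s) = 3 * vol s"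
  unfolding vol_def by (rule area_cone_over[OF Ks_compact Ks_points])

lemma cone_Ks_measurable: "0 \<le> s \<Longrightarrow> s \<le> 1 \<Longrightarrow> cone_over (Ks s) \<in> lmeasurable"
  using subsetD[OF Ks_points, of 0 s] by (intro cone_over_measurable(2) Ks_compact) (auto simp: in_points)

lemma cone_Ks_sub_W: assumes "y \<in> cone_over (Ks s)" shows "y \<in> W"
proof -
  obtain h t where ht: "0 < h" "h \<le> 1" "t \<in> Ks s" "y = h *\<^sub>R t" using assms by (auto simp: cone_over_def)
  have t: "t \<in> points M" "haver M (x 0) t \<le> gver M r" "haver M (x 1) t \<le> gver M r" using ht(3) by (auto simp: Ks_def common_def)
  have "dual M (x 0) t \<le> H0"
    unfolding dual_haver[OF x_points[of 0, simplified] t(1)] H0_def gcos_gver using t(2) haver_bounds(1)[OF x_points[of 0, simplified] t(1)] by (cases M) auto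
  moreover have "0 < dual M (x 0) t"
    using W_dual_pos(2)[of t] scale_point(1)[OF t(1), of 1] excess_scale[OF t(1), of 1] t(2) by simp
  ultimately have "h * dual M (x 0) t \<le> 1 * H0" using ht(1,2) by (intro mult_mono) auto
  then show ?thesis
    using ht t by (simp add: W_def scale_point excess_scale mult_le_0_iff)
qed

lemma m_point_cone: "m \<in> point_cone M" "height M m = 1" "central M m = m"
  using scale_point[OF m_points, of 1] by simp_all

lemma excess_m: assumes "q \<in> points M" "haver M q m \<le> gver M R" shows "excess M r q m \<le> - (gver M r - gver M R)"
  using assms m_point_cone by (simp add: excess_def)

lemma m_W: "m \<in> W"
proof -
  have "dual M (x 0) m \<le> H0" unfolding dual_haver[OF x_points[of 0, simplified] m_points] H0_def gcos_gver
    using haver_x_center[of 0] gver_R_gap haver_bounds(1)[OF x_points[of 0, simplified] m_points] by (cases M) auto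
  then show ?thesis using m_point_cone haver_x_center[of 0] haver_x_center[of 1] gver_R_gap by (simp add: W_def excess_def)
qed

lemma excess_hom: assumes "y \<in> point_cone M" "0 < c" shows "excess M r q (c *\<^sub>R y) = c * excess M r q y" "c *\<^sub>R y \<in> point_cone M"
proof -
  have "y = height M y *\<^sub>R central M y" by (rule point_cone_eq[OF assms(1)])
  then have e: "c *\<^sub>R y = (c * height M y) *\<^sub>R central M y" by (metis scaleR_scaleR)
  have p: "0 < c * height M y" using height_pos[OF assms(1)] assms(2) by simp
  show "excess M r q (c *\<^sub>R y) = c * excess M r q y" unfolding e excess_scale[OF central_points[OF assms(1)] p] by (simp add: excess_def)
  show "c *\<^sub>R y \<in> point_cone M" unfolding e by (rule scale_point(1)[OF central_points[OF assms(1)] p])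
qed

text \<open>
  At \<open>m\<close> all disk conditions hold with the margin \<open>gver M r - gver M R\<close>, so moving towards \<open>m\<close>
  gains in proportion.
\<close>
lemma excess_towards_center:
  assumes y: "y \<in> point_cone M" "excess M r (x 0) y \<le> 0" and l: "0 < l" "l < 1" and q: "q \<in> points M" "haver M q m \<le> gver M R"
  shows "(1 - l) *\<^sub>R y + l *\<^sub>R m \<in> point_cone M"
    "excess M r q ((1 - l) *\<^sub>R y + l *\<^sub>R m) \<le> (1 - l) * excess M r q y - l * (gver M r - gver M R)"
proof -
  have f: "(1 - l) *\<^sub>R y \<in> point_cone M" "l *\<^sub>R m \<in> point_cone M" using excess_hom(2)[OF y(1)] excess_hom(2)[OF m_point_cone(1)] l by auto
  have p: "0 < dual M (x 0) ((1 - l) *\<^sub>R y)" "0 < dual M (x 0) (l *\<^sub>R m)"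
    using W_dual_pos(2)[OF y] W_dual_pos(2)[OF m_point_cone(1)] m_W l by (auto simp: W_def)
  have xp: "x 0 \<in> points M" using x_points by simp
  show "(1 - l) *\<^sub>R y + l *\<^sub>R m \<in> point_cone M" by (rule point_cone_add[OF f xp p])
  have "excess M r q ((1 - l) *\<^sub>R y + l *\<^sub>R m) \<le> excess M r q ((1 - l) *\<^sub>R y) + excess M r q (l *\<^sub>R m)"
    by (rule excess_sublinear[OF f xp p q(1) r])
  also have "\<dots> = (1 - l) * excess M r q y + l * excess M r q m"
    using excess_hom(1)[OF y(1)] excess_hom(1)[OF m_point_cone(1)] l by simp
  also have "\<dots> \<le> (1 - l) * excess M r q y + l * (- (gver M r - gver M R))"
    using excess_m[OF q] l by (intro add_left_mono mult_left_mono) auto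
  finally show "excess M r q ((1 - l) *\<^sub>R y + l *\<^sub>R m) \<le> (1 - l) * excess M r q y - l * (gver M r - gver M R)" by (simp add: algebra_simps)
qed

text \<open>
  The homothety with center \<open>m\<close> and ratio \<open>1 - l\<close> maps \<open>E s \<delta>\<close> into \<open>E s 0\<close> if \<open>l\<close> balances the
  excess \<open>\<delta>\<close> against the margin at \<open>m\<close>; volumes scale with the third power.
\<close>
lemma E_scaling:
  assumes s: "0 \<le> s" "s \<le> 1" and d: "0 < \<delta>"
  shows "measure lebesgue (E s \<delta>) \<le> (1 + \<delta> / (gver M r - gver M R)) ^ 3 * measure lebesgue (E s 0)"
proof -
  define g where "g = gver M r - gver M R"
  have g: "0 < g" using gver_R_gap by (simp add: g_def)
  define l where "l = \<delta> / (\<delta> + g)"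
  have l: "0 < l" "l < 1" "1 / (1 - l) = 1 + \<delta> / g" "(1 - l) * \<delta> = l * g" using d g by (auto simp: l_def field_simps)
  have zm: "z s \<in> points M" "haver M (z s) m \<le> gver M R" using z_points[OF s] haver_z_m[OF s] by auto
  define \<psi> where "\<psi> y = (1 / (1 - l)) *\<^sub>R (y - l *\<^sub>R m)" for y
  have "E s \<delta> \<subseteq> \<psi> ` E s 0"
  proof
    fix y assume y: "y \<in> E s \<delta>"
    have yW: "y \<in> point_cone M" "excess M r (x 0) y \<le> 0" "excess M r (x 1) y \<le> 0" "dual M (x 0) y \<le> H0" "excess M r (z s) y \<le> \<delta>"
      using y by (auto simp: E_def W_def)
    let ?y = "(1 - l) *\<^sub>R y + l *\<^sub>R m"
    note c = excess_towards_center[OF yW(1,2) l(1,2)]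
    have neg: "excess M r q ?y \<le> 0" if q: "q \<in> points M" "haver M q m \<le> gver M R" "excess M r q y \<le> \<delta>" for q
    proof -
      have "(1 - l) * excess M r q y \<le> (1 - l) * \<delta>" using q(3) l by (intro mult_left_mono) auto
      then show ?thesis using c(2)[OF q(1,2)] l(4) by (simp add: g_def)
    qed
    have "dual M (x 0) ?y \<le> H0"
    proof -
      have "(1 - l) * dual M (x 0) y + l * dual M (x 0) m \<le> (1 - l) * H0 + l * H0"
        using yW(4) m_W l by (intro add_mono mult_left_mono) (auto simp: W_def)
      then show ?thesis by (simp add: algebra_simps)
    qed
    then have "?y \<in> E s 0"
      using c(1)[OF zm] neg[of "x 0"] neg[of "x 1"] neg[OF zm yW(5)] x_points[of 0] x_points[of 1] haver_x_center[of 0] haver_x_center[of 1] yW d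
      by (simp add: E_def W_def)
    moreover have "\<psi> ?y = y" using l(1,2) by (simp add: \<psi>_def)
    ultimately show "y \<in> \<psi> ` E s 0" by (metis image_eqI)
  qed
  moreover have m: "\<psi> ` E s 0 \<in> lmeasurable" "measure lebesgue (\<psi> ` E s 0) = (1 / (1 - l)) ^ 3 * measure lebesgue (E s 0)"
  proof -
    have psi: "\<psi> = (\<lambda>y. (1 / (1 - l)) *\<^sub>R y + - (l / (1 - l)) *\<^sub>R m)"
      by (auto simp: fun_eq_iff \<psi>_def scaleR_right_diff_distrib)
    have sc: "(*\<^sub>R) (1 / (1 - l)) ` E s 0 \<in> lmeasurable"
      by (intro measurable_linear_image E_measurable linear_scaleR)
    have tr: "\<psi> ` E s 0 = (+) (- (l / (1 - l)) *\<^sub>R m) ` ((*\<^sub>R) (1 / (1 - l)) ` E s 0)"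
      unfolding psi by (simp add: image_image add.commute)
    show "\<psi> ` E s 0 \<in> lmeasurable" unfolding tr by (rule measurable_translation[OF sc])
    show "measure lebesgue (\<psi> ` E s 0) = (1 / (1 - l)) ^ 3 * measure lebesgue (E s 0)"
    proof -
      have "\<bar>1 / (1 - l)\<bar> = 1 / (1 - l)" using l(1,2) by simp
      then show ?thesis
        unfolding psi using measure_lebesgue_affine[of "1 / (1 - l)" "- (l / (1 - l)) *\<^sub>R m" "E s 0"]
        by (simp only: DIM_cart DIM_real) simp
    qed
  qed
  ultimately have "measure lebesgue (E s \<delta>) \<le> (1 / (1 - l)) ^ 3 * measure lebesgue (E s 0)"
    using measure_mono_fmeasurable[of "E s \<delta>" "\<psi> ` E s 0" lebesgue] E_measurable[of s \<delta>] by (auto simp: fmeasurableD)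
  then show ?thesis unfolding l(3) g_def .
qed

text \<open>
  What \<open>Ks s\<close> has in addition to \<open>Ks s'\<close> violates the condition for \<open>z s'\<close> by at most \<open>\<delta>\<close>, so the
  difference of the cones lies in \<open>E s' \<delta> - E s' 0\<close>.
\<close>
lemma vol_diff:
  assumes s: "0 \<le> s" "s \<le> 1" and s': "0 \<le> s'" "s' \<le> 1" and d: "0 < \<delta>"
    and z: "\<And>t. t \<in> Ks s \<Longrightarrow> haver M (z s') t \<le> haver M (z s) t + \<delta>"
  shows "vol s - vol s' \<le> ((1 + \<delta> / (gver M r - gver M R)) ^ 3 - 1) * measure lebesgue (E s' 0)"
proof -
  let ?A = "cone_over (Ks s)" and ?B = "cone_over (Ks s')"
  have "?A - ?B \<subseteq> E s' \<delta> - E s' 0"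
  proof
    fix y assume y: "y \<in> ?A - ?B"
    then obtain h t where ht: "0 < h" "h \<le> 1" "t \<in> Ks s" "y = h *\<^sub>R t" by (auto simp: cone_over_def)
    have t: "t \<in> points M" "haver M (x 0) t \<le> gver M r" "haver M (x 1) t \<le> gver M r" "haver M (z s) t \<le> gver M r"
      using ht(3) by (auto simp: Ks_def common_def)
    have yW: "y \<in> W" using cone_Ks_sub_W y by auto
    have ex: "excess M r (z s') y = h * (haver M (z s') t - gver M r)" unfolding ht(4) by (rule excess_scale[OF t(1) ht(1)])
    have "haver M (z s') t - gver M r \<le> \<delta>" using z[OF ht(3)] t(4) by simp
    then have "h * (haver M (z s') t - gver M r) \<le> h * \<delta>" using ht(1) by (intro mult_left_mono) auto
    also have "\<dots> \<le> \<delta>" using ht(1,2) d by (simp add: mult_left_le_one_le)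
    finally have "y \<in> E s' \<delta>" using yW ex by (simp add: E_def)
    moreover have "y \<notin> E s' 0"
    proof
      assume "y \<in> E s' 0"
      then have "haver M (z s') t \<le> gver M r" using ex ht(1) by (simp add: E_def mult_le_0_iff)
      then have "t \<in> Ks s'" using t by (simp add: Ks_def common_def)
      then show False using y ht unfolding cone_over_def by blast
    qed
    ultimately show "y \<in> E s' \<delta> - E s' 0" by simp
  qed
  then have "measure lebesgue (?A - ?B) \<le> measure lebesgue (E s' \<delta> - E s' 0)"
    using cone_Ks_measurable[OF s] cone_Ks_measurable[OF s'] E_measurable
    by (intro measure_mono_fmeasurable) (auto intro: fmeasurable.Diff)
  also have "\<dots> = measure lebesgue (E s' \<delta>) - measure lebesgue (E s' 0)"
    using E_measurable d by (intro measurable_measure_Diff) (auto simp: E_def)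
  also have "\<dots> \<le> ((1 + \<delta> / (gver M r - gver M R)) ^ 3 - 1) * measure lebesgue (E s' 0)"
    using E_scaling[OF s' d] by (simp add: algebra_simps)
  finally have "measure lebesgue (?A - ?B) \<le> \<dots>" .
  moreover have "vol s - vol s' \<le> measure lebesgue (?A - ?B)"
  proof -
    have "vol s \<le> measure lebesgue (?B \<union> (?A - ?B))"
      unfolding vol_def using cone_Ks_measurable[OF s] cone_Ks_measurable[OF s']
      by (intro measure_mono_fmeasurable) (auto intro: fmeasurable.Un fmeasurable.Diff)
    also have "\<dots> \<le> vol s' + measure lebesgue (?A - ?B)"
      unfolding vol_def using cone_Ks_measurable[OF s] cone_Ks_measurable[OF s']
      by (intro measure_Un_le) auto
    finally show ?thesis by simp
  qed
  ultimately show ?thesis by linarith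
qed

lemma vol_lipschitz: "\<exists>C>0. \<forall>s s'. 0 \<le> s \<and> s \<le> 1 \<and> 0 \<le> s' \<and> s' \<le> 1 \<longrightarrow> \<bar>vol s - vol s'\<bar> \<le> C * \<bar>s - s'\<bar>"
proof -
  obtain L where L: "0 < L" "\<And>s s' t. 0 \<le> s \<Longrightarrow> s \<le> 1 \<Longrightarrow> 0 \<le> s' \<Longrightarrow> s' \<le> 1 \<Longrightarrow> t \<in> points M \<Longrightarrow> haver M (x 1) t \<le> gver M r
     \<Longrightarrow> \<bar>haver M (z s) t - haver M (z s') t\<bar> \<le> L * \<bar>s - s'\<bar>" using haver_z_lipschitz by blast
  define g where "g = gver M r - gver M R"
  have g: "0 < g" using gver_R_gap by (simp add: g_def)
  obtain B where B: "\<And>s \<delta>. measure lebesgue (E s \<delta>) \<le> B"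
  proof -
    obtain a where "\<forall>y\<in>W. norm y \<le> a" using bounded_W unfolding bounded_iff by blast
    then have a: "W \<subseteq> cball 0 a" by auto
    have "measure lebesgue (E s \<delta>) \<le> measure lebesgue (cball (0 :: real^3) a)" for s \<delta>
      using a E_measurable[of s \<delta>] by (intro measure_mono_fmeasurable) (auto simp: E_def)
    then show thesis by (rule that)
  qed
  have B0: "0 \<le> B" using B[of 0 0] measure_nonneg order_trans by blast
  define X where "X = L / g"
  have X: "0 < X" using L g by (simp add: X_def)
  define C where "C = X * (3 + 3 * X + X * X) * B + 1"
  have half: "vol s - vol s' \<le> C * \<bar>s - s'\<bar>" if s: "0 \<le> s" "s \<le> 1" and s': "0 \<le> s'" "s' \<le> 1" for s s'
  proof (cases "s = s'")
    case False
    define \<delta> where "\<delta> = L * \<bar>s - s'\<bar>"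
    have d: "0 < \<delta>" using False L by (simp add: \<delta>_def)
    have zz: "haver M (z s') t \<le> haver M (z s) t + \<delta>" if "t \<in> Ks s" for t
      using L(2)[OF s s', of t] that by (auto simp: Ks_def common_def \<delta>_def)
    define Y where "Y = \<delta> / g"
    have Y: "0 < Y" "Y = X * \<bar>s - s'\<bar>" using d g by (auto simp: Y_def X_def \<delta>_def)
    have YX: "Y \<le> X" unfolding Y(2) using X s s' by (intro mult_right_le_one_le) auto
    have "vol s - vol s' \<le> ((1 + Y) ^ 3 - 1) * measure lebesgue (E s' 0)"
      using vol_diff[OF s s' d zz] by (simp add: Y_def g_def)
    also have "\<dots> \<le> ((1 + Y) ^ 3 - 1) * B"
      using B Y by (intro mult_left_mono) auto
    also have "(1 + Y) ^ 3 - 1 = Y * (3 + 3 * Y + Y * Y)" by (simp add: power3_eq_cube algebra_simps)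
    also have "Y * (3 + 3 * Y + Y * Y) * B \<le> Y * (3 + 3 * X + X * X) * B"
      using Y YX B0 by (intro mult_right_mono mult_left_mono add_mono mult_mono) auto
    also have "\<dots> = (C - 1) * \<bar>s - s'\<bar>" unfolding Y(2) C_def by simp
    also have "\<dots> \<le> C * \<bar>s - s'\<bar>" by (intro mult_right_mono) auto
    finally show ?thesis .
  qed simp
  have "0 < C" using X B0 by (simp add: C_def add_nonneg_pos)
  moreover have "\<bar>vol s - vol s'\<bar> \<le> C * \<bar>s - s'\<bar>" if "0 \<le> s" "s \<le> 1" "0 \<le> s'" "s' \<le> 1" for s s'
    using half[OF that] half[OF that(3,4,1,2)] by (simp add: abs_le_iff abs_minus_commute)
  ultimately show ?thesis by blast
qed

text \<open>
  The point \<open>P (rate * s)\<close> of \<open>Ks s\<close> lies outside \<open>T\<close>. Moving it slightly towards \<open>m\<close> makes all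
  disk conditions for \<open>Ks s\<close> strict without entering \<open>T\<close>, so the difference of the cones contains
  a nonempty open set.
\<close>
lemma vol_strict: assumes s: "0 < s" "s \<le> 1" "rate * s \<le> cos_xi" shows "vol 0 < vol s"
proof -
  have s0: "0 \<le> s" using s by simp
  let ?P = "P (rate * s)"
  have PK: "?P \<in> Ks s" by (rule P_in_Ks[OF s0 s(2,3)])
  then have PP': "?P \<in> points M" using Ks_points by auto
  have hP: "haver M (x 0) ?P \<le> gver M r" "haver M (x 1) ?P \<le> gver M r" "haver M (z s) ?P \<le> gver M r"
    using PK by (auto simp: Ks_def common_def)
  then have x2: "gver M r < haver M (x 2) ?P"
    using P_notin_T[OF s] PP' unfolding Ks_0[symmetric] Ks_def z_0 common_def by auto
  have fP: "?P \<in> point_cone M" using scale_point(1)[OF PP', of 1] by simp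
  have exP: "excess M r q ?P = haver M q ?P - gver M r" for q using excess_scale[OF PP', of 1] by simp
  have "open (point_cone M \<inter> excess M r (x 2) -` {0<..})"
    by (rule continuous_open_preimage[OF continuous_on_excess open_point_cone]) simp
  moreover have "?P \<in> point_cone M \<inter> excess M r (x 2) -` {0<..}" using fP x2 exP by simp
  ultimately obtain e where e: "0 < e" "ball ?P e \<subseteq> point_cone M \<inter> excess M r (x 2) -` {0<..}" using open_contains_ball by blast
  define l where "l = min (1 / 2) (e / (2 * (norm (m - ?P) + 1)))"
  have l: "0 < l" "l < 1" using e(1) by (auto simp: l_def add_nonneg_pos)
  define y where "y = (1 - l) *\<^sub>R ?P + l *\<^sub>R m"
  have "dist ?P y < e"
  proof -
    have "?P - y = l *\<^sub>R (?P - m)" by (simp add: y_def algebra_simps)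
    then have "dist ?P y = l * norm (m - ?P)" using l by (simp add: dist_norm norm_minus_commute)
    also have "\<dots> \<le> l * (norm (m - ?P) + 1)" using l by (intro mult_left_mono) auto
    also have "\<dots> \<le> e / (2 * (norm (m - ?P) + 1)) * (norm (m - ?P) + 1)" by (intro mult_right_mono) (auto simp: l_def)
    also have "\<dots> = e / 2" by (simp add: field_simps add_nonneg_eq_0_iff)
    finally show ?thesis using e(1) by simp
  qed
  then have yx2: "0 < excess M r (x 2) y" using e(2) by auto
  note c = excess_towards_center[OF fP _ l]
  have ex0: "excess M r (x 0) ?P \<le> 0" using exP hP by simp
  have yneg: "excess M r q y < 0" if "q \<in> {x 0, x 1, z s}" for q
  proof -
    have q: "q \<in> points M" "haver M q m \<le> gver M R" using Ks_centers(2,4)[OF s0 s(2)] that by auto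
    have "excess M r q ?P \<le> 0" using that exP hP by auto
    then have "(1 - l) * excess M r q ?P \<le> 0" using l by (simp add: mult_le_0_iff)
    moreover have "0 < l * (gver M r - gver M R)" using l gver_R_gap by simp
    ultimately show ?thesis using c(2)[OF ex0 q] unfolding y_def by linarith
  qed
  have fy: "y \<in> point_cone M" unfolding y_def by (rule c(1)[OF ex0 x_points[of 0]]) (use haver_x_center[of 0] in simp_all)
  define O' where "O' = (point_cone M \<inter> excess M r (x 0) -` {..<0}) \<inter> (point_cone M \<inter> excess M r (x 1) -` {..<0})
    \<inter> (point_cone M \<inter> excess M r (z s) -` {..<0}) \<inter> (point_cone M \<inter> excess M r (x 2) -` {0<..}) \<inter> {y. dual M y y < 1}"
  have op: "open (point_cone M \<inter> excess M r q -` S)" if "open S" for q S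
    by (rule continuous_open_preimage[OF continuous_on_excess open_point_cone that])
  have oO: "open O'" unfolding O'_def
    by (intro op open_Int open_lessThan open_greaterThan open_Collect_less continuous_intros)
  define c where "c = 1 / (2 * height M y)"
  have c: "0 < c" using height_pos[OF fy] by (simp add: c_def)
  have "c *\<^sub>R y \<in> O'"
  proof -
    have hh: "dual M y y = height M y * height M y" using fy by (simp add: height_def point_cone_def)
    have "dual M (c *\<^sub>R y) (c *\<^sub>R y) = 1 / 4" unfolding dual_scaleR hh c_def using height_pos[OF fy] by simp
    then show ?thesis using excess_hom[OF fy c] yneg yx2 c by (simp add: O'_def mult_less_0_iff)
  qed
  then have ne: "O' \<noteq> {}" by auto
  have sub: "O' \<subseteq> cone_over (Ks s) - cone_over (Ks 0)"
  proof
    fix y assume y: "y \<in> O'"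
    have f: "y \<in> point_cone M" using y by (simp add: O'_def)
    have t: "central M y \<in> points M" and h: "0 < height M y" using central_points[OF f] height_pos[OF f] by auto
    have h1: "height M y \<le> 1" using y by (simp add: height_def O'_def)
    have "central M y \<in> Ks s" using y t h by (auto simp: Ks_def common_def O'_def excess_def mult_less_0_iff)
    then have "y \<in> cone_over (Ks s)" unfolding cone_over_def using point_cone_eq[OF f] h h1 by blast
    moreover have "y \<notin> cone_over (Ks 0)"
    proof
      assume "y \<in> cone_over (Ks 0)"
      then obtain k t where kt: "0 < k" "t \<in> Ks 0" "y = k *\<^sub>R t" by (auto simp: cone_over_def)
      have tp: "t \<in> points M" "haver M (x 2) t \<le> gver M r" using kt(2) by (auto simp: Ks_def common_def z_0)
      have "excess M r (x 2) y \<le> 0" unfolding kt(3) excess_scale[OF tp(1) kt(1)] using tp(2) kt(1) by (simp add: mult_le_0_iff)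
      then show False using y by (simp add: O'_def)
    qed
    ultimately show "y \<in> cone_over (Ks s) - cone_over (Ks 0)" by simp
  qed
  have lm: "cone_over (Ks s) \<in> lmeasurable" "cone_over (Ks 0) \<in> lmeasurable" using cone_Ks_measurable s0 s(2) by auto
  have Olm: "O' \<in> lmeasurable"
    using fmeasurable.Diff[OF lm(1)] lm sub oO by (intro fmeasurableI2[OF lm(1)]) auto
  have "0 < measure lebesgue O'"
    using open_not_negligible[OF oO ne] Olm measure_nonneg[of lebesgue O'] by (auto simp: negligible_iff_measure order.strict_iff_order)
  also have "\<dots> \<le> measure lebesgue (cone_over (Ks s) - cone_over (Ks 0))"
    using sub Olm lm by (intro measure_mono_fmeasurable) (auto intro: fmeasurable.Diff)
  also have "\<dots> = vol s - vol 0" unfolding vol_def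
  proof (rule measurable_measure_Diff[OF lm(1)])
    show "cone_over (Ks 0) \<in> sets lebesgue" using lm by auto
    have "Ks 0 \<subseteq> Ks s" unfolding Ks_0 by (rule T_subset_Ks[OF s0 s(2)])
    then show "cone_over (Ks 0) \<subseteq> cone_over (Ks s)" by (auto simp: cone_over_def)
  qed
  finally show ?thesis by simp
qed

end

section \<open>Existence and structure of the disk triangle of given width\<close>

text \<open>
  The minimal width is an infimum over supporting lines, and lower bounds for it presuppose that
  there is one: it exists at a point farthest from \<open>q\<close>.
\<close>
lemma ex_supporting_line:
  assumes K: "K \<subseteq> points M" "compact K" "K \<noteq> {}" and q: "q \<in> points M" and r: "acute M r" "\<And>t. t \<in> K \<Longrightarrow> haver M q t \<le> gver M r"
  shows "\<exists>H. supporting_line M K H"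
proof -
  have "continuous_on K (\<lambda>t. haver M q t)" by (intro continuous_intros)
  then obtain a where a: "a \<in> K" "\<And>t. t \<in> K \<Longrightarrow> haver M q t \<le> haver M q a"
    using continuous_attains_sup[OF K(2,3)] by blast
  have aP: "a \<in> points M" using a K by auto
  let ?d = "gdist M a q"
  obtain n where n: "unit M a n" "q = gexp M a n ?d" using ex_gexp[OF aP q] by blast
  have d: "gver M ?d = haver M q a" using gdist_gver(1)[OF aP q] by (simp add: haver_commute)
  have "?d \<le> r" using r(2)[OF a(1)] gdist_le_iff[OF aP q acute_lengths[OF r(1)]] by (simp add: haver_commute)
  then have ac: "acute M ?d" using gdist_nonneg[OF aP q] by (intro acute_mono[OF r(1)]) auto
  have "0 \<le> form M n (t - a)" if "t \<in> K" for t
    using form_in_disk(2)[OF aP n(1) _ ac, of t] a(2)[OF that] that K(1) n(2) d by auto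
  then show ?thesis using supporting_line_intro[OF K(1) a(1) n(1)] by blast
qed

lemma ex_orthogonal_pair: fixes a b :: "real^3" shows "\<exists>n. n \<noteq> 0 \<and> n \<bullet> a = 0 \<and> n \<bullet> b = 0"
proof -
  have "dim {a, b} \<le> card {a, b}" by (intro dim_le_card) (auto intro: span_base)
  also have "\<dots> \<le> 2" by (simp add: card_insert_if)
  finally have "dim {a, b} < DIM(real^3)" by simp
  then obtain n where "n \<noteq> 0" "\<And>y. y \<in> span {a, b} \<Longrightarrow> orthogonal n y" using orthogonal_to_subspace_exists by blast
  then show ?thesis by (intro exI[of _ n]) (auto simp: orthogonal_def span_base)
qed

text \<open>
  The center is the normalized sum \<open>s\<close> of the vertices. On the sphere \<open>s = 0\<close> is excluded because
  the vertices do not lie on a great circle, and choosing the positive multiple of \<open>s\<close> makes the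
  circumradius acute. Comparing the components tangent at the center shows that the three
  directions sum to zero; as the sides are equal, the angles between them are equal and hence 120
  degrees.
\<close>
lemma regular_triangle_frame:
  assumes "regular_triangle M a b c"
  shows "\<exists>m u R. regular_directions M m u \<and> acute M R \<and> 0 < R \<and> a = gexp M m (u 0) R \<and> b = gexp M m (u 1) R \<and> c = gexp M m (u 2) R"
proof -
  have P: "a \<in> points M" "b \<in> points M" "c \<in> points M" and g: "gdist M a b = gdist M b c" "gdist M b c = gdist M c a"
    and ind: "\<And>n. n \<noteq> 0 \<Longrightarrow> n \<bullet> a = 0 \<Longrightarrow> n \<bullet> b = 0 \<Longrightarrow> n \<bullet> c = 0 \<Longrightarrow> False"
    using assms by (auto simp: regular_triangle_def)
  define D where "D = haver M a b"
  have D: "haver M a b = D" "haver M b c = D" "haver M a c = D"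
    using gdist_gver(1)[OF P(1,2)] gdist_gver(1)[OF P(2,3)] gdist_gver(1)[OF P(3,1)] g by (auto simp: D_def haver_commute[of M a c])
  define C where "C = 1 - kappa M * D"
  have dd: "dual M a b = C" "dual M b c = C" "dual M a c = C" "dual M b a = C" "dual M c b = C" "dual M c a = C"
    using dual_haver[OF P(1,2)] dual_haver[OF P(2,3)] dual_haver[OF P(1,3)] D
    by (auto simp: C_def dual_commute[of M b a] dual_commute[of M c b] dual_commute[of M c a])
  have one: "dual M a a = 1" "dual M b b = 1" "dual M c c = 1" using P points_dual by auto
  have D0: "0 \<le> D" using haver_bounds(1)[OF P(1,2)] D by simp
  define s where "s = a + b + c"
  have ss: "dual M s s = 3 * (1 + 2 * C)" and sx: "dual M s a = 1 + 2 * C" "dual M s b = 1 + 2 * C" "dual M s c = 1 + 2 * C"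
    using dd one by (simp_all add: s_def)
  have "s \<noteq> 0"
  proof
    assume "s = 0"
    obtain n where n: "n \<noteq> 0" "n \<bullet> a = 0" "n \<bullet> b = 0" using ex_orthogonal_pair by blast
    have "n \<bullet> s = 0" using \<open>s = 0\<close> by simp
    then have "n \<bullet> c = 0" using n by (simp add: s_def inner_add_right)
    then show False using ind n by blast
  qed
  have fut: "s \<in> point_cone M"
  proof (cases M)
    case Spherical
    have "0 < s \<bullet> s" using \<open>s \<noteq> 0\<close> by simp
    then show ?thesis using Spherical by (simp add: point_cone_def dual_def inner_vec_def sum_3)
  next
    case Euclidean
    then show ?thesis using ss P by (simp add: point_cone_def C_def in_points s_def)
  next
    case Hyperbolic
    then show ?thesis using ss P D0 by (simp add: point_cone_def C_def in_points s_def)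
  qed
  define m where "m = central M s"
  define l where "l = height M s"
  have l: "0 < l" "s = l *\<^sub>R m" "l * l = 3 * (1 + 2 * C)"
  proof -
    show "0 < l" "s = l *\<^sub>R m" using fut height_pos point_cone_eq by (auto simp: l_def m_def)
    show "l * l = 3 * (1 + 2 * C)" using fut ss by (simp add: l_def height_def point_cone_def)
  qed
  have m_points: "m \<in> points M" using central_points[OF fut] by (simp add: m_def)
  have mx: "dual M m x = l / 3" if "dual M s x = 1 + 2 * C" for x
  proof -
    have "l * dual M m x = (l * l) / 3" using that l by simp
    then show ?thesis using l(1) by (simp add: field_simps)
  qed
  have hav: "haver M m a = haver M m b \<and> haver M m b = haver M m c"
  proof (cases "M = Euclidean")
    case False
    then show ?thesis using haver_dual[OF m_points P(1)] haver_dual[OF m_points P(2)] haver_dual[OF m_points P(3)] mx sx by simp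
  next
    case True
    then have "(l - 3) * (l + 3) = 0" using l(3) by (simp add: C_def algebra_simps)
    then have l3: "l = 3" using l(1) by simp
    have AA: "form M (a - b) (a - b) = 2 * D" "form M (b - c) (b - c) = 2 * D" "form M (a - c) (a - c) = 2 * D" using D by (auto simp: haver_def)
    have h: "haver M m x = form M (s - 3 *\<^sub>R x) (s - 3 *\<^sub>R x) / 18" for x
    proof -
      have "s - 3 *\<^sub>R x = 3 *\<^sub>R (m - x)" using l l3 by (simp add: algebra_simps)
      then show ?thesis by (simp add: haver_def del: form_diff)
    qed
    have q: "form M (a - b) (a - b) = form M a a - 2 * form M a b + form M b b" for a b
      by (simp add: form_commute[of M b a])
    have e: "form M a b = (form M a a + form M b b) / 2 - D" "form M b c = (form M b b + form M c c) / 2 - D" "form M a c = (form M a a + form M c c) / 2 - D"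
      subgoal using trans[OF AA(1)[symmetric] q[of a b]] by (simp add: field_simps del: form_diff)
      subgoal using trans[OF AA(2)[symmetric] q[of b c]] by (simp add: field_simps del: form_diff)
      subgoal using trans[OF AA(3)[symmetric] q[of a c]] by (simp add: field_simps del: form_diff)
      done
    have "form M (s - 3 *\<^sub>R a) (s - 3 *\<^sub>R a) = 6 * D" "form M (s - 3 *\<^sub>R b) (s - 3 *\<^sub>R b) = 6 * D" "form M (s - 3 *\<^sub>R c) (s - 3 *\<^sub>R c) = 6 * D"
      by (simp_all add: s_def form_commute[of M b a] form_commute[of M c a] form_commute[of M c b] e field_simps)
    then show ?thesis unfolding h by simp
  qed
  define R where "R = gdist M m a"
  have Rl: "R \<in> lengths M" "gver M R = haver M m a" using gdist_gver[OF m_points P(1)] by (auto simp: R_def)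
  have Rb: "gdist M m b = R" "gdist M m c = R"
    using gdist_eq_iff[OF m_points P(2) Rl(1)] gdist_eq_iff[OF m_points P(3) Rl(1)] Rl(2) hav by auto
  obtain u0 where u0: "unit M m u0" "a = gexp M m u0 R" using ex_gexp[OF m_points P(1)] by (auto simp: R_def)
  obtain u1 where u1: "unit M m u1" "b = gexp M m u1 R" using ex_gexp[OF m_points P(2)] Rb by auto
  obtain u2 where u2: "unit M m u2" "c = gexp M m u2 R" using ex_gexp[OF m_points P(3)] Rb by auto
  have CR: "gcos M R = l / 3" using mx[OF sx(1)] dual_haver[OF m_points P(1)] Rl(2) by (simp add: gcos_gver)
  have Rpos: "0 < R"
  proof (rule ccontr)
    assume "\<not> 0 < R"
    then have "R = 0" using Rl(1) by (simp add: lengths_def)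
    then have "a = b" "b = c" using u0 u1 u2 by auto
    moreover obtain n where "n \<noteq> 0" "n \<bullet> a = 0" "n \<bullet> a = 0" using ex_orthogonal_pair by blast
    ultimately show False using ind by auto
  qed
  have ac: "acute M R"
  proof (cases "M = Spherical")
    case True
    then have c: "0 < cos R" "0 \<le> R" "R \<le> pi" using CR l(1) Rl(1) by (auto simp: lengths_def)
    have "R < pi / 2"
    proof (rule ccontr)
      assume "\<not> ?thesis"
      then have "cos R \<le> cos (pi / 2)" using c by (intro cos_monotone_0_pi_le) auto
      then show False using c by simp
    qed
    then show ?thesis using c by (simp add: acute_def)
  qed (use Rl(1) in \<open>simp add: acute_def lengths_def\<close>)
  have SR: "0 < gsin M R" using gsin_pos[OF ac Rpos] .
  have "gsin M R *\<^sub>R (u0 + u1 + u2) = 0"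
  proof -
    have "s = (3 * gcos M R) *\<^sub>R m + gsin M R *\<^sub>R (u0 + u1 + u2)"
      unfolding s_def u0(2) u1(2) u2(2) gexp_def by (simp add: vec_eq_iff algebra_simps)
    then show ?thesis using l(2) CR by simp
  qed
  then have sum0: "u0 + u1 + u2 = 0" using SR by simp
  have hh: "D = gcos M R * gver M R + gver M R - gsin M R * gsin M R * form M v w"
    if "unit M m v" "unit M m w" "haver M (gexp M m v R) (gexp M m w R) = D" for v w
    using haver_gexp_gexp[OF m_points that(1,2), of R R] that(3) by simp
  have f: "form M u0 u1 = form M u1 u2" "form M u0 u2 = form M u1 u2"
    using hh[OF u0(1) u1(1)] hh[OF u1(1) u2(1)] hh[OF u0(1) u2(1)] D u0(2) u1(2) u2(2) SR by auto
  have "form M u0 (u0 + u1 + u2) = 0" using sum0 by simp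
  then have h: "form M u1 u2 = - 1 / 2" using u0(1) f by (simp add: unit_def)
  define u where "u i = (if i = 0 then u0 else if i = Suc 0 then u1 else u2)" for i :: nat
  have "regular_directions M m u"
  proof
    show "m \<in> points M" by (rule m_points)
    show "unit M m (u i)" if "i < 3" for i using u0 u1 u2 by (simp add: u_def)
    show "form M (u i) (u j) = - 1 / 2" if "i < 3" "j < 3" "i \<noteq> j" for i j
    proof -
      have "i = 0 \<or> i = 1 \<or> i = 2" "j = 0 \<or> j = 1 \<or> j = 2" using that by auto
      then show ?thesis using that h f
        by (auto simp: u_def form_commute[of M u1 u0] form_commute[of M u2 u0] form_commute[of M u2 u1])
    qed
  qed
  then show ?thesis using ac Rpos u0 u1 u2 by (intro exI[of _ m] exI[of _ u] exI[of _ R]) (auto simp: u_def)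
qed

context regular_directions
begin

text \<open>
  An interior point can be chosen different from \<open>m\<close>. Averaging the distance conditions for such a
  point over the three centers cancels the directional terms and leaves \<open>gver M R < gver M r\<close>.
\<close>
lemma circumradius_less:
  assumes r: "acute M r" and R: "acute M R" "0 < R"
    and int: "top_of_set (points M) interior_of (common M r ((\<lambda>i. gexp M m (u i) R) ` {..<3})) \<noteq> {}"
  shows "R < r"
proof -
  let ?K = "common M r ((\<lambda>i. gexp M m (u i) R) ` {..<3})"
  let ?I = "top_of_set (points M) interior_of ?K"
  obtain t where t: "t \<in> ?I" "t \<noteq> m"
  proof -
    obtain t where t: "t \<in> ?I" using int by auto
    show thesis
    proof (cases "t = m")
      case True
      have "openin (top_of_set (points M)) ?I" by simp
      then obtain U where U: "open U" "?I = points M \<inter> U" unfolding openin_open by blast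
      have "m \<in> U" using t True U by auto
      moreover have "isCont (\<lambda>s. gexp M m (u 0) s) 0"
      proof -
        have "continuous_on UNIV (\<lambda>s. gexp M m (u 0) s)" unfolding gexp_def by (intro continuous_intros)
        then show ?thesis by (simp add: continuous_on_eq_continuous_at)
      qed
      ultimately have "\<forall>\<^sub>F s in at_right 0. gexp M m (u 0) s \<in> U"
        using U(1) unfolding isCont_def
        by (intro topological_tendstoD[of _ "gexp M m (u 0) 0"]) (auto intro: tendsto_within_subset)
      then have "\<forall>\<^sub>F s in at_right 0. gexp M m (u 0) s \<in> U \<and> s \<in> {0<..<1}"
        by (intro eventually_conj eventually_at_right_real) auto
      from eventually_happens'[OF trivial_limit_at_right_real this]
      obtain s where s: "gexp M m (u 0) s \<in> U" "0 < s" "s < 1" by auto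
      have "s \<in> lengths M" using s pi_gt3 by (auto simp: lengths_def)
      then have "gdist M m (gexp M m (u 0) s) = s" by (intro gdist_gexp m_points unit_u) auto
      moreover have "gdist M m m = 0" using gdist_eq_iff[OF m_points m_points, of 0] by (auto simp: lengths_def)
      ultimately have "gexp M m (u 0) s \<noteq> m" using s by auto
      moreover have "gexp M m (u 0) s \<in> ?I" using U s gexp_points[OF m_points unit_u[of 0]] by auto
      ultimately show thesis using that by blast
    qed (use t that in blast)
  qed
  have "t \<in> ?K" by (rule subsetD[OF interior_of_subset t(1)])
  then have tP: "t \<in> points M" and le: "\<And>i. i < 3 \<Longrightarrow> haver M (gexp M m (u i) R) t \<le> gver M r" by (auto simp: common_def)
  define \<sigma> where "\<sigma> = gdist M m t"
  obtain e where e: "unit M m e" "t = gexp M m e \<sigma>" using ex_gexp[OF m_points tP] by (auto simp: \<sigma>_def)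
  have sl: "\<sigma> \<in> lengths M" using gdist_gver(2)[OF m_points tP] by (simp add: \<sigma>_def)
  have "\<sigma> \<noteq> 0" using e(2) t(2) by auto
  then have sp: "0 < \<sigma>" using sl by (simp add: lengths_def)
  have h: "haver M (gexp M m (u i) R) t = gcos M R * gver M \<sigma> + gver M R - gsin M R * gsin M \<sigma> * form M e (u i)" if "i < 3" for i
    using haver_gexp_gexp[OF m_points unit_u[OF that] e(1), of R \<sigma>] e(2) by (simp add: form_commute)
  have "haver M (gexp M m (u 0) R) t + haver M (gexp M m (u 1) R) t + haver M (gexp M m (u 2) R) t
       = 3 * (gcos M R * gver M \<sigma> + gver M R) - gsin M R * gsin M \<sigma> * (form M e (u 0) + form M e (u 1) + form M e (u 2))"
    by (simp add: h algebra_simps)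
  also have "form M e (u 0) + form M e (u 1) + form M e (u 2) = 0" by (rule sum_form_u) auto
  finally have "gcos M R * gver M \<sigma> + gver M R \<le> gver M r" using le[of 0] le[of 1] le[of 2] by simp
  moreover have "0 < gver M \<sigma>" using gver_less_iff[of 0 M \<sigma>] sl sp by (auto simp: lengths_def)
  then have "0 < gcos M R * gver M \<sigma>" using gcos_pos[OF R(1)] by simp
  ultimately have "gver M R < gver M r" by linarith
  then show ?thesis using gver_less_iff[OF acute_lengths[OF R(1)] acute_lengths[OF r]] by simp
qed

text \<open>
  If the mutual distance \<open>l\<close> of the centers is less than \<open>r\<close>, the minimal width exceeds \<open>r\<close>. The
  center \<open>q\<close> of a touching disk containing the triangle has distance at most \<open>l\<close> from every \<open>x i\<close>:
  otherwise the segment from \<open>q\<close> to \<open>x i\<close> could be prolonged by \<open>r - l\<close> inside the triangle,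
  beyond distance \<open>r\<close> from \<open>q\<close>. Hence the point that lies \<open>h \<le> r - l\<close> behind \<open>q\<close> on the normal
  geodesic belongs to the triangle, at depth \<open>r + h\<close>.
\<close>
lemma minimal_width_close_centers:
  assumes r: "acute M r" and R: "acute M R" "0 < R" "R < r"
    and close: "gcos M R * gver M R + gver M R + gsin M R * gsin M R / 2 < gver M r"
  shows "r < minimal_width M (common M r ((\<lambda>i. gexp M m (u i) R) ` {..<3}))"
proof -
  define x where "x i = gexp M m (u i) R" for i
  let ?Q = "x ` {..<3}" let ?K = "common M r ?Q"
  have x_points: "x i \<in> points M" if "i < 3" for i unfolding x_def by (rule gexp_points[OF m_points unit_u[OF that]])
  have Q: "finite ?Q" "?Q \<subseteq> points M" "?Q \<noteq> {}" using x_points by (auto simp: lessThan_empty_iff)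
  have r0: "0 < r" using R by simp
  have gver_r_pos: "0 < gver M r" using gver_less_iff[of 0 M r] r0 acute_lengths[OF r] by (auto simp: lengths_def)
  have haver_x_center: "haver M (x i) m < gver M r" if "i < 3" for i
  proof -
    have "haver M (x i) m = gver M R" using haver_gexp_self[OF m_points unit_u[OF that], of R] by (simp add: x_def haver_commute[of M _ m])
    then show ?thesis using gver_less_iff[OF acute_lengths[OF R(1)] acute_lengths[OF r]] R(3) by simp
  qed
  have mQ: "haver M q m < gver M r" if "q \<in> ?Q" for q using haver_x_center that by auto
  define l where "l = gdist M (x 0) (x 1)"
  have xx: "haver M (x i) (x j) = gcos M R * gver M R + gver M R + gsin M R * gsin M R / 2" if "i < 3" "j < 3" "i \<noteq> j" for i j
    unfolding x_def using haver_gexp_gexp[OF m_points unit_u[OF that(1)] unit_u[OF that(2)], of R R] form_u[OF that] by simp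
  have l: "l \<in> lengths M" "gver M l = haver M (x 0) (x 1)" using gdist_gver[OF x_points[of 0] x_points[of 1]] by (auto simp: l_def)
  have lr: "l < r" using gver_less_iff[OF l(1) acute_lengths[OF r]] l(2) xx[of 0 1] close by simp
  have l0: "0 \<le> l" using l(1) by (simp add: lengths_def)
  have dxx: "gdist M (x i) (x j) \<le> l" if "i < 3" "j < 3" for i j
  proof -
    have "haver M (x i) (x j) \<le> gver M l" using xx[OF that] xx[of 0 1] l(2) gver_nonneg[of M l] by (cases "i = j") auto
    then show ?thesis using gdist_le_iff[OF x_points[OF that(1)] x_points[OF that(2)] l(1)] by simp
  qed
  define h where "h = min (r - l) (if M = Spherical then (pi / 2 - r) / 2 else 1)"
  have h: "0 < h" "h \<le> r - l" "acute M (r + h)" using lr r r0 by (auto simp: h_def acute_def min_def field_simps)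
  have inK: "t \<in> ?K" if "t \<in> points M" "\<And>i. i < 3 \<Longrightarrow> gdist M (x i) t \<le> r" for t
    using that gdist_le_iff[OF x_points _ acute_lengths[OF r]] by (auto simp: common_def)
  interpret wide_set M ?K r "r + h"
  proof
    show "?K \<subseteq> points M" by (auto simp: common_def)
    show "compact ?K" by (rule compact_common[OF Q(2,3) r])
    show "acute M r" "0 < r" "acute M (r + h)" "0 < r + h" using r r0 h by auto
    show "r - (r + h) \<in> {- pi / 2<..<pi / 2} \<or> M \<noteq> Spherical" using h r0 by (auto simp: acute_def)
    fix p e assume p: "p \<in> ?K" "unit M p e" "\<And>t. t \<in> ?K \<Longrightarrow> 0 \<le> form M e (t - p)"
    have pP: "p \<in> points M" using p by (auto simp: common_def)
    have tang: "haver M (gexp M p e r) t \<le> gver M r" if "t \<in> ?K" for t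
      by (rule common_tangent_disk(2)[OF Q(1,2) r r0 m_points _ p(1,2) _ that]) (fact mQ p(3))+
    show "haver M (gexp M p e r) t \<le> gver M r" if "t \<in> ?K" for t by (rule tang[OF that])
    let ?q = "gexp M p e r" and ?t = "gexp M p e (r + h)"
    have qP: "?q \<in> points M" and tP: "?t \<in> points M" using gexp_points[OF pP p(2)] by auto
    have qK: "gdist M ?q t \<le> r" if "t \<in> ?K" for t
      using tang[OF that] that gdist_le_iff[OF qP _ acute_lengths[OF r]] by (auto simp: common_def)
    have qx: "gdist M ?q (x i) \<le> l" if i: "i < 3" for i
    proof (rule ccontr)
      assume far: "\<not> gdist M ?q (x i) \<le> l"
      define d where "d = gdist M ?q (x i)"
      obtain f where f: "unit M ?q f" "x i = gexp M ?q f d" using ex_gexp[OF qP x_points[OF i]] by (auto simp: d_def)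
      have "x i \<in> ?K" using dxx lr by (intro inK x_points[OF i]) (use i in force)
      then have dr: "d \<le> r" using qK by (simp add: d_def)
      have d0: "0 \<le> d" using gdist_nonneg[OF qP x_points[OF i]] by (simp add: d_def)
      let ?y = "gexp M ?q f (d + (r - l))"
      have yP: "?y \<in> points M" using gexp_points[OF qP f(1)] .
      have rl: "acute M (r - l)" using lr l0 by (intro acute_mono[OF r]) auto
      have "?y = gexp M (x i) (gdir M ?q f d) (r - l)" unfolding f(2) by (simp add: gexp_gexp)
      then have xy: "gdist M (x i) ?y = r - l"
        using gdist_gexp[OF x_points[OF i] _ acute_lengths[OF rl], of "gdir M ?q f d"] unit_gdir[OF qP f(1), of d] f(2) by simp
      have "?y \<in> ?K"
      proof (rule inK[OF yP])
        fix j :: nat assume j: "j < 3"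
        show "gdist M (x j) ?y \<le> r" using gdist_triangle[OF x_points[OF j] x_points[OF i] yP] dxx[OF j i] xy by linarith
      qed
      then have "gdist M ?q ?y \<le> r" by (rule qK)
      moreover have "d + (r - l) \<in> lengths M" using acute_add[OF acute_mono[OF r d0 dr] rl] .
      then have "gdist M ?q ?y = d + (r - l)" by (rule gdist_gexp[OF qP f(1)])
      ultimately show False using far by (simp add: d_def)
    qed
    have qt: "gdist M ?q ?t \<le> h"
    proof -
      have "?t = gexp M ?q (gdir M p e r) h" by (simp add: gexp_gexp)
      moreover have "h \<in> lengths M" using h r0 by (auto simp: acute_def lengths_def)
      ultimately show ?thesis using gdist_gexp[OF qP unit_gdir[OF pP p(2)], of h] by simp
    qed
    have "?t \<in> ?K"
    proof (rule inK[OF tP])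
      fix j :: nat assume j: "j < 3"
      have "gdist M (x j) ?t \<le> gdist M (x j) ?q + gdist M ?q ?t" by (rule gdist_triangle[OF x_points[OF j] qP tP])
      then show "gdist M (x j) ?t \<le> r" using qx[OF j] qt h(2) gdist_commute[OF x_points[OF j] qP] by linarith
    qed
    moreover have "form M e (?t - p) = gsin M (r + h)"
      using form_gexp[OF pP p(2), of e "r + h"] p(2) by (simp add: unit_def)
    moreover have "dual M p ?t = gcos M (r + h)"
      using p(2) points_dual[OF pP] by (simp add: gexp_def unit_def)
    ultimately show "\<exists>t\<in>?K. 0 \<le> gcos M (r + h) * form M e (t - p) - gsin M (r + h) * dual M p t \<and> gsin M (r + h) \<le> form M e (t - p)"
      by (intro bexI[of _ ?t]) (simp_all del: form_diff)
  qed
  have "m \<in> ?K" using m_points haver_x_center by (auto simp: common_def intro: less_imp_le)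
  then obtain H where "supporting_line M ?K H"
    using ex_supporting_line[OF K, of "x 0" r] x_points[of 0] r by (force simp: common_def)
  then have "r + h \<le> minimal_width M ?K" by (rule minimal_width_ge)
  then show ?thesis using h by (simp add: x_def[abs_def])
qed

end

context regular_disk_triangle
begin

lemma T_disks: "T = disk M (x 0) r \<inter> disk M (x 1) r \<inter> disk M (x 2) r"
  using x_points by (auto simp: T_def lessThan_3 common_def disk_eq r)

lemma convex_body_T: "convex_body M T"
  using ball_convex_Ks[of 0] unfolding Ks_0 ball_convex_body_def by simp

lemma minimal_width_T: "minimal_width M T = r - (R - \<tau>)"
  using minimal_width_Ks[of 0] unfolding Ks_0 by simp

text \<open>
  If a functional vanishes at the three centers, it vanishes at \<open>m\<close>, a multiple of their sum, and
  on two independent tangent vectors at \<open>m\<close>, so it is zero.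
\<close>
lemma regular_triangle_centers: "regular_triangle M (x 0) (x 1) (x 2)"
proof -
  have h: "haver M (x i) (x j) = gcos M R * gver M R + gver M R + gsin M R * gsin M R / 2" if "i < 3" "j < 3" "i \<noteq> j" for i j
    unfolding x_def using haver_gexp_gexp[OF m_points unit_u[OF that(1)] unit_u[OF that(2)], of R R] form_u[OF that] by simp
  have g: "gdist M (x i) (x j) = gdist M (x k) (x l)" if "i < 3" "j < 3" "i \<noteq> j" "k < 3" "l < 3" "k \<noteq> l" for i j k l
    using gdist_eq_iff[OF x_points[OF that(1)] x_points[OF that(2)] gdist_gver(2)[OF x_points[OF that(4)] x_points[OF that(5)]]]
      gdist_gver(1)[OF x_points[OF that(4)] x_points[OF that(5)]] h that by simp
  have "False" if n: "n \<noteq> 0" "n \<bullet> x 0 = 0" "n \<bullet> x 1 = 0" "n \<bullet> x 2 = 0" for n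
  proof -
    have s: "u 0 + u 1 + u 2 = 0" by (rule sum_u) auto
    have "x 0 + x 1 + x 2 = (3 * gcos M R) *\<^sub>R m + gsin M R *\<^sub>R (u 0 + u 1 + u 2)"
      unfolding x_def gexp_def by (simp add: vec_eq_iff algebra_simps)
    moreover have "n \<bullet> (x 0 + x 1 + x 2) = 0" using n by (simp add: inner_add_right)
    ultimately have "n \<bullet> ((3 * gcos M R) *\<^sub>R m) = 0" using s by simp
    then have nm: "n \<bullet> m = 0" using CR by simp
    have nu: "n \<bullet> u i = 0" if "n \<bullet> x i = 0" for i
      using that nm SR by (simp add: x_def gexp_def inner_add_right)
    let ?r = "rot M m (u 0)"
    have u1: "u 1 = form M (u 1) (u 0) *\<^sub>R u 0 + form M (u 1) ?r *\<^sub>R ?r"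
      by (rule tangent_decomp[OF m_points unit_u dual_mu]) auto
    have "form M (u 1) ?r \<noteq> 0"
    proof
      assume 0: "form M (u 1) ?r = 0"
      have "form M (u 1) (u 1) = form M (u 1) (u 0) * form M (u 0) (u 1) + form M (u 1) ?r * form M ?r (u 1)"
        by (rule tangent_form[OF m_points unit_u dual_mu]) auto
      then show False using 0 form_uu[of 1] form_u[of 0 1] form_u[of 1 0] by simp
    qed
    moreover have "form M (u 1) ?r * (n \<bullet> ?r) = 0"
      using arg_cong[OF u1, of "\<lambda>v. n \<bullet> v"] nu[of 0] nu[of 1] n by (simp add: inner_add_right)
    ultimately have nr: "n \<bullet> ?r = 0" by simp
    have "tpart M m n = form M (tpart M m n) (u 0) *\<^sub>R u 0 + form M (tpart M m n) ?r *\<^sub>R ?r"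
      by (rule tangent_decomp[OF m_points unit_u dual_tpart[OF m_points]]) auto
    from arg_cong[OF this, of "inner n"] have "n \<bullet> tpart M m n = 0"
      using nu[OF n(2)] nr by (simp only: inner_add_right inner_scaleR_right mult_zero_right add_0)
    then have "n \<bullet> n = 0" using nm by (simp add: tpart_def inner_diff_right)
    then show False using n(1) by simp
  qed
  then show ?thesis unfolding regular_triangle_def using x_points g by (auto 4 3)
qed

lemma is_disk_triangle_T: "is_disk_triangle M r T"
  unfolding is_disk_triangle_def using regular_triangle_centers T_disks by blast

end

text \<open>
  With \<open>R = \<tau> + (r - w)\<close> the minimal width is \<open>w\<close> by construction, and the equation that relates
  \<open>\<tau>\<close> to \<open>r\<close> is solved by the intermediate value theorem between \<open>0\<close> and \<open>w\<close>.
\<close>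
lemma ex_disk_triangle:
  assumes w: "0 < w" "w \<le> r" and r: "acute M r"
  shows "\<exists>T. is_disk_triangle M r T \<and> convex_body M T \<and> minimal_width M T = w"
proof -
  define m :: "real^3" where "m = vector [0, 0, 1]"
  define u :: "nat \<Rightarrow> real^3" where "u i = (if i = 0 then vector [1, 0, 0] else if i = Suc 0 then vector [- 1 / 2, sqrt 3 / 2, 0] else vector [- 1 / 2, - sqrt 3 / 2, 0])" for i
  have td: "regular_directions M m u"
  proof
    show "m \<in> points M" by (simp add: in_points m_def)
    show "unit M m (u i)" if "i < 3" for i
      by (auto simp: unit_def dual_def form_def u_def m_def field_simps)
    show "form M (u i) (u j) = - 1 / 2" if "i < 3" "j < 3" "i \<noteq> j" for i j
    proof -
      have "i = 0 \<or> i = 1 \<or> i = 2" "j = 0 \<or> j = 1 \<or> j = 2" using that by auto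
      then show ?thesis using that by (auto simp: form_def u_def field_simps)
    qed
  qed
  define \<rho> where "\<rho> = r - w"
  have rho: "0 \<le> \<rho>" "\<rho> < r" using w by (auto simp: \<rho>_def)
  define G where "G t = gcos M (t + \<rho>) * gver M t + gver M (t + \<rho>) + gsin M (t + \<rho>) * gsin M t / 2" for t
  have rl: "r \<in> lengths M" and rhol: "\<rho> \<in> lengths M" using acute_lengths[OF r] acute_lengths[OF acute_mono[OF r, of \<rho>]] rho by auto
  have G0: "G 0 < gver M r" using gver_less_iff[OF rhol rl] rho by (simp add: G_def)
  have aw: "acute M w" using w by (intro acute_mono[OF r]) auto
  have Gw: "gver M r < G w"
  proof -
    have "0 < gsin M r * gsin M w" using gsin_pos[OF r] gsin_pos[OF aw] w by simp
    moreover have "0 \<le> gcos M r * gver M w" using gcos_pos[OF r] gver_nonneg[of M w] by simp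
    ultimately show ?thesis by (simp add: G_def \<rho>_def)
  qed
  have "continuous_on {0..w} G" unfolding G_def by (intro continuous_intros) auto
  then obtain \<tau> where t: "0 \<le> \<tau>" "\<tau> \<le> w" "G \<tau> = gver M r" using IVT'[of G 0 "gver M r" w] G0 Gw w by auto
  have "\<tau> \<noteq> 0" "\<tau> \<noteq> w" using t(3) G0 Gw by auto
  then have t': "0 < \<tau>" "\<tau> < w" using t by auto
  interpret regular_disk_triangle M m u r "\<tau> + \<rho>" \<tau>
  proof (intro regular_disk_triangle.intro td regular_disk_triangle_axioms.intro)
    show "acute M r" "0 < \<tau>" "\<tau> \<le> \<tau> + \<rho>" "\<tau> + \<rho> < r" using r t' rho by (auto simp: \<rho>_def)
    show "gver M r = gcos M (\<tau> + \<rho>) * gver M \<tau> + gver M (\<tau> + \<rho>) + gsin M (\<tau> + \<rho>) * gsin M \<tau> / 2"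
      using t(3) by (simp add: G_def)
  qed
  have "r - (\<tau> + \<rho> - \<tau>) = w" by (simp add: \<rho>_def)
  then show ?thesis using is_disk_triangle_T convex_body_T minimal_width_T by (intro exI[of _ T]) simp
qed

text \<open>
  Here \<open>R\<close> is given, and the intermediate value theorem solves for \<open>\<tau>\<close> between \<open>0\<close> and \<open>R\<close>. At \<open>\<tau>
  = R\<close> the expression is \<open>gver\<close> of the distance of two centers, which is at least \<open>r\<close> by
  \<open>minimal_width_close_centers\<close>.
\<close>
lemma disk_triangle_structure:
  assumes T: "is_disk_triangle M r T" "convex_body M T" "minimal_width M T = w" and w: "0 < w" "w \<le> r" and r: "acute M r"
  shows "\<exists>m u R \<tau>. regular_disk_triangle M m u r R \<tau> \<and> T = regular_disk_triangle.T M m u r R \<and> r - (R - \<tau>) = w"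
proof -
  obtain a b c where abc: "regular_triangle M a b c" "T = disk M a r \<inter> disk M b r \<inter> disk M c r"
    using T(1) by (auto simp: is_disk_triangle_def)
  obtain m u R where f: "regular_directions M m u" "acute M R" "0 < R" "a = gexp M m (u 0) R" "b = gexp M m (u 1) R" "c = gexp M m (u 2) R"
    using regular_triangle_frame[OF abc(1)] by blast
  interpret regular_directions M m u by (rule f(1))
  have eq: "T = common M r ((\<lambda>i. gexp M m (u i) R) ` {..<3})"
  proof -
    have "{..<3} = {0, 1, 2::nat}" by auto
    then show ?thesis unfolding abc(2) f(4-6)
      using gexp_points[OF m_points unit_u[of 0], of R] gexp_points[OF m_points unit_u[of 1], of R] gexp_points[OF m_points unit_u[of 2], of R]
      by (auto simp: common_def disk_eq r)
  qed
  have Rr: "R < r" using circumradius_less[OF r f(2,3)] T(2) unfolding eq[symmetric] convex_body_def by blast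
  define F where "F t = gcos M R * gver M t + gver M R + gsin M R * gsin M t / 2" for t
  have "gver M r \<le> F R"
  proof (rule ccontr)
    assume "\<not> ?thesis"
    then have "r < minimal_width M T" unfolding eq by (intro minimal_width_close_centers[OF r f(2,3) Rr]) (simp add: F_def)
    then show False using T(3) w by simp
  qed
  moreover have F0: "F 0 < gver M r" using gver_less_iff[OF acute_lengths[OF f(2)] acute_lengths[OF r]] Rr by (simp add: F_def)
  moreover have "continuous_on {0..R} F" unfolding F_def by (intro continuous_intros) auto
  ultimately obtain \<tau> where t: "0 \<le> \<tau>" "\<tau> \<le> R" "F \<tau> = gver M r" using IVT'[of F 0 "gver M r" R] f(3) by auto
  have "\<tau> \<noteq> 0" using F0 t(3) by auto
  have dt: "regular_disk_triangle M m u r R \<tau>"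
  proof (intro regular_disk_triangle.intro f(1) regular_disk_triangle_axioms.intro)
    show "acute M r" "0 < \<tau>" "\<tau> \<le> R" "R < r" using r t \<open>\<tau> \<noteq> 0\<close> Rr by auto
    show "gver M r = gcos M R * gver M \<tau> + gver M R + gsin M R * gsin M \<tau> / 2" using t(3) by (simp add: F_def)
  qed
  interpret regular_disk_triangle M m u r R \<tau> by (rule dt)
  have "T = regular_disk_triangle.T M m u r R" unfolding eq T_def x_def ..
  moreover from this have "r - (R - \<tau>) = w" using minimal_width_T T(3) by simp
  ultimately show ?thesis using dt by blast
qed

section \<open>Bodies of prescribed area\<close>

text \<open>
  The parameter \<open>s\<close> realizing the area excess \<open>\<epsilon>\<close> satisfies \<open>\<epsilon> \<le> 3 * C * s\<close>, where \<open>C\<close> is the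
  Lipschitz constant of the cone volume. The range \<open>s1\<close> of parameters is the one in which both the
  width and the point \<open>P\<close> are under control.
\<close>
lemma (in regular_disk_triangle) enlarged_bodies:
  "\<exists>c>0. \<exists>\<epsilon>0>0. \<forall>\<epsilon>. 0 < \<epsilon> \<and> \<epsilon> < \<epsilon>0 \<longrightarrow>
    (\<exists>K. ball_convex_body M r K \<and> minimal_width M K = r - (R - \<tau>) \<and> area M K = area M T + \<epsilon> \<and>
         (\<forall>\<phi>. isometry_of M \<phi> \<longrightarrow> hausdorff_distance M K (\<phi> ` T) \<ge> c * \<epsilon>))"
proof -
  obtain c where c: "0 < c" "\<And>s \<phi>. 0 \<le> s \<Longrightarrow> s \<le> 1 / 2 \<Longrightarrow> rate * s \<le> cos_xi \<Longrightarrow> isometry_of M \<phi> \<Longrightarrow> c * s \<le> hausdorff_distance M (Ks s) (\<phi> ` T)"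
    using Hausdorff_bound by blast
  obtain C where C: "0 < C" "\<And>s s'. 0 \<le> s \<Longrightarrow> s \<le> 1 \<Longrightarrow> 0 \<le> s' \<Longrightarrow> s' \<le> 1 \<Longrightarrow> \<bar>vol s - vol s'\<bar> \<le> C * \<bar>s - s'\<bar>"
    using vol_lipschitz by blast
  define s1 where "s1 = min (1 / 2) (cos_xi / rate)"
  have s1: "0 < s1" "s1 \<le> 1 / 2" "rate * s1 \<le> cos_xi" using cos_xi rate by (auto simp: s1_def min_def field_simps)
  define e0 where "e0 = 3 * (vol s1 - vol 0)"
  have e0: "0 < e0" using vol_strict[of s1] s1 by (simp add: e0_def)
  have aT: "area M T = 3 * vol 0" using area_Ks[of 0] by (simp add: Ks_0)
  have cont: "continuous_on {0..s1} vol"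
  proof (rule continuous_on_iff[THEN iffD2], intro ballI allI impI)
    fix s e :: real assume s: "s \<in> {0..s1}" and e: "0 < e"
    show "\<exists>d>0. \<forall>s'\<in>{0..s1}. dist s' s < d \<longrightarrow> dist (vol s') (vol s) < e"
    proof (intro exI[of _ "e / C"] conjI ballI impI)
      show "0 < e / C" using e C by simp
      fix s' assume s': "s' \<in> {0..s1}" "dist s' s < e / C"
      have "\<bar>vol s' - vol s\<bar> \<le> C * \<bar>s' - s\<bar>" using C(2)[of s' s] s s' s1 by simp
      also have "\<dots> < e" using s'(2) C(1) by (simp add: dist_real_def field_simps)
      finally show "dist (vol s') (vol s) < e" by (simp add: dist_real_def)
    qed
  qed
  have "\<exists>K. ball_convex_body M r K \<and> minimal_width M K = r - (R - \<tau>) \<and> area M K = area M T + \<epsilon> \<and>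
         (\<forall>\<phi>. isometry_of M \<phi> \<longrightarrow> hausdorff_distance M K (\<phi> ` T) \<ge> c / (3 * C) * \<epsilon>)" if e: "0 < \<epsilon>" "\<epsilon> < e0" for \<epsilon>
  proof -
    obtain s where s: "0 \<le> s" "s \<le> s1" "vol s = vol 0 + \<epsilon> / 3"
      using IVT'[of vol 0 "vol 0 + \<epsilon> / 3" s1] cont e s1 by (auto simp: e0_def)
    have sl: "s \<le> 1" "s \<le> 1 / 2" using s s1 by auto
    have ks: "rate * s \<le> cos_xi" using mult_left_mono[OF s(2), of rate] rate s1(3) by linarith
    have "\<epsilon> / 3 \<le> C * s" using C(2)[of s 0] s sl by simp
    then have "\<epsilon> / (3 * C) \<le> s" using C(1) by (simp add: field_simps)
    then have le_s: "c / (3 * C) * \<epsilon> \<le> c * s" using c(1) mult_left_mono[of "\<epsilon> / (3 * C)" s c] by simp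
    have "area M (Ks s) = area M T + \<epsilon>" using area_Ks[OF s(1) sl(1)] s(3) aT by simp
    then show ?thesis
      using ball_convex_Ks[OF s(1) sl(1)] minimal_width_Ks[OF s(1) sl(2)] c(2)[OF s(1) sl(2) ks] le_s
      by (intro exI[of _ "Ks s"]) (auto intro: order_trans)
  qed
  moreover have "0 < c / (3 * C)" using c C by simp
  ultimately show ?thesis using e0 by blast
qed

theorem corollary5p4:
  fixes M :: geometry and w r :: real
  assumes "0 < w" and "w \<le> r" and "M = Spherical \<Longrightarrow> r < pi / 2"
  shows "\<exists>c>0. \<exists>\<epsilon>0>0. \<forall>\<epsilon>. 0 < \<epsilon> \<and> \<epsilon> < \<epsilon>0 \<longrightarrow>
    (\<exists>K. ball_convex_body M r K \<and> minimal_width M K = w \<and>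
         area M K = area M (disk_triangle M w r) + \<epsilon> \<and>
         (\<forall>\<phi>. isometry_of M \<phi> \<longrightarrow>
            hausdorff_distance M K (\<phi> ` disk_triangle M w r) \<ge> c * \<epsilon>))"
proof -
  have r: "acute M r" using assms by (auto simp: acute_def)
  let ?T = "disk_triangle M w r"
  have "is_disk_triangle M r ?T \<and> convex_body M ?T \<and> minimal_width M ?T = w"
    unfolding disk_triangle_def by (rule someI_ex[OF ex_disk_triangle[OF assms(1,2) r]])
  then obtain m u R \<tau> where d: "regular_disk_triangle M m u r R \<tau>" and T: "?T = regular_disk_triangle.T M m u r R" and w: "r - (R - \<tau>) = w"
    using disk_triangle_structure assms(1,2) r by metis
  show ?thesis using regular_disk_triangle.enlarged_bodies[OF d] unfolding T w .
qed

end
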